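(* Assume $\mathsf{RL}$. Then there is no $\Sigma_1$-elementary $j:V\to V$ which is definable from parameters. That is, for every formula $\varphi$ and every set $p$, the class $\{(x,y):\varphi(p,x,y)\}$ is not a $\Sigma_1$-elementary map from $V$ to $V$.
   Context: $\mathsf{RL}$ (Rank Limit) is the first-order theory in the language of set theory consisting of Empty Set, Extensionality, Foundation, Pairing, Union, Power Set, Separation (for all formulas, with parameters), together with: "for every ordinal $\alpha$, $\alpha+1$ exists, $V_\alpha$ exists and $\langle V_\beta\rangle_{\beta<\alpha}$ exists", and "for every $x$ there is an ordinal $\alpha$ with $x\in V_\alpha$". (It holds in $V_\lambda$ for every limit $\lambda$.) The theorem is a scheme, one instance per formula $\varphi$.
   Formalization: The map j is required to be different from the identity, since the identity is itself Σ₁-elementary and definable (by the formula x = y), so the statement fails literally without this standing convention. *)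

theory Defs
  imports Main
begin

datatype fm = Mem nat nat | Eq nat nat | Neg fm | And fm fm | Ex nat fm

primrec sat :: "('a \<Rightarrow> 'a \<Rightarrow> bool) \<Rightarrow> (nat \<Rightarrow> 'a) \<Rightarrow> fm \<Rightarrow> bool" where
  "sat mem s (Mem m n) \<longleftrightarrow> mem (s m) (s n)"
| "sat mem s (Eq m n) \<longleftrightarrow> s m = s n"
| "sat mem s (Neg \<phi>) \<longleftrightarrow> \<not> sat mem s \<phi>"
| "sat mem s (And \<phi> \<psi>) \<longleftrightarrow> sat mem s \<phi> \<and> sat mem s \<psi>"
| "sat mem s (Ex n \<phi>) \<longleftrightarrow> (\<exists>x. sat mem (s(n := x)) \<phi>)"

inductive Delta0 :: "fm \<Rightarrow> bool" where
  "Delta0 (Mem m n)"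
| "Delta0 (Eq m n)"
| "Delta0 \<phi> \<Longrightarrow> Delta0 (Neg \<phi>)"
| "Delta0 \<phi> \<Longrightarrow> Delta0 \<psi> \<Longrightarrow> Delta0 (And \<phi> \<psi>)"
| "Delta0 \<phi> \<Longrightarrow> n \<noteq> m \<Longrightarrow> Delta0 (Ex n (And (Mem n m) \<phi>))"

inductive Sigma1 :: "fm \<Rightarrow> bool" where
  "Delta0 \<phi> \<Longrightarrow> Sigma1 \<phi>"
| "Sigma1 \<phi> \<Longrightarrow> Sigma1 (Ex n \<phi>)"

definition Sigma1_elementary :: "('a \<Rightarrow> 'a \<Rightarrow> bool) \<Rightarrow> ('a \<Rightarrow> 'a) \<Rightarrow> bool" where
  "Sigma1_elementary mem j \<longleftrightarrow>
    (\<forall>\<psi> s. Sigma1 \<psi> \<longrightarrow> (sat mem s \<psi> \<longleftrightarrow> sat mem (j \<circ> s) \<psi>))"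

text \<open>The class of all \<open>(x, y)\<close> with \<open>\<phi>(p, x, y)\<close>: variable 1 denotes \<open>x\<close>, variable 2
  denotes \<open>y\<close>, and every other variable denotes \<open>p\<close>, so that no restriction on the free
  variables of \<open>\<phi>\<close> is needed.\<close>

definition defined_class :: "('a \<Rightarrow> 'a \<Rightarrow> bool) \<Rightarrow> fm \<Rightarrow> 'a \<Rightarrow> ('a \<times> 'a) set" where
  "defined_class mem \<phi> p = {(x, y). sat mem ((\<lambda>_. p)(1 := x, 2 := y)) \<phi>}"

text \<open>The universe of a structure is the whole type \<open>'a\<close>. All the notions below are first-order
  over \<open>(UNIV, \<epsilon>)\<close>: quantifiers range over elements of the structure only.\<close>

locale set_structure =
  fixes mem :: "'a \<Rightarrow> 'a \<Rightarrow> bool"  (infix "\<epsilon>" 50)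
begin

definition is_empty :: "'a \<Rightarrow> bool" where
  "is_empty x \<longleftrightarrow> (\<forall>w. \<not> w \<epsilon> x)"

definition subset_of :: "'a \<Rightarrow> 'a \<Rightarrow> bool" where
  "subset_of x y \<longleftrightarrow> (\<forall>w. w \<epsilon> x \<longrightarrow> w \<epsilon> y)"

definition is_upair :: "'a \<Rightarrow> 'a \<Rightarrow> 'a \<Rightarrow> bool" where
  "is_upair z x y \<longleftrightarrow> (\<forall>w. w \<epsilon> z \<longleftrightarrow> w = x \<or> w = y)"

definition is_opair :: "'a \<Rightarrow> 'a \<Rightarrow> 'a \<Rightarrow> bool" where
  "is_opair z x y \<longleftrightarrow> (\<exists>a b. is_upair a x x \<and> is_upair b x y \<and> is_upair z a b)"

definition is_Union :: "'a \<Rightarrow> 'a \<Rightarrow> bool" where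
  "is_Union u x \<longleftrightarrow> (\<forall>w. w \<epsilon> u \<longleftrightarrow> (\<exists>y. y \<epsilon> x \<and> w \<epsilon> y))"

definition is_Pow :: "'a \<Rightarrow> 'a \<Rightarrow> bool" where
  "is_Pow u x \<longleftrightarrow> (\<forall>w. w \<epsilon> u \<longleftrightarrow> subset_of w x)"

definition is_succ :: "'a \<Rightarrow> 'a \<Rightarrow> bool" where
  "is_succ s a \<longleftrightarrow> (\<forall>w. w \<epsilon> s \<longleftrightarrow> w \<epsilon> a \<or> w = a)"

text \<open>In the presence of Foundation, the elements of an ordinal are well-ordered by membership
  as soon as they are linearly ordered.\<close>

definition is_Ord :: "'a \<Rightarrow> bool" where
  "is_Ord a \<longleftrightarrow>
    (\<forall>x. x \<epsilon> a \<longrightarrow> subset_of x a) \<and>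
    (\<forall>x y. x \<epsilon> a \<longrightarrow> y \<epsilon> a \<longrightarrow> x \<epsilon> y \<or> x = y \<or> y \<epsilon> x)"

definition is_Limit :: "'a \<Rightarrow> bool" where
  "is_Limit a \<longleftrightarrow> is_Ord a \<and> \<not> is_empty a \<and> \<not> (\<exists>b. is_succ a b)"

definition maps_to :: "'a \<Rightarrow> 'a \<Rightarrow> 'a \<Rightarrow> bool" where
  "maps_to f x y \<longleftrightarrow> (\<exists>z. z \<epsilon> f \<and> is_opair z x y)"

definition is_function_on :: "'a \<Rightarrow> 'a \<Rightarrow> bool" where
  "is_function_on f a \<longleftrightarrow>
    (\<forall>z. z \<epsilon> f \<longrightarrow> (\<exists>x y. x \<epsilon> a \<and> is_opair z x y)) \<and>
    (\<forall>x. x \<epsilon> a \<longrightarrow> (\<exists>!y. maps_to f x y))"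

definition V_recursion :: "'a \<Rightarrow> 'a \<Rightarrow> bool" where
  "V_recursion f a \<longleftrightarrow> is_function_on f a \<and>
    (\<forall>b y. b \<epsilon> a \<longrightarrow> maps_to f b y \<longrightarrow>
      (is_empty b \<longrightarrow> is_empty y) \<and>
      (\<forall>c u. is_succ b c \<longrightarrow> maps_to f c u \<longrightarrow> is_Pow y u) \<and>
      (is_Limit b \<longrightarrow> (\<forall>w. w \<epsilon> y \<longleftrightarrow> (\<exists>c u. c \<epsilon> b \<and> maps_to f c u \<and> w \<epsilon> u))))"

text \<open>\<open>is_V v a\<close> says that \<open>v\<close> is the rank initial segment \<open>V\<^sub>a\<close>, as witnessed by a function on
  \<open>a + 1\<close> obeying the recursion.\<close>

definition is_V :: "'a \<Rightarrow> 'a \<Rightarrow> bool" where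
  "is_V v a \<longleftrightarrow> is_Ord a \<and> (\<exists>s f. is_succ s a \<and> V_recursion f s \<and> maps_to f a v)"

definition is_V_sequence :: "'a \<Rightarrow> 'a \<Rightarrow> bool" where
  "is_V_sequence f a \<longleftrightarrow> is_function_on f a \<and>
    (\<forall>b y. b \<epsilon> a \<longrightarrow> (maps_to f b y \<longleftrightarrow> is_V y b))"

end

text \<open>Models of the theory Rank Limit. In Separation, the assignment \<open>s\<close> supplies the
  parameters.\<close>

locale RL = set_structure +
  assumes empty_set: "\<exists>x. is_empty x"
    and extensionality: "(\<forall>w. w \<epsilon> x \<longleftrightarrow> w \<epsilon> y) \<Longrightarrow> x = y"
    and foundation: "\<not> is_empty x \<Longrightarrow> \<exists>y. y \<epsilon> x \<and> \<not> (\<exists>w. w \<epsilon> y \<and> w \<epsilon> x)"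
    and pairing: "\<exists>z. is_upair z x y"
    and union: "\<exists>u. is_Union u x"
    and power_set: "\<exists>u. is_Pow u x"
    and separation: "\<exists>y. \<forall>w. w \<epsilon> y \<longleftrightarrow> w \<epsilon> x \<and> sat mem (s(n := w)) \<phi>"
    and succ_exists: "is_Ord a \<Longrightarrow> \<exists>b. is_succ b a"
    and V_exists: "is_Ord a \<Longrightarrow> \<exists>v. is_V v a"
    and V_sequence_exists: "is_Ord a \<Longrightarrow> \<exists>f. is_V_sequence f a"
    and ranked: "\<exists>a v. is_Ord a \<and> is_V v a \<and> x \<epsilon> v"

end

theory Submission
  imports Defs
begin

text \<open>Write \<open>A\<^sup>+(C)\<close> for the union of the sets \<open>A(C \<inter> v)\<close> over all sets \<open>v\<close>, where \<open>C\<close> is a definable class. A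
  \<open>\<Sigma>\<^sub>1\<close>-elementary \<open>j\<close> is cofinal, but without Replacement it need not be fully elementary: an
  existential quantifier is lost if \<open>j\<close> is discontinuous at the (definable) cofinality of the universe.
  This is repaired by passing to an iterate \<open>j\<^sub>n = (j\<^sup>n)\<^sup>+(j)\<close>. For every prewellordered set \<open>R\<close> some
  \<open>j\<^sub>n\<close> maps \<open>R\<close> cofinally into \<open>j\<^sub>n(R)\<close>: take a least counterexample, apply \<open>j\<close> to its minimality, and
  use that \<open>j\<close> embeds \<open>R\<close> cofinally into a proper initial segment of \<open>j(R)\<close>. If \<open>R\<close> measures the growth
  of a definable class whose witnesses are unbounded, such a \<open>j\<^sub>n\<close> is fully elementary; if there is no
  such class, then Collection holds and \<open>j\<close> itself is. The properties used, namely preservation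
  of finitely many bounded relations, cofinality and continuity at some unbounded class from
  a fixed family, are first-order in the parameter. As in Suzuki's theorem, the least rank at which
  an embedding from this family moves a set is definable without parameters,
  hence fixed by the embedding that attains it, which is absurd.\<close>

text \<open>The structure is an arbitrary model, so its numbers may be nonstandard. The index of the
  repairing iterate is found by applying \<open>j\<close> to an existential statement of the
  structure and need not be a true natural number. Hence \<open>j^n\<close> is computed inside, by
  set-coded chains, and facts about all \<open>n\<close> are proved by induction on definable
  predicates only. No axiom of Infinity is available; the numbers come from the critical point,
  whose level is closed under singletons.

  Why continuity is the repair: let \<open>b\<close> be the set of all \<open>t\<close> in
  \<open>a\<close> that have a witness, and \<open>b_v\<close> those with a witness in the level
  \<open>v\<close>. Bounded preservation controls each \<open>k(b_v)\<close>, but an element of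
  \<open>k(b)\<close> outside all \<open>k(b_v)\<close> has no witness. Continuity makes
  \<open>k(b)\<close> the union of the \<open>k(b_v)\<close>.

  The iterates are weaker than \<open>j\<close>: they are only shown to be cofinal and to preserve
  bounded formulas. Well-foundedness is therefore moved by \<open>j\<close> alone, and whatever an
  iterate moves is phrased as a bounded statement about sets, with restrictions of maps coded by
  their graphs.\<close>

primrec vbound :: "fm \<Rightarrow> nat" where
  "vbound (Mem m n) = Suc (max m n)"
| "vbound (Eq m n) = Suc (max m n)"
| "vbound (Neg \<phi>) = vbound \<phi>"
| "vbound (And \<phi> \<psi>) = max (vbound \<phi>) (vbound \<psi>)"
| "vbound (Ex n \<phi>) = max (Suc n) (vbound \<phi>)"

lemma sat_cong: "(\<And>i. i < vbound \<phi> \<Longrightarrow> s i = t i) \<Longrightarrow> sat mem s \<phi> = sat mem t \<phi>"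
proof (induction \<phi> arbitrary: s t)
  case (Ex n \<phi>)
  have "sat mem (s(n := x)) \<phi> = sat mem (t(n := x)) \<phi>" for x
    by (rule Ex.IH) (use Ex.prems in auto)
  then show ?case by simp
next
  case (And \<phi> \<psi>)
  have "sat mem s \<phi> = sat mem t \<phi>" "sat mem s \<psi> = sat mem t \<psi>"
    using And.prems by (auto intro!: And.IH)
  then show ?case by simp
next
  case (Neg \<phi>)
  have "sat mem s \<phi> = sat mem t \<phi>" by (rule Neg.IH) (use Neg.prems in auto)
  then show ?case by simp
qed auto

lemma fresh_index: "\<exists>m::nat. m \<noteq> k \<and> (\<forall>i<b::nat. f i \<noteq> m)"
proof -
  have "finite (insert k (f ` {..<b}))" by simp
  then obtain m where "m \<notin> insert k (f ` {..<b})" using ex_new_if_finite infinite_UNIV_nat by blast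
  then show ?thesis by blast
qed

text \<open>Avoidance of capture: \<open>m\<close> is not a value of \<open>\<rho>\<close> on the
  variables of \<open>\<phi>\<close>, so storing \<open>x\<close> there disturbs no other
  variable.\<close>

lemma sat_rename_binder:
  assumes "\<forall>i<vbound \<phi>. \<rho> i \<noteq> m"
  shows "sat mem (\<lambda>i. (s(m := x)) ((\<rho>(n := m)) i)) \<phi> = sat mem ((\<lambda>i. s (\<rho> i))(n := x)) \<phi>"
  by (rule sat_cong) (use assms in auto)

lemma rename_fm: "\<exists>\<phi>'. \<forall>s. sat mem s \<phi>' = sat mem (\<lambda>i. s (\<rho> i)) \<phi>"
proof (induction \<phi> arbitrary: \<rho>)
  case (Mem m n)
  show ?case by (rule exI[of _ "Mem (\<rho> m) (\<rho> n)"]) simp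
next
  case (Eq m n)
  show ?case by (rule exI[of _ "Eq (\<rho> m) (\<rho> n)"]) simp
next
  case (Neg \<phi>)
  obtain \<phi>' where "\<forall>s. sat mem s \<phi>' = sat mem (\<lambda>i. s (\<rho> i)) \<phi>" using Neg[of \<rho>] by blast
  then show ?case by (intro exI[of _ "Neg \<phi>'"]) simp
next
  case (And \<phi> \<psi>)
  obtain \<phi>' where "\<forall>s. sat mem s \<phi>' = sat mem (\<lambda>i. s (\<rho> i)) \<phi>" using And.IH(1)[of \<rho>] by blast
  moreover obtain \<psi>' where "\<forall>s. sat mem s \<psi>' = sat mem (\<lambda>i. s (\<rho> i)) \<psi>" using And.IH(2)[of \<rho>] by blast
  ultimately show ?case by (intro exI[of _ "And \<phi>' \<psi>'"]) simp
next
  case (Ex n \<phi>)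
  obtain m where m: "\<forall>i<vbound \<phi>. \<rho> i \<noteq> m" using fresh_index[of 0 "vbound \<phi>" \<rho>] by blast
  obtain \<phi>' where "\<forall>s. sat mem s \<phi>' = sat mem (\<lambda>i. s ((\<rho>(n := m)) i)) \<phi>" using Ex[of "\<rho>(n := m)"] by blast
  then have "sat mem (s(m := x)) \<phi>' = sat mem ((\<lambda>i. s (\<rho> i))(n := x)) \<phi>" for s x
    using sat_rename_binder[OF m, of mem s x n] by (simp only:)
  then show ?case by (intro exI[of _ "Ex m \<phi>'"]) simp
qed

lemma rename_Delta0:
  "Delta0 \<phi> \<Longrightarrow> \<exists>\<phi>'. Delta0 \<phi>' \<and> (\<forall>s. sat mem s \<phi>' = sat mem (\<lambda>i. s (\<rho> i)) \<phi>)"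
proof (induction \<phi> arbitrary: \<rho> rule: Delta0.induct)
  case (1 m n)
  show ?case by (rule exI[of _ "Mem (\<rho> m) (\<rho> n)"]) (simp add: Delta0.intros)
next
  case (2 m n)
  show ?case by (rule exI[of _ "Eq (\<rho> m) (\<rho> n)"]) (simp add: Delta0.intros)
next
  case (3 \<phi>)
  obtain \<phi>' where "Delta0 \<phi>'" "\<forall>s. sat mem s \<phi>' = sat mem (\<lambda>i. s (\<rho> i)) \<phi>"
    using 3(2)[of \<rho>] by blast
  then show ?case by (intro exI[of _ "Neg \<phi>'"]) (simp add: Delta0.intros)
next
  case (4 \<phi> \<psi>)
  obtain \<phi>' where "Delta0 \<phi>'" "\<forall>s. sat mem s \<phi>' = sat mem (\<lambda>i. s (\<rho> i)) \<phi>"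
    using 4(3)[of \<rho>] by blast
  moreover obtain \<psi>' where "Delta0 \<psi>'" "\<forall>s. sat mem s \<psi>' = sat mem (\<lambda>i. s (\<rho> i)) \<psi>"
    using 4(4)[of \<rho>] by blast
  ultimately show ?case by (intro exI[of _ "And \<phi>' \<psi>'"]) (simp add: Delta0.intros)
next
  case (5 \<phi> n k)
  obtain m where m: "m \<noteq> \<rho> k" "\<forall>i<vbound \<phi>. \<rho> i \<noteq> m"
    using fresh_index[of "\<rho> k" "vbound \<phi>" \<rho>] by blast
  obtain \<phi>' where \<phi>': "Delta0 \<phi>'" "\<forall>s. sat mem s \<phi>' = sat mem (\<lambda>i. s ((\<rho>(n := m)) i)) \<phi>"
    using 5(3)[of "\<rho>(n := m)"] by blast
  then have "sat mem (s(m := x)) \<phi>' = sat mem ((\<lambda>i. s (\<rho> i))(n := x)) \<phi>" for s x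
    using sat_rename_binder[OF m(2), of mem s x n] by (simp only:)
  then show ?case
    using \<phi>'(1) m(1) 5(2)
    by (intro exI[of _ "Ex m (And (Mem m (\<rho> k)) \<phi>')"]) (simp add: Delta0.intros)
qed

lemma sat_de_Bruijn_binder:
  assumes "vbound \<phi> \<le> m"
  shows "sat mem (\<lambda>i. (s(m := x)) ((case_nat m (\<lambda>i. i)) i)) \<phi> = sat mem (case_nat x s) \<phi>"
  by (rule sat_cong) (use assms in \<open>auto split: nat.split\<close>)

lemma de_Bruijn_Ex:
  "\<exists>\<phi>'. \<forall>s. sat mem s \<phi>' \<longleftrightarrow> (\<exists>x. sat mem (case_nat x s) \<phi>)"
proof -
  obtain \<phi>' where "\<forall>s. sat mem s \<phi>' = sat mem (\<lambda>i. s ((case_nat (vbound \<phi>) (\<lambda>i. i)) i)) \<phi>"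
    using rename_fm[of mem "case_nat (vbound \<phi>) (\<lambda>i. i)" \<phi>] by blast
  then have "sat mem (s(vbound \<phi> := x)) \<phi>' = sat mem (case_nat x s) \<phi>" for s x
    using sat_de_Bruijn_binder[OF order_refl, of mem s \<phi> x] by (simp only:)
  then show ?thesis by (intro exI[of _ "Ex (vbound \<phi>) \<phi>'"]) simp
qed

lemma de_Bruijn_Ex_Sigma1:
  assumes "Delta0 \<phi>"
  shows "\<exists>\<phi>'. Sigma1 \<phi>' \<and> (\<forall>s. sat mem s \<phi>' \<longleftrightarrow> (\<exists>x. sat mem (case_nat x s) \<phi>))"
proof -
  obtain \<phi>' where \<phi>': "Delta0 \<phi>'"
    "\<forall>s. sat mem s \<phi>' = sat mem (\<lambda>i. s ((case_nat (vbound \<phi>) (\<lambda>i. i)) i)) \<phi>"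
    using rename_Delta0[OF assms, of mem "case_nat (vbound \<phi>) (\<lambda>i. i)"] by blast
  then have "sat mem (s(vbound \<phi> := x)) \<phi>' = sat mem (case_nat x s) \<phi>" for s x
    using sat_de_Bruijn_binder[OF order_refl, of mem s \<phi> x] by (simp only:)
  then show ?thesis
    using \<phi>'(1) by (intro exI[of _ "Ex (vbound \<phi>) \<phi>'"]) (simp add: Sigma1.intros)
qed

lemma de_Bruijn_bounded_Ex:
  assumes "Delta0 \<phi>"
  shows "\<exists>\<phi>'. Delta0 \<phi>' \<and> (\<forall>s. sat mem s \<phi>' \<longleftrightarrow> (\<exists>x. mem x (s n) \<and> sat mem (case_nat x s) \<phi>))"
proof -
  \<comment> \<open>\<open>m\<close> must differ from \<open>n\<close> as well, since a
    \<open>Delta0\<close> quantifier may not be bounded by its own variable.\<close>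
  define m where "m = max (Suc n) (vbound \<phi>)"
  obtain \<phi>' where \<phi>': "Delta0 \<phi>'" "\<forall>s. sat mem s \<phi>' = sat mem (\<lambda>i. s ((case_nat m (\<lambda>i. i)) i)) \<phi>"
    using rename_Delta0[OF assms, of mem "case_nat m (\<lambda>i. i)"] by blast
  have m: "m \<noteq> n" "vbound \<phi> \<le> m" by (auto simp: m_def)
  have "sat mem (s(m := x)) \<phi>' = sat mem (case_nat x s) \<phi>" for s x
    using \<phi>'(2) sat_de_Bruijn_binder[OF m(2), of mem s x] by (simp only:)
  then show ?thesis
    using \<phi>'(1) m(1) by (intro exI[of _ "Ex m (And (Mem m n) \<phi>')"]) (simp add: Delta0.intros)
qed

section \<open>Definable predicates on assignments\<close>

context set_structure
begin

text \<open>Quantifiers are handled in de Bruijn style: \<open>case_nat x s\<close> extends the assignment \<open>s\<close> by \<open>x\<close> at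
  index 0.\<close>

definition Fm :: "((nat \<Rightarrow> 'a) \<Rightarrow> bool) \<Rightarrow> bool" where
  "Fm P \<longleftrightarrow> (\<exists>\<phi>. \<forall>s. sat mem s \<phi> = P s)"

definition D0 :: "((nat \<Rightarrow> 'a) \<Rightarrow> bool) \<Rightarrow> bool" where
  "D0 P \<longleftrightarrow> (\<exists>\<phi>. Delta0 \<phi> \<and> (\<forall>s. sat mem s \<phi> = P s))"

lemma D0_imp_Fm: "D0 P \<Longrightarrow> Fm P"
  unfolding D0_def Fm_def by blast

lemma Fm_rename: "Fm P \<Longrightarrow> Fm (\<lambda>s. P (\<lambda>i. s (\<rho> i)))"
proof -
  assume "Fm P"
  then obtain \<phi> where "\<And>s. sat mem s \<phi> = P s" unfolding Fm_def by blast
  then show ?thesis unfolding Fm_def using rename_fm[of mem \<rho> \<phi>] by simp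
qed

lemma D0_rename: "D0 P \<Longrightarrow> D0 (\<lambda>s. P (\<lambda>i. s (\<rho> i)))"
proof -
  assume "D0 P"
  then obtain \<phi> where "Delta0 \<phi>" "\<And>s. sat mem s \<phi> = P s" unfolding D0_def by blast
  then show ?thesis unfolding D0_def using rename_Delta0[of \<phi> mem \<rho>] by simp
qed

lemma Fm_not: "Fm P \<Longrightarrow> Fm (\<lambda>s. \<not> P s)"
proof -
  assume "Fm P"
  then obtain \<phi> where "\<And>s. sat mem s \<phi> = P s" unfolding Fm_def by blast
  then show ?thesis unfolding Fm_def by (intro exI[of _ "Neg \<phi>"]) simp
qed

lemma Fm_conj: "Fm P \<Longrightarrow> Fm Q \<Longrightarrow> Fm (\<lambda>s. P s \<and> Q s)"
proof -
  assume "Fm P" "Fm Q"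
  then obtain \<phi> \<psi> where "\<And>s. sat mem s \<phi> = P s" "\<And>s. sat mem s \<psi> = Q s"
    unfolding Fm_def by blast
  then show ?thesis unfolding Fm_def by (intro exI[of _ "And \<phi> \<psi>"]) simp
qed

lemma Fm_Ex: "Fm P \<Longrightarrow> Fm (\<lambda>s. \<exists>x. P (case_nat x s))"
proof -
  assume "Fm P"
  then obtain \<phi> where "\<And>s. sat mem s \<phi> = P s" unfolding Fm_def by blast
  then show ?thesis unfolding Fm_def using de_Bruijn_Ex[of mem \<phi>] by simp
qed

subsection \<open>Bounded formulas\<close>

text \<open>A variable viewed as a function of the assignment: passing under a quantifier becomes an
  index shift, and the closure rules can be chained backwards.\<close>

definition Var :: "((nat \<Rightarrow> 'a) \<Rightarrow> 'a) \<Rightarrow> bool" where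
  "Var f \<longleftrightarrow> (\<exists>n. f = (\<lambda>s. s n))"

lemma Var_index: "Var (\<lambda>s. s n)"
  unfolding Var_def by blast

lemma Var_lift: "Var f \<Longrightarrow> Var (\<lambda>s. f (\<lambda>n. s (Suc n)))"
  unfolding Var_def by auto

lemma D0_mem: "Var f \<Longrightarrow> Var g \<Longrightarrow> D0 (\<lambda>s. f s \<epsilon> g s)"
proof -
  assume "Var f" "Var g"
  then obtain m n where "f = (\<lambda>s. s m)" "g = (\<lambda>s. s n)" unfolding Var_def by blast
  then show ?thesis unfolding D0_def by (intro exI[of _ "Mem m n"]) (simp add: Delta0.intros)
qed

lemma D0_eq: "Var f \<Longrightarrow> Var g \<Longrightarrow> D0 (\<lambda>s. f s = g s)"
proof -
  assume "Var f" "Var g"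
  then obtain m n where "f = (\<lambda>s. s m)" "g = (\<lambda>s. s n)" unfolding Var_def by blast
  then show ?thesis unfolding D0_def by (intro exI[of _ "Eq m n"]) (simp add: Delta0.intros)
qed

lemma D0_not: "D0 P \<Longrightarrow> D0 (\<lambda>s. \<not> P s)"
proof -
  assume "D0 P"
  then obtain \<phi> where "Delta0 \<phi>" "\<And>s. sat mem s \<phi> = P s" unfolding D0_def by blast
  then show ?thesis unfolding D0_def by (intro exI[of _ "Neg \<phi>"]) (simp add: Delta0.intros)
qed

lemma D0_conj: "D0 P \<Longrightarrow> D0 Q \<Longrightarrow> D0 (\<lambda>s. P s \<and> Q s)"
proof -
  assume "D0 P" "D0 Q"
  then obtain \<phi> \<psi> where "Delta0 \<phi>" "\<And>s. sat mem s \<phi> = P s" "Delta0 \<psi>" "\<And>s. sat mem s \<psi> = Q s"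
    unfolding D0_def by blast
  then show ?thesis unfolding D0_def by (intro exI[of _ "And \<phi> \<psi>"]) (simp add: Delta0.intros)
qed

lemma D0_disj: "D0 P \<Longrightarrow> D0 Q \<Longrightarrow> D0 (\<lambda>s. P s \<or> Q s)"
  using D0_not[OF D0_conj[OF D0_not[of P] D0_not[of Q]]] by simp

lemma D0_imp: "D0 P \<Longrightarrow> D0 Q \<Longrightarrow> D0 (\<lambda>s. P s \<longrightarrow> Q s)"
  unfolding imp_conv_disj by (intro D0_disj D0_not)

lemma D0_iff: "D0 P \<Longrightarrow> D0 Q \<Longrightarrow> D0 (\<lambda>s. P s \<longleftrightarrow> Q s)"
  unfolding iff_conv_conj_imp by (intro D0_conj D0_imp)

lemma D0_bex:
  assumes "Var g" "D0 (\<lambda>s. P (s 0) (\<lambda>n. s (Suc n)))"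
  shows "D0 (\<lambda>s. \<exists>x. x \<epsilon> g s \<and> P x s)"
proof -
  obtain \<phi> n where "Delta0 \<phi>" and \<phi>: "\<And>s. sat mem s \<phi> = P (s 0) (\<lambda>n. s (Suc n))"
    and n: "g = (\<lambda>s. s n)"
    using assms unfolding D0_def Var_def by blast
  have "sat mem (case_nat x s) \<phi> = P x s" for x s
    using \<phi>[of "case_nat x s"] by simp
  then show ?thesis
    using de_Bruijn_bounded_Ex[OF \<open>Delta0 \<phi>\<close>, of mem n] n unfolding D0_def by auto
qed

lemma D0_ball:
  assumes "Var g" "D0 (\<lambda>s. P (s 0) (\<lambda>n. s (Suc n)))"
  shows "D0 (\<lambda>s. \<forall>x. x \<epsilon> g s \<longrightarrow> P x s)"
  using D0_not[OF D0_bex[OF assms(1) D0_not[OF assms(2)]]] by simp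

lemma D0_subset: "Var f \<Longrightarrow> Var g \<Longrightarrow> D0 (\<lambda>s. subset_of (f s) (g s))"
  unfolding subset_of_def by (intro D0_ball D0_mem Var_index Var_lift)

lemma D0_upair: "Var f \<Longrightarrow> Var g \<Longrightarrow> Var h \<Longrightarrow> D0 (\<lambda>s. is_upair (f s) (g s) (h s))"
proof -
  assume v: "Var f" "Var g" "Var h"
  have "is_upair z x y \<longleftrightarrow> x \<epsilon> z \<and> y \<epsilon> z \<and> (\<forall>w. w \<epsilon> z \<longrightarrow> w = x \<or> w = y)" for x y z
    unfolding is_upair_def by blast
  then show ?thesis
    by (simp only:) (intro D0_ball D0_mem D0_conj D0_disj D0_eq Var_index Var_lift v)
qed

lemma D0_opair: "Var f \<Longrightarrow> Var g \<Longrightarrow> Var h \<Longrightarrow> D0 (\<lambda>s. is_opair (f s) (g s) (h s))"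
proof -
  assume v: "Var f" "Var g" "Var h"
  have "is_opair z x y \<longleftrightarrow> (\<exists>a. a \<epsilon> z \<and> (\<exists>b. b \<epsilon> z \<and> is_upair a x x \<and> is_upair b x y \<and> is_upair z a b))" for x y z
    unfolding is_opair_def is_upair_def by blast
  then show ?thesis
    by (simp only:) (intro D0_bex D0_conj D0_upair Var_index Var_lift v)
qed

subsection \<open>Definability with constants\<close>

text \<open>The constants \<open>l\<close> occupy the first places of the assignment.
  \<open>C = UNIV\<close> allows all parameters, \<open>C = {}\<close> none; the final argument
  depends on the difference, because only parameter-free properties are transferred by an elementary
  map without moving a parameter.\<close>

definition Def :: "'a set \<Rightarrow> ((nat \<Rightarrow> 'a) \<Rightarrow> bool) \<Rightarrow> bool" where
  "Def C P \<longleftrightarrow> (\<exists>Q l. set l \<subseteq> C \<and> Fm Q \<and> P = (\<lambda>s. Q (foldr case_nat l s)))"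

lemma foldr_case_nat: "foldr case_nat l s i = (if i < length l then l ! i else s (i - length l))"
  by (induction l arbitrary: i) (auto split: nat.split)

lemma Def_empty: "Def {} P \<longleftrightarrow> Fm P"
  unfolding Def_def by auto

lemma Fm_imp_Def: "Fm P \<Longrightarrow> Def C P"
  unfolding Def_def by (intro exI[of _ P] exI[of _ "[]"]) auto

lemma Def_rename:
  assumes "Def C P"
  shows "Def C (\<lambda>s. P (\<lambda>i. s (\<rho> i)))"
proof -
  obtain Q l where l: "set l \<subseteq> C" and Q: "Fm Q" and P: "P = (\<lambda>s. Q (foldr case_nat l s))"
    using assms unfolding Def_def by blast
  define \<sigma> where "\<sigma> i = (if i < length l then i else length l + \<rho> (i - length l))" for i
  have "P (\<lambda>i. s (\<rho> i)) = Q (\<lambda>i. foldr case_nat l s (\<sigma> i))" for s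
    unfolding P by (rule arg_cong[of _ _ Q]) (auto simp: fun_eq_iff foldr_case_nat \<sigma>_def)
  then show ?thesis unfolding Def_def using l Fm_rename[OF Q, of \<sigma>] by blast
qed

lemma Def_not: "Def C P \<Longrightarrow> Def C (\<lambda>s. \<not> P s)"
proof -
  assume "Def C P"
  then obtain Q l where "set l \<subseteq> C" "Fm Q" "P = (\<lambda>s. Q (foldr case_nat l s))"
    unfolding Def_def by blast
  then show ?thesis
    unfolding Def_def using Fm_not[of Q] by (intro exI[of _ "\<lambda>s. \<not> Q s"] exI[of _ l]) auto
qed

lemma Def_conj:
  assumes "Def C P" "Def C P'"
  shows "Def C (\<lambda>s. P s \<and> P' s)"
proof -
  obtain Q l where l: "set l \<subseteq> C" and Q: "Fm Q" and P: "P = (\<lambda>s. Q (foldr case_nat l s))"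
    using assms(1) unfolding Def_def by blast
  obtain Q' l' where l': "set l' \<subseteq> C" and Q': "Fm Q'" and P': "P' = (\<lambda>s. Q' (foldr case_nat l' s))"
    using assms(2) unfolding Def_def by blast
  define \<sigma> where "\<sigma> i = (if i < length l then i else length l' + i)" for i
  define \<sigma>' where "\<sigma>' i = length l + i" for i
  have "P s = Q (\<lambda>i. foldr case_nat (l @ l') s (\<sigma> i))" for s
    unfolding P by (rule arg_cong[of _ _ Q]) (auto simp: fun_eq_iff foldr_case_nat \<sigma>_def nth_append simp del: foldr_append)
  moreover have "P' s = Q' (\<lambda>i. foldr case_nat (l @ l') s (\<sigma>' i))" for s
    unfolding P' by (rule arg_cong[of _ _ Q']) (auto simp: fun_eq_iff foldr_case_nat \<sigma>'_def nth_append simp del: foldr_append)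
  ultimately show ?thesis
    unfolding Def_def using l l' Fm_conj[OF Fm_rename[OF Q, of \<sigma>] Fm_rename[OF Q', of \<sigma>']]
    by (intro exI[of _ "\<lambda>s. Q (\<lambda>i. s (\<sigma> i)) \<and> Q' (\<lambda>i. s (\<sigma>' i))"] exI[of _ "l @ l'"]) auto
qed

lemma Def_disj: "Def C P \<Longrightarrow> Def C Q \<Longrightarrow> Def C (\<lambda>s. P s \<or> Q s)"
  using Def_not[OF Def_conj[OF Def_not[of C P] Def_not[of C Q]]] by simp

lemma Def_imp: "Def C P \<Longrightarrow> Def C Q \<Longrightarrow> Def C (\<lambda>s. P s \<longrightarrow> Q s)"
  unfolding imp_conv_disj by (intro Def_disj Def_not)

lemma Def_iff: "Def C P \<Longrightarrow> Def C Q \<Longrightarrow> Def C (\<lambda>s. P s \<longleftrightarrow> Q s)"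
  unfolding iff_conv_conj_imp by (intro Def_conj Def_imp)

lemma Def_ex:
  assumes "Def C (\<lambda>s. P (s 0) (\<lambda>n. s (Suc n)))"
  shows "Def C (\<lambda>s. \<exists>x. P x s)"
proof -
  obtain Q l where l: "set l \<subseteq> C" and Q: "Fm Q"
    and P: "(\<lambda>s. P (s 0) (\<lambda>n. s (Suc n))) = (\<lambda>s. Q (foldr case_nat l s))"
    using assms unfolding Def_def by blast
  define \<sigma> where "\<sigma> i = (if i < length l then Suc i else if i = length l then 0 else i)" for i
  have "P x s = Q (\<lambda>i. case_nat x (foldr case_nat l s) (\<sigma> i))" for x s
  proof -
    have "P x s = Q (foldr case_nat l (case_nat x s))"
      using fun_cong[OF P, of "case_nat x s"] by simp
    also have "\<dots> = Q (\<lambda>i. case_nat x (foldr case_nat l s) (\<sigma> i))"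
      by (rule arg_cong[of _ _ Q])
        (auto simp: fun_eq_iff foldr_case_nat \<sigma>_def intro!: arg_cong[of _ _ s] split: nat.split)
    finally show ?thesis .
  qed
  then show ?thesis
    unfolding Def_def using l Fm_Ex[OF Fm_rename[OF Q, of \<sigma>]]
    by (intro exI[of _ "\<lambda>s. \<exists>x. Q (\<lambda>i. case_nat x s (\<sigma> i))"] exI[of _ l]) auto
qed

lemma Def_all:
  "Def C (\<lambda>s. P (s 0) (\<lambda>n. s (Suc n))) \<Longrightarrow> Def C (\<lambda>s. \<forall>x. P x s)"
  using Def_not[OF Def_ex[OF Def_not]] by simp

lemma Def_const_index:
  assumes "c \<in> C"
  shows "Def C (\<lambda>s. s n = c)"
proof -
  have "Fm (\<lambda>s. s (Suc n) = s 0)" unfolding Fm_def by (intro exI[of _ "Eq (Suc n) 0"]) simp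
  then show ?thesis
    unfolding Def_def using assms
    by (intro exI[of _ "\<lambda>s. s (Suc n) = s 0"] exI[of _ "[c]"]) auto
qed

definition DF :: "'a set \<Rightarrow> ((nat \<Rightarrow> 'a) \<Rightarrow> 'a) \<Rightarrow> bool" where
  "DF C f \<longleftrightarrow> Def C (\<lambda>s. s 0 = f (\<lambda>n. s (Suc n)))"

lemma DF_index: "DF C (\<lambda>s. s n)"
  unfolding DF_def by (rule Fm_imp_Def, unfold Fm_def) (intro exI[of _ "Eq 0 (Suc n)"], simp)

lemma DF_const: "c \<in> C \<Longrightarrow> DF C (\<lambda>s. c)"
  unfolding DF_def by (rule Def_const_index)

lemma DF_lift: "DF C f \<Longrightarrow> DF C (\<lambda>s. f (\<lambda>n. s (Suc n)))"
  unfolding DF_def by (drule Def_rename[where \<rho> = "case_nat 0 (\<lambda>n. Suc (Suc n))"]) simp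

lemma DF_const_UNIV: "DF UNIV (\<lambda>s. c)"
  by (rule DF_const) simp

lemma Def_comp:
  assumes "Def C (\<lambda>s. P (s 0) (\<lambda>n. s (Suc n)))" "DF C f"
  shows "Def C (\<lambda>s. P (f s) s)"
proof -
  have "Def C (\<lambda>s. \<exists>x. x = f s \<and> P x s)"
    using assms(2) unfolding DF_def by (intro Def_ex Def_conj assms(1))
  then show ?thesis by simp
qed

text \<open>Simultaneous substitution, one term at a time from the end of the list; the remaining
  terms are lifted past the variable standing for the one split off.\<close>

lemma Def_comp_list:
  assumes P: "Def C P" and F: "\<forall>f \<in> set F. DF C f"
  shows "Def C (\<lambda>s. P (\<lambda>i. if i < length F then (F ! i) s else s (i - length F)))"
  using F
proof (induction "length F" arbitrary: F)
  case 0
  then show ?case using P by simp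
next
  case (Suc n)
  then obtain f F' where F: "F = F' @ [f]" and n: "n = length F'" by (metis length_Suc_conv_rev)
  let ?G = "\<lambda>s x i. if i < n then (F' ! i) s else case_nat x s (i - n)"
  have "Def C (\<lambda>s. P (?G (\<lambda>n. s (Suc n)) (s 0)))"
  proof -
    define L where "L = map (\<lambda>f s. f (\<lambda>n. s (Suc n))) F'"
    have "\<forall>f \<in> set L. DF C f"
      using Suc.prems DF_lift unfolding L_def F by auto
    from Suc.hyps(1)[OF _ this]
    have "Def C (\<lambda>s. P (\<lambda>i. if i < length L then (L ! i) s else s (i - length L)))" by (simp add: L_def n)
    moreover have "?G (\<lambda>n. s (Suc n)) (s 0) = (\<lambda>i. if i < length L then (L ! i) s else s (i - length L))" for s
      by (auto simp: fun_eq_iff L_def n split: nat.split)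
    ultimately show ?thesis by simp
  qed
  then have "Def C (\<lambda>s. P (?G s (f s)))"
    by (rule Def_comp[where P = "\<lambda>x s. P (?G s x)"]) (use Suc.prems F in simp)
  moreover have "?G s (f s) = (\<lambda>i. if i < length F then (F ! i) s else s (i - length F))" for s
    by (auto simp: F n fun_eq_iff nth_append less_Suc_eq intro!: arg_cong[of _ _ s] split: nat.split)
  ultimately show ?case by simp
qed

lemma Def_comp1: "Def C (\<lambda>s. P (s 0)) \<Longrightarrow> DF C f \<Longrightarrow> Def C (\<lambda>s. P (f s))"
  using Def_comp_list[of C "\<lambda>s. P (s 0)" "[f]"] by simp

lemma Def_comp2:
  "Def C (\<lambda>s. P (s 0) (s 1)) \<Longrightarrow> DF C f \<Longrightarrow> DF C g \<Longrightarrow> Def C (\<lambda>s. P (f s) (g s))"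
  using Def_comp_list[of C "\<lambda>s. P (s 0) (s 1)" "[f, g]"] by simp

lemma Def_comp3:
  "Def C (\<lambda>s. P (s 0) (s 1) (s 2)) \<Longrightarrow> DF C f \<Longrightarrow> DF C g \<Longrightarrow> DF C h \<Longrightarrow>
    Def C (\<lambda>s. P (f s) (g s) (h s))"
  using Def_comp_list[of C "\<lambda>s. P (s 0) (s 1) (s 2)" "[f, g, h]"] by simp

lemma Def_comp4:
  "Def C (\<lambda>s. P (s 0) (s 1) (s 2) (s 3)) \<Longrightarrow> DF C e \<Longrightarrow> DF C f \<Longrightarrow> DF C g \<Longrightarrow> DF C h \<Longrightarrow>
    Def C (\<lambda>s. P (e s) (f s) (g s) (h s))"
  using Def_comp_list[of C "\<lambda>s. P (s 0) (s 1) (s 2) (s 3)" "[e, f, g, h]"]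
  by (simp add: numeral_3_eq_3)

lemma Def_mem: "DF C f \<Longrightarrow> DF C g \<Longrightarrow> Def C (\<lambda>s. f s \<epsilon> g s)"
  by (rule Def_comp2) (rule Fm_imp_Def, unfold Fm_def, intro exI[of _ "Mem 0 1"], simp)

lemma Def_eq: "DF C f \<Longrightarrow> DF C g \<Longrightarrow> Def C (\<lambda>s. f s = g s)"
  by (rule Def_comp2) (rule Fm_imp_Def, unfold Fm_def, intro exI[of _ "Eq 0 1"], simp)

end

context RL
begin

lemmas Def_intros =
  Def_not Def_conj Def_disj Def_imp Def_iff Def_ex Def_all Def_mem Def_eq DF_index

lemmas pDef_intros = Def_intros DF_const_UNIV

definition pDef :: "('a \<Rightarrow> bool) \<Rightarrow> bool" where
  "pDef Q \<longleftrightarrow> Def UNIV (\<lambda>s. Q (s 0))"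

lemma Def_subset: "DF C f \<Longrightarrow> DF C g \<Longrightarrow> Def C (\<lambda>s. subset_of (f s) (g s))"
  by (rule Def_comp2) (unfold subset_of_def, intro Def_intros)

lemma pDef_separation:
  assumes "pDef Q"
  shows "\<exists>y. \<forall>w. w \<epsilon> y \<longleftrightarrow> w \<epsilon> x \<and> Q w"
proof -
  obtain R l where "Fm R" and R: "(\<lambda>s. Q (s 0)) = (\<lambda>s. R (foldr case_nat l s))"
    using assms unfolding pDef_def Def_def by blast
  then obtain \<phi> where \<phi>: "\<And>s. sat mem s \<phi> = R s" unfolding Fm_def by blast
  \<comment> \<open>\<open>separation\<close> varies a single index. Since \<open>Q\<close> depends
    only on the value at index \<open>length l\<close>, all later indices may be identified with
    that one.\<close>
  obtain \<phi>' where \<phi>': "\<And>s. sat mem s \<phi>' = sat mem (\<lambda>i. s (min i (length l))) \<phi>"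
    using rename_fm[of mem "\<lambda>i. min i (length l)" \<phi>] by blast
  have "Q w = sat mem ((foldr case_nat l (\<lambda>_. x))(length l := w)) \<phi>'" for w
  proof -
    have "Q w = R (foldr case_nat l (\<lambda>_. w))" using fun_cong[OF R, of "\<lambda>_. w"] by simp
    also have "foldr case_nat l (\<lambda>_. w) = (\<lambda>i. ((foldr case_nat l (\<lambda>_. x))(length l := w)) (min i (length l)))"
      by (auto simp: fun_eq_iff foldr_case_nat min_def)
    finally show ?thesis by (simp only: \<phi>' \<phi>)
  qed
  then show ?thesis
    using separation[of x "foldr case_nat l (\<lambda>_. x)" "length l" \<phi>'] by (simp only:)
qed

definition Sep :: "'a \<Rightarrow> ('a \<Rightarrow> bool) \<Rightarrow> 'a" where
  "Sep x Q = (SOME y. \<forall>w. w \<epsilon> y \<longleftrightarrow> w \<epsilon> x \<and> Q w)"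

lemma mem_Sep: "pDef Q \<Longrightarrow> w \<epsilon> Sep x Q \<longleftrightarrow> w \<epsilon> x \<and> Q w"
  using someI_ex[OF pDef_separation[of Q x]] unfolding Sep_def by blast

subsection \<open>Pairs\<close>

definition upr :: "'a \<Rightarrow> 'a \<Rightarrow> 'a" where
  "upr x y = (SOME z. is_upair z x y)"

lemma mem_upr [simp]: "w \<epsilon> upr x y \<longleftrightarrow> w = x \<or> w = y"
  using someI_ex[OF pairing[of x y]] unfolding upr_def is_upair_def by blast

definition single :: "'a \<Rightarrow> 'a" where
  "single x = upr x x"

lemma mem_single [simp]: "w \<epsilon> single x \<longleftrightarrow> w = x"
  by (simp add: single_def)

lemma set_eqI: "(\<And>w. w \<epsilon> x \<longleftrightarrow> w \<epsilon> y) \<Longrightarrow> x = y"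
  using extensionality by blast

lemma is_upair_iff: "is_upair z x y \<longleftrightarrow> z = upr x y"
  unfolding is_upair_def by (metis mem_upr set_eqI)

definition pr :: "'a \<Rightarrow> 'a \<Rightarrow> 'a" where
  "pr x y = upr (single x) (upr x y)"

lemma is_opair_iff: "is_opair z x y \<longleftrightarrow> z = pr x y"
  unfolding is_opair_def is_upair_iff pr_def single_def by blast

lemma pr_inject [simp]: "pr x y = pr x' y' \<longleftrightarrow> x = x' \<and> y = y'"
proof
  assume eq: "pr x y = pr x' y'"
  have 1: "w \<epsilon> pr x y \<longleftrightarrow> w \<epsilon> pr x' y'" for w using eq by simp
  have 2: "single a = single b \<longleftrightarrow> a = b" for a b by (metis mem_single)
  have 3: "single a = upr b c \<longleftrightarrow> a = b \<and> a = c" for a b c by (metis mem_single mem_upr set_eqI)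
  have 4: "upr a b = upr a c \<longleftrightarrow> b = c" for a b c by (metis mem_upr)
  have "x = x'" using 1[of "single x"] 2 3 unfolding pr_def mem_upr by auto
  moreover have "y = y'"
    using 1[of "upr x y"] 1[of "upr x y'"] 3 3[THEN arg_cong[of _ _ Not], simplified] 4 \<open>x = x'\<close> unfolding pr_def mem_upr by metis
  ultimately show "x = x' \<and> y = y'" by blast
qed simp

lemma single_inject [simp]: "single a = single b \<longleftrightarrow> a = b"
  by (metis mem_single)

lemma mem_irrefl [simp]: "\<not> x \<epsilon> x"
  using foundation[of "single x"] unfolding is_empty_def by auto

lemma D0_pr_eq: "Var f \<Longrightarrow> Var g \<Longrightarrow> Var h \<Longrightarrow> D0 (\<lambda>s. f s = pr (g s) (h s))"
  using D0_opair[of f g h] by (simp add: is_opair_iff)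

lemma D0_pr_mem: "Var f \<Longrightarrow> Var g \<Longrightarrow> Var h \<Longrightarrow> D0 (\<lambda>s. pr (f s) (g s) \<epsilon> h s)"
proof -
  assume v: "Var f" "Var g" "Var h"
  have "D0 (\<lambda>s. \<exists>z. z \<epsilon> h s \<and> z = pr (f s) (g s))"
    by (intro D0_bex D0_pr_eq Var_index Var_lift v)
  moreover have "(\<exists>z. z \<epsilon> r \<and> z = p) \<longleftrightarrow> p \<epsilon> r" for r p by blast
  ultimately show ?thesis by simp
qed

text \<open>Both components of a pair are elements of its element \<open>upr x y\<close>, so
  quantifiers over them are bounded.\<close>

lemma D0_ex_pr_eq:
  assumes v: "Var h" and P: "D0 (\<lambda>s. P (s (Suc 0)) (s 0) (\<lambda>n. s (Suc (Suc n))))"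
  shows "D0 (\<lambda>s. \<exists>x y. h s = pr x y \<and> P x y s)"
proof -
  obtain k where h: "h = (\<lambda>s. s k)" using v unfolding Var_def by blast
  have "D0 (\<lambda>s. P (s 2) (s 0) (\<lambda>n. s (Suc (Suc (Suc (Suc n))))))"
    using D0_rename[OF P, of "case_nat 0 (case_nat 2 (\<lambda>n. Suc (Suc (Suc (Suc n)))))"] by simp
  then have "D0 (\<lambda>s. \<exists>u. u \<epsilon> s k \<and> (\<exists>x. x \<epsilon> u \<and> (\<exists>u'. u' \<epsilon> s k \<and> (\<exists>y. y \<epsilon> u' \<and> s k = pr x y \<and> P x y s))))"
    by (intro D0_bex D0_conj D0_pr_eq Var_index) (simp_all add: numeral_2_eq_2)
  moreover have "(\<exists>u. u \<epsilon> z \<and> (\<exists>x. x \<epsilon> u \<and> (\<exists>u'. u' \<epsilon> z \<and> (\<exists>y. y \<epsilon> u' \<and> z = pr x y \<and> P x y s))))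
    \<longleftrightarrow> (\<exists>x y. z = pr x y \<and> P x y s)" for z s
  proof -
    have "upr x y \<epsilon> pr x y" "x \<epsilon> upr x y" "y \<epsilon> upr x y" for x y by (simp_all add: pr_def)
    then show ?thesis by blast
  qed
  ultimately show ?thesis unfolding h by simp
qed

lemma D0_ex_pr_mem:
  assumes v: "Var h" and P: "D0 (\<lambda>s. P (s (Suc 0)) (s 0) (\<lambda>n. s (Suc (Suc n))))"
  shows "D0 (\<lambda>s. \<exists>x y. pr x y \<epsilon> h s \<and> P x y s)"
proof -
  have "D0 (\<lambda>s. P (s (Suc 0)) (s 0) (\<lambda>n. s (Suc (Suc (Suc n)))))"
    using D0_rename[OF P, of "case_nat 0 (case_nat 1 (\<lambda>n. Suc (Suc (Suc n))))"] by simp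
  then have "D0 (\<lambda>s. \<exists>z. z \<epsilon> h s \<and> (\<exists>x y. z = pr x y \<and> P x y s))"
    by (intro D0_bex D0_ex_pr_eq Var_index v)
  moreover have "(\<exists>z. z \<epsilon> r \<and> (\<exists>x y. z = pr x y \<and> P x y s)) \<longleftrightarrow> (\<exists>x y. pr x y \<epsilon> r \<and> P x y s)" for r s
    by blast
  ultimately show ?thesis by simp
qed

lemma D0_all_pr_mem:
  assumes v: "Var h" and P: "D0 (\<lambda>s. P (s (Suc 0)) (s 0) (\<lambda>n. s (Suc (Suc n))))"
  shows "D0 (\<lambda>s. \<forall>x y. pr x y \<epsilon> h s \<longrightarrow> P x y s)"
  using D0_not[OF D0_ex_pr_mem[OF v D0_not[OF P]]] by simp

lemmas D0_intros = D0_mem D0_eq D0_not D0_conj D0_disj D0_imp D0_iff D0_bex D0_ball D0_subset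
  D0_pr_eq D0_pr_mem D0_ex_pr_eq D0_ex_pr_mem D0_all_pr_mem Var_index

lemma DF_upr: "DF C f \<Longrightarrow> DF C g \<Longrightarrow> DF C (\<lambda>s. upr (f s) (g s))"
proof -
  assume "DF C f" "DF C g"
  then have "Def C (\<lambda>s. \<forall>w. w \<epsilon> s 0 \<longleftrightarrow> w = f (\<lambda>n. s (Suc n)) \<or> w = g (\<lambda>n. s (Suc n)))"
    by (intro Def_intros DF_lift)
  moreover have "z = upr x y \<longleftrightarrow> (\<forall>w. w \<epsilon> z \<longleftrightarrow> w = x \<or> w = y)" for x y z
    by (metis mem_upr set_eqI)
  ultimately show ?thesis unfolding DF_def by simp
qed

lemma DF_single: "DF C f \<Longrightarrow> DF C (\<lambda>s. single (f s))"
  unfolding single_def by (rule DF_upr)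

lemma DF_pr: "DF C f \<Longrightarrow> DF C g \<Longrightarrow> DF C (\<lambda>s. pr (f s) (g s))"
  unfolding pr_def by (intro DF_upr DF_single)

subsection \<open>Unions and bounds\<close>

lemma bin_un_exists: "\<exists>z. \<forall>w. w \<epsilon> z \<longleftrightarrow> w \<epsilon> x \<or> w \<epsilon> y"
  using union[of "upr x y"] unfolding is_Union_def by auto

definition bin_un :: "'a \<Rightarrow> 'a \<Rightarrow> 'a" where
  "bin_un x y = (SOME z. \<forall>w. w \<epsilon> z \<longleftrightarrow> w \<epsilon> x \<or> w \<epsilon> y)"

lemma mem_bin_un [simp]: "w \<epsilon> bin_un x y \<longleftrightarrow> w \<epsilon> x \<or> w \<epsilon> y"
  using someI_ex[OF bin_un_exists[of x y]] unfolding bin_un_def by blast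

definition emp :: 'a where
  "emp = (SOME x. is_empty x)"

lemma mem_emp [simp]: "\<not> w \<epsilon> emp"
  using someI_ex[OF empty_set] unfolding emp_def is_empty_def by blast

lemma DF_emp: "DF C (\<lambda>s. emp)"
proof -
  have "x = emp \<longleftrightarrow> (\<forall>w. \<not> w \<epsilon> x)" for x by (metis mem_emp set_eqI)
  then show ?thesis unfolding DF_def by (simp only:) (intro Def_intros)
qed

lemma single_ne_emp [simp]: "single x \<noteq> emp" "emp \<noteq> single x"
  by (metis mem_emp mem_single)+

lemma product_exists: "\<exists>z. \<forall>w. w \<epsilon> z \<longleftrightarrow> (\<exists>x y. x \<epsilon> a \<and> y \<epsilon> b \<and> w = pr x y)"
proof -
  obtain p where p: "is_Pow p (bin_un a b)" using power_set by blast
  obtain q where q: "is_Pow q p" using power_set by blast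
  have "pr x y \<epsilon> q" if "x \<epsilon> a" "y \<epsilon> b" for x y
    using that p q unfolding pr_def is_Pow_def subset_of_def by auto
  moreover have "pDef (\<lambda>w. \<exists>x y. x \<epsilon> a \<and> y \<epsilon> b \<and> w = pr x y)"
    unfolding pDef_def by (intro pDef_intros DF_pr)
  ultimately show ?thesis using mem_Sep[of _ _ q] by (intro exI[of _ "Sep q (\<lambda>w. \<exists>x y. x \<epsilon> a \<and> y \<epsilon> b \<and> w = pr x y)"]) auto
qed

definition prod :: "'a \<Rightarrow> 'a \<Rightarrow> 'a" where
  "prod a b = (SOME z. \<forall>w. w \<epsilon> z \<longleftrightarrow> (\<exists>x y. x \<epsilon> a \<and> y \<epsilon> b \<and> w = pr x y))"

lemma mem_prod: "w \<epsilon> prod a b \<longleftrightarrow> (\<exists>x y. x \<epsilon> a \<and> y \<epsilon> b \<and> w = pr x y)"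
  using someI_ex[OF product_exists[of a b]] unfolding prod_def by blast

lemma pr_mem_prod [simp]: "pr x y \<epsilon> prod a b \<longleftrightarrow> x \<epsilon> a \<and> y \<epsilon> b"
  by (auto simp: mem_prod)

subsection \<open>Levels\<close>

text \<open>The sets \<open>V\<^sub>\<alpha>\<close> without mention of ordinals, as in Button's level theory: a history is an initial
  segment of the hierarchy, and being a history is \<open>\<Pi>\<^sub>1\<close>, hence preserved by \<open>\<Sigma>\<^sub>1\<close>-elementary maps.\<close>

definition hist :: "'a \<Rightarrow> bool" where
  "hist h \<longleftrightarrow> (\<forall>x. x \<epsilon> h \<longrightarrow> (\<forall>y. y \<epsilon> x \<longleftrightarrow> (\<exists>c. c \<epsilon> x \<and> c \<epsilon> h \<and> subset_of y c)))"

definition acc :: "'a \<Rightarrow> 'a \<Rightarrow> bool" where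
  "acc v h \<longleftrightarrow> (\<forall>y. y \<epsilon> v \<longleftrightarrow> (\<exists>c. c \<epsilon> h \<and> subset_of y c))"

definition Lev :: "'a \<Rightarrow> bool" where
  "Lev v \<longleftrightarrow> (\<exists>h. hist h \<and> acc v h)"

lemma Def_Lev: "DF C f \<Longrightarrow> Def C (\<lambda>s. Lev (f s))"
  by (rule Def_comp1) (unfold Lev_def hist_def acc_def, intro Def_intros Def_subset)

lemma subset_refl [simp]: "subset_of x x"
  by (simp add: subset_of_def)

lemma subset_trans: "subset_of x y \<Longrightarrow> subset_of y z \<Longrightarrow> subset_of x z"
  by (simp add: subset_of_def)

lemma subsetD: "subset_of x y \<Longrightarrow> w \<epsilon> x \<Longrightarrow> w \<epsilon> y"
  by (simp add: subset_of_def)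

lemma hist_transitive:
  assumes h: "hist h" and "x \<epsilon> h" "y \<epsilon> x"
  shows "subset_of y x"
proof (rule ccontr)
  let ?Q = "\<lambda>x. \<exists>y. y \<epsilon> x \<and> \<not> subset_of y x"
  have Q: "pDef ?Q" unfolding pDef_def by (intro pDef_intros Def_subset)
  assume "\<not> subset_of y x"
  then have "x \<epsilon> Sep h ?Q" using assms mem_Sep[OF Q] by blast
  then obtain x0 where x0: "x0 \<epsilon> Sep h ?Q" and least: "\<And>w. w \<epsilon> x0 \<Longrightarrow> \<not> w \<epsilon> Sep h ?Q"
    using foundation[of "Sep h ?Q"] unfolding is_empty_def by blast
  obtain y0 where y0: "y0 \<epsilon> x0" "\<not> subset_of y0 x0" and x0h: "x0 \<epsilon> h"
    using x0 mem_Sep[OF Q] by blast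
  have x0_iff: "y \<epsilon> x0 \<longleftrightarrow> (\<exists>c. c \<epsilon> x0 \<and> c \<epsilon> h \<and> subset_of y c)" for y
    using h x0h unfolding hist_def by blast
  obtain c where c: "c \<epsilon> x0" "c \<epsilon> h" "subset_of y0 c" using y0 x0_iff by blast
  have trans: "\<And>d. d \<epsilon> c \<Longrightarrow> subset_of d c" using least[OF c(1)] c(2) mem_Sep[OF Q] by blast
  have "z \<epsilon> x0" if "z \<epsilon> c" for z
  proof -
    obtain d where "d \<epsilon> c" "d \<epsilon> h" "subset_of z d" using h c(2) \<open>z \<epsilon> c\<close> unfolding hist_def by blast
    then show ?thesis using trans c x0_iff by blast
  qed
  then show False using y0 c(3) unfolding subset_of_def by blast
qed

lemma Lev_potent: "Lev v \<Longrightarrow> y \<epsilon> v \<Longrightarrow> subset_of z y \<Longrightarrow> z \<epsilon> v"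
  unfolding Lev_def acc_def using subset_trans by blast

lemma Lev_transitive: "Lev v \<Longrightarrow> y \<epsilon> v \<Longrightarrow> subset_of y v"
  unfolding Lev_def acc_def hist_def subset_of_def by blast

text \<open>A member \<open>c\<close> of a history \<open>h\<close> is itself a level: the members
  of \<open>h\<close> lying in \<open>c\<close> form a history that accumulates to
  \<open>c\<close>.\<close>

lemma Lev_below:
  assumes "Lev v" "y \<epsilon> v"
  shows "\<exists>c. c \<epsilon> v \<and> Lev c \<and> subset_of y c"
proof -
  obtain h where h: "hist h" "acc v h" using assms(1) unfolding Lev_def by blast
  obtain c where c: "c \<epsilon> h" "subset_of y c" using h(2) assms(2) unfolding acc_def by blast
  have Q: "pDef (\<lambda>w. w \<epsilon> c)" unfolding pDef_def by (intro pDef_intros)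
  have "hist (Sep h (\<lambda>w. w \<epsilon> c))"
    unfolding hist_def mem_Sep[OF Q]
    using h(1) hist_transitive[OF h(1) c(1)] unfolding hist_def subset_of_def by blast
  moreover have "acc c (Sep h (\<lambda>w. w \<epsilon> c))"
    unfolding acc_def mem_Sep[OF Q] using h(1) c(1) unfolding hist_def by blast
  ultimately have "Lev c" unfolding Lev_def by blast
  moreover have "c \<epsilon> v" using h(2) c(1) unfolding acc_def by auto
  ultimately show ?thesis using c(2) by blast
qed

text \<open>Foundation speaks of sets only, but the members of \<open>v\<close> with the property
  form a set by Separation, and transitivity of \<open>v\<close> makes a minimal one minimal among
  all levels.\<close>

lemma Lev_least:
  assumes Q: "pDef Q" and v: "Lev v" "Q v"
  shows "\<exists>u. Lev u \<and> Q u \<and> (\<forall>w. w \<epsilon> u \<longrightarrow> Lev w \<longrightarrow> \<not> Q w)"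
proof -
  have Q': "pDef (\<lambda>w. Lev w \<and> Q w)"
    using Q unfolding pDef_def by (intro Def_conj Def_Lev DF_index)
  show ?thesis
  proof (cases "\<exists>u. u \<epsilon> Sep v (\<lambda>w. Lev w \<and> Q w)")
    case True
    then obtain u where "u \<epsilon> Sep v (\<lambda>w. Lev w \<and> Q w)"
      "\<And>w. w \<epsilon> u \<Longrightarrow> \<not> w \<epsilon> Sep v (\<lambda>w. Lev w \<and> Q w)"
      using foundation[of "Sep v (\<lambda>w. Lev w \<and> Q w)"] unfolding is_empty_def by blast
    then show ?thesis
      unfolding mem_Sep[OF Q'] using Lev_transitive[OF v(1)] subsetD by blast
  next
    case False
    then show ?thesis using v unfolding mem_Sep[OF Q'] by blast
  qed
qed

text \<open>Take \<open>u\<close> least with an incomparable level and then \<open>v\<close> least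
  among those incomparable to \<open>u\<close>; each contains the elements of the other, so they are
  equal.\<close>

lemma Lev_linear:
  assumes "Lev u" "Lev v"
  shows "u \<epsilon> v \<or> u = v \<or> v \<epsilon> u"
proof (rule ccontr)
  assume bad: "\<not> ?thesis"
  let ?cmp = "\<lambda>u v. u \<epsilon> v \<or> u = v \<or> v \<epsilon> u"
  have "pDef (\<lambda>u. \<exists>v. Lev v \<and> \<not> ?cmp u v)" unfolding pDef_def by (intro pDef_intros Def_Lev)
  from Lev_least[OF this assms(1)] obtain u where u: "Lev u" "\<exists>v. Lev v \<and> \<not> ?cmp u v"
    and umin: "\<And>w v. w \<epsilon> u \<Longrightarrow> Lev w \<Longrightarrow> Lev v \<Longrightarrow> ?cmp w v"
    using assms(2) bad by blast
  have "pDef (\<lambda>v. \<not> ?cmp u v)" unfolding pDef_def by (intro pDef_intros)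
  from Lev_least[OF this] u(2) obtain v where v: "Lev v" "\<not> ?cmp u v"
    and vmin: "\<And>w. w \<epsilon> v \<Longrightarrow> Lev w \<Longrightarrow> ?cmp u w" by blast
  have "y \<epsilon> v" if "y \<epsilon> u" for y
  proof -
    obtain c where "c \<epsilon> u" "Lev c" "subset_of y c" using Lev_below[OF u(1) \<open>y \<epsilon> u\<close>] by blast
    then show ?thesis
      using umin[of c v] v Lev_potent Lev_transitive[OF u(1)] subsetD by blast
  qed
  moreover have "y \<epsilon> u" if "y \<epsilon> v" for y
  proof -
    obtain c where "c \<epsilon> v" "Lev c" "subset_of y c" using Lev_below[OF v(1) \<open>y \<epsilon> v\<close>] by blast
    then show ?thesis
      using vmin[of c] v u(1) Lev_potent Lev_transitive[OF v(1)] subsetD by blast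
  qed
  ultimately show False using v(2) set_eqI by blast
qed

lemma Lev_subset_or: "Lev u \<Longrightarrow> Lev v \<Longrightarrow> subset_of u v \<or> v \<epsilon> u"
  using Lev_linear Lev_transitive subset_refl by blast

section \<open>Comparison with the hierarchy indexed by ordinals\<close>

lemma mem_asym: "x \<epsilon> y \<Longrightarrow> \<not> y \<epsilon> x"
  using foundation[of "upr x y"] unfolding is_empty_def by auto

lemma mem_no_3_cycle: "x \<epsilon> y \<Longrightarrow> y \<epsilon> z \<Longrightarrow> \<not> z \<epsilon> x"
  using foundation[of "bin_un (upr x y) (single z)"] unfolding is_empty_def by auto

lemma maps_to_iff: "maps_to f x y \<longleftrightarrow> pr x y \<epsilon> f"
  unfolding maps_to_def is_opair_iff by blast

lemma Ord_trans:
  assumes "is_Ord a" "b \<epsilon> a \<or> b = a" "c \<epsilon> b" "d \<epsilon> c"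
  shows "d \<epsilon> b"
proof (cases "b = a")
  case True
  then show ?thesis using assms unfolding is_Ord_def subset_of_def by blast
next
  case False
  then have "b \<epsilon> a" "c \<epsilon> a" "d \<epsilon> a" using assms unfolding is_Ord_def subset_of_def by blast+
  then have "d \<epsilon> b \<or> d = b \<or> b \<epsilon> d" using assms(1) unfolding is_Ord_def by blast
  then show ?thesis using assms(3,4) mem_asym mem_no_3_cycle by blast
qed

text \<open>The three clauses of the recursion merge into one: the value at \<open>b\<close> is the
  union of the power sets of the earlier values. At a least failure \<open>b\<close>, the values
  below \<open>b\<close> increase, which settles a successor; a limit has no last element, so a
  subset of one value is an element of a later one.\<close>

lemma V_recursion_step:
  assumes a: "is_Ord a" and s: "is_succ s a" and f: "V_recursion f s"
    and "b \<epsilon> s" "pr b y \<epsilon> f"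
  shows "w \<epsilon> y \<longleftrightarrow> (\<exists>c u. c \<epsilon> b \<and> pr c u \<epsilon> f \<and> subset_of w u)"
proof (rule ccontr)
  let ?good = "\<lambda>b. \<forall>y w. pr b y \<epsilon> f \<longrightarrow> (w \<epsilon> y \<longleftrightarrow> (\<exists>c u. c \<epsilon> b \<and> pr c u \<epsilon> f \<and> subset_of w u))"
  have Q: "pDef (\<lambda>b. \<not> ?good b)" unfolding pDef_def by (intro pDef_intros Def_subset DF_pr)
  assume "\<not> ?thesis"
  then have "b \<epsilon> Sep s (\<lambda>b. \<not> ?good b)" unfolding mem_Sep[OF Q] using assms(4,5) by blast
  then obtain b where b: "b \<epsilon> Sep s (\<lambda>b. \<not> ?good b)"
    and min: "\<And>c. c \<epsilon> b \<Longrightarrow> \<not> c \<epsilon> Sep s (\<lambda>b. \<not> ?good b)"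
    using foundation[of "Sep s (\<lambda>b. \<not> ?good b)"] unfolding is_empty_def by blast
  have bs: "b \<epsilon> s" and bad: "\<not> ?good b" using b unfolding mem_Sep[OF Q] by blast+
  have ba: "b \<epsilon> a \<or> b = a" using bs s unfolding is_succ_def by blast
  have below: "c \<epsilon> s" "c \<epsilon> a" if "c \<epsilon> b" for c
    using that ba a s unfolding is_succ_def is_Ord_def subset_of_def by blast+
  have good: "w \<epsilon> y \<longleftrightarrow> (\<exists>d u. d \<epsilon> c \<and> pr d u \<epsilon> f \<and> subset_of w u)"
    if "c \<epsilon> b" "pr c y \<epsilon> f" for c y w
    using min[OF that(1)] below(1)[OF that(1)] that(2) unfolding mem_Sep[OF Q] by blast
  have fn: "\<exists>!y. pr c y \<epsilon> f" if "c \<epsilon> s" for c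
    using f that unfolding V_recursion_def is_function_on_def maps_to_iff by blast
  have mono: "subset_of u' u" if "c \<epsilon> b" "d \<epsilon> c" "pr c u \<epsilon> f" "pr d u' \<epsilon> f" for c d u u'
  proof -
    have db: "d \<epsilon> b" using Ord_trans[OF a ba that(1,2)] .
    have "e \<epsilon> c" if "e \<epsilon> d" for e
      using Ord_trans[OF a _ \<open>d \<epsilon> c\<close> that] below(2)[OF \<open>c \<epsilon> b\<close>] by blast
    then show ?thesis unfolding subset_of_def good[OF db that(4)] good[OF that(1,3)] by blast
  qed
  have rec: "(is_empty b \<longrightarrow> is_empty y) \<and> (\<forall>c u. is_succ b c \<longrightarrow> pr c u \<epsilon> f \<longrightarrow> is_Pow y u) \<and>
      (is_Limit b \<longrightarrow> (\<forall>w. w \<epsilon> y \<longleftrightarrow> (\<exists>c u. c \<epsilon> b \<and> pr c u \<epsilon> f \<and> w \<epsilon> u)))" if "pr b y \<epsilon> f" for y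
    using f bs that unfolding V_recursion_def maps_to_iff by blast
  have "is_Ord b"
    unfolding is_Ord_def subset_of_def
    using Ord_trans[OF a ba] a below(2) unfolding is_Ord_def by blast
  then consider "is_empty b" | c where "is_succ b c" | "is_Limit b"
    unfolding is_Limit_def by blast
  then have "?good b"
  proof cases
    case 1
    then show ?thesis using rec unfolding is_empty_def by blast
  next
    case (2 c)
    then have cb: "c \<epsilon> b" unfolding is_succ_def by blast
    obtain u where u: "pr c u \<epsilon> f" using fn[OF below(1)[OF cb]] by blast
    have pow: "w \<epsilon> y \<longleftrightarrow> subset_of w u" if "pr b y \<epsilon> f" for y w
      using rec[OF that] 2 u unfolding is_Pow_def by blast
    have "subset_of w u" if "d \<epsilon> b" "pr d u' \<epsilon> f" "subset_of w u'" for d u' w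
    proof (cases "d = c")
      case True
      then show ?thesis using that u fn[OF below(1)[OF cb]] by blast
    next
      case False
      then have "d \<epsilon> c" using that(1) 2 unfolding is_succ_def by blast
      then show ?thesis using mono[OF cb _ u that(2)] that(3) subset_trans by blast
    qed
    then show ?thesis using pow u cb by blast
  next
    case 3
    then have lim: "w \<epsilon> y \<longleftrightarrow> (\<exists>c u. c \<epsilon> b \<and> pr c u \<epsilon> f \<and> w \<epsilon> u)" if "pr b y \<epsilon> f" for y w
      using rec[OF that] by blast
    have up: "\<exists>d u'. d \<epsilon> b \<and> pr d u' \<epsilon> f \<and> w \<epsilon> u'"
      if c: "c \<epsilon> b" "pr c u \<epsilon> f" "subset_of w u" for c u w
    proof -
      have "\<not> is_succ b c" using 3 unfolding is_Limit_def by blast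
      then obtain d where d: "d \<epsilon> b" "\<not> d \<epsilon> c" "d \<noteq> c"
        unfolding is_succ_def using c(1) Ord_trans[OF a ba c(1)] by blast
      then have "c \<epsilon> d" using a below(2) c(1) unfolding is_Ord_def by blast
      moreover obtain u' where "pr d u' \<epsilon> f" using fn[OF below(1)[OF d(1)]] by blast
      ultimately show ?thesis using good[OF d(1)] d(1) c by blast
    qed
    have "\<exists>d u'. d \<epsilon> b \<and> pr d u' \<epsilon> f \<and> subset_of w u'" if "c \<epsilon> b" "pr c u \<epsilon> f" "w \<epsilon> u" for c u w
      using good[OF that(1,2)] that(3) Ord_trans[OF a ba that(1)] by blast
    then show ?thesis using lim up by blast
  qed
  then show False using bad by blast
qed

text \<open>The history consists of the values of the recursion below \<open>a\<close>.\<close>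

lemma is_V_Lev:
  assumes "is_V v a"
  shows "Lev v"
proof -
  obtain s f where a: "is_Ord a" and s: "is_succ s a" and f: "V_recursion f s" and v: "pr a v \<epsilon> f"
    using assms unfolding is_V_def maps_to_iff by blast
  note step = V_recursion_step[OF a s f]
  have as: "a \<epsilon> s" and cs: "\<And>c. c \<epsilon> a \<Longrightarrow> c \<epsilon> s" using s unfolding is_succ_def by blast+
  have Q: "pDef (\<lambda>u. \<exists>c. c \<epsilon> a \<and> pr c u \<epsilon> f)" unfolding pDef_def by (intro pDef_intros DF_pr)
  define h where "h = Sep v (\<lambda>u. \<exists>c. c \<epsilon> a \<and> pr c u \<epsilon> f)"
  have h: "u \<epsilon> h \<longleftrightarrow> (\<exists>c. c \<epsilon> a \<and> pr c u \<epsilon> f)" for u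
    unfolding h_def mem_Sep[OF Q] using step[OF as v, of u] subset_refl by blast
  have "acc v h" unfolding acc_def h using step[OF as v] by blast
  moreover have "hist h"
    unfolding hist_def
  proof (intro allI impI)
    fix x y assume "x \<epsilon> h"
    then obtain c where c: "c \<epsilon> a" "pr c x \<epsilon> f" unfolding h by blast
    note x = step[OF cs[OF c(1)] c(2)]
    have "d \<epsilon> a" if "d \<epsilon> c" for d using that c(1) a unfolding is_Ord_def subset_of_def by blast
    then show "y \<epsilon> x \<longleftrightarrow> (\<exists>d. d \<epsilon> x \<and> d \<epsilon> h \<and> subset_of y d)"
      unfolding h x using subset_trans subset_refl by meson
  qed
  ultimately show ?thesis unfolding Lev_def by blast
qed

lemma Lev_cofinal: "\<exists>v. Lev v \<and> x \<epsilon> v"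
  using ranked[of x] is_V_Lev by blast

lemma Lev_cofinal_subset: "\<exists>v. Lev v \<and> subset_of x v"
  using Lev_cofinal[of x] Lev_transitive by blast

text \<open>Four arguments are the most that any later transfer needs. Because it ranges over all
  bounded formulas, \<open>pres\<close> is not given by a single formula; \<open>good\<close> takes
  its place when a first-order condition is required.\<close>

definition pres :: "('a \<Rightarrow> 'a) \<Rightarrow> bool" where
  "pres k \<longleftrightarrow> (\<forall>B. D0 (\<lambda>s. B (s 0) (s 1) (s 2) (s 3)) \<longrightarrow>
    (\<forall>w x y z. B w x y z \<longleftrightarrow> B (k w) (k x) (k y) (k z)))"

definition cofin :: "('a \<Rightarrow> 'a) \<Rightarrow> bool" where
  "cofin k \<longleftrightarrow> (\<forall>y. \<exists>v. subset_of y (k v))"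

definition pDefF :: "('a \<Rightarrow> 'a) \<Rightarrow> bool" where
  "pDefF k \<longleftrightarrow> Def UNIV (\<lambda>s. s 0 = k (s 1))"

definition emb :: "('a \<Rightarrow> 'a) \<Rightarrow> bool" where
  "emb k \<longleftrightarrow> pres k \<and> cofin k \<and> pDefF k"

lemma pres4:
  "pres k \<Longrightarrow> D0 (\<lambda>s. B (s 0) (s (Suc 0)) (s (Suc (Suc 0))) (s (Suc (Suc (Suc 0))))) \<Longrightarrow>
    B w x y z \<longleftrightarrow> B (k w) (k x) (k y) (k z)"
  unfolding pres_def by (simp add: numeral_2_eq_2 numeral_3_eq_3)

lemma pres3:
  "pres k \<Longrightarrow> D0 (\<lambda>s. B (s 0) (s (Suc 0)) (s (Suc (Suc 0)))) \<Longrightarrow> B w x y \<longleftrightarrow> B (k w) (k x) (k y)"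
  by (rule pres4[where B = "\<lambda>w x y z. B w x y" and z = w])

lemma pres2: "pres k \<Longrightarrow> D0 (\<lambda>s. B (s 0) (s (Suc 0))) \<Longrightarrow> B w x \<longleftrightarrow> B (k w) (k x)"
  by (rule pres4[where B = "\<lambda>w x y z. B w x" and z = w and y = w])

lemma pres1: "pres k \<Longrightarrow> D0 (\<lambda>s. B (s 0)) \<Longrightarrow> B w \<longleftrightarrow> B (k w)"
  by (rule pres4[where B = "\<lambda>w x y z. B w" and z = w and y = w and x = w])

lemma pres2D: "pres k \<Longrightarrow> B w x \<Longrightarrow> D0 (\<lambda>s. B (s 0) (s (Suc 0))) \<Longrightarrow> B (k w) (k x)"
  using pres2[of k B w x] by blast

lemma pres3D:
  "pres k \<Longrightarrow> B w x y \<Longrightarrow> D0 (\<lambda>s. B (s 0) (s (Suc 0)) (s (Suc (Suc 0)))) \<Longrightarrow> B (k w) (k x) (k y)"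
  using pres3[of k B w x y] by blast

lemma pres4D:
  "pres k \<Longrightarrow> B w x y z \<Longrightarrow> D0 (\<lambda>s. B (s 0) (s (Suc 0)) (s (Suc (Suc 0))) (s (Suc (Suc (Suc 0))))) \<Longrightarrow>
    B (k w) (k x) (k y) (k z)"
  using pres4[of k B w x y z] by blast

lemma pres_mem: "pres k \<Longrightarrow> k x \<epsilon> k y \<longleftrightarrow> x \<epsilon> y"
  by (erule pres2[where B = "\<lambda>x y. x \<epsilon> y", symmetric]) (intro D0_intros)

lemma pres_eq: "pres k \<Longrightarrow> k x = k y \<longleftrightarrow> x = y"
  by (erule pres2[where B = "\<lambda>x y. x = y", symmetric]) (intro D0_intros)

lemma pres_subset: "pres k \<Longrightarrow> subset_of (k x) (k y) \<longleftrightarrow> subset_of x y"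
  by (erule pres2[where B = "\<lambda>x y. subset_of x y", symmetric]) (intro D0_intros)

lemma pres_pr: "pres k \<Longrightarrow> k (pr x y) = pr (k x) (k y)"
  using pres3[where B = "\<lambda>z x y. z = pr x y" and w = "pr x y" and x = x and y = y and k = k]
    D0_pr_eq[OF Var_index Var_index Var_index] by simp

lemma pres_pr_mem: "pres k \<Longrightarrow> pr (k x) (k y) \<epsilon> k r \<longleftrightarrow> pr x y \<epsilon> r"
  by (metis pres_mem pres_pr)

lemma pres_single: "pres k \<Longrightarrow> k (single x) = single (k x)"
  using pres2[where B = "\<lambda>z x. is_upair z x x" and w = "single x" and x = x and k = k]
    D0_upair[OF Var_index Var_index Var_index, of 0 "Suc 0" "Suc 0"] by (simp add: is_upair_iff single_def)

lemma D0_eq_emp: "Var f \<Longrightarrow> D0 (\<lambda>s. f s = emp)"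
proof -
  assume v: "Var f"
  have "x = emp \<longleftrightarrow> (\<forall>w. w \<epsilon> x \<longrightarrow> \<not> w = w)" for x by (metis mem_emp set_eqI)
  then show ?thesis by (simp only:) (intro D0_intros v)
qed

lemma pres_emp: "pres k \<Longrightarrow> k emp = emp"
  using pres1[where B = "\<lambda>x. x = emp" and w = emp and k = k] D0_eq_emp[OF Var_index] by simp

lemma DF_pDefF: "pDefF k \<Longrightarrow> DF UNIV f \<Longrightarrow> DF UNIV (\<lambda>s. k (f s))"
  unfolding DF_def[of _ "\<lambda>s. k (f s)"] pDefF_def
  by (rule Def_comp2[where P = "\<lambda>x y. x = k y"]) (auto intro: DF_index DF_lift)

lemma emb_pDefF: "emb k \<Longrightarrow> pDefF k" and emb_pres: "emb k \<Longrightarrow> pres k" and emb_cofin: "emb k \<Longrightarrow> cofin k"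
  by (simp_all add: emb_def)

section \<open>Applying one embedding to another\<close>

definition res :: "('a \<Rightarrow> 'a) \<Rightarrow> 'a \<Rightarrow> 'a" where
  "res k v = Sep (prod v (k v)) (\<lambda>z. \<exists>x. z = pr x (k x))"

text \<open>Membership is preserved, so \<open>k\<close> maps \<open>v\<close> into
  \<open>k v\<close> and the graph lies in \<open>prod v (k v)\<close>: Separation does the work of
  Replacement.\<close>

lemma mem_res:
  assumes "emb k"
  shows "z \<epsilon> res k v \<longleftrightarrow> (\<exists>x. x \<epsilon> v \<and> z = pr x (k x))"
proof -
  have "pDef (\<lambda>z. \<exists>x. z = pr x (k x))"
    using emb_pDefF[OF assms] unfolding pDef_def by (intro pDef_intros DF_pr DF_pDefF[of k])
  then show ?thesis
    unfolding res_def using assms pres_mem[of k _ v] unfolding emb_def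
    by (auto simp: mem_Sep mem_prod)
qed

lemma pr_mem_res: "emb k \<Longrightarrow> pr x y \<epsilon> res k v \<longleftrightarrow> x \<epsilon> v \<and> y = k x"
  by (auto simp: mem_res)

text \<open>\<open>act A k\<close> is the class \<open>A\<^sup>+(k)\<close>.\<close>

definition act :: "('a \<Rightarrow> 'a) \<Rightarrow> ('a \<Rightarrow> 'a) \<Rightarrow> 'a \<Rightarrow> 'a" where
  "act A k x = (THE y. \<exists>v. pr x y \<epsilon> A (res k v))"

context
  fixes A k
  assumes A: "emb A" and k: "emb k"
begin

private lemma presA: "pres A" and cofinA: "cofin A" and presk: "pres k" and cofink: "cofin k"
  using A k by (auto simp: emb_def)

private lemma image_res_fun:
  assumes "pr x y \<epsilon> A (res k v)" "pr x y' \<epsilon> A (res k v)"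
  shows "y = y'"
proof -
  have "\<forall>x y. pr x y \<epsilon> res k v \<longrightarrow> (\<forall>x' y'. pr x' y' \<epsilon> res k v \<longrightarrow> x = x' \<longrightarrow> y = y')"
    by (auto simp: pr_mem_res[OF k])
  then have "\<forall>x y. pr x y \<epsilon> A (res k v) \<longrightarrow> (\<forall>x' y'. pr x' y' \<epsilon> A (res k v) \<longrightarrow> x = x' \<longrightarrow> y = y')"
    by (rule pres1[OF presA, THEN iffD1, rotated]) (intro D0_intros)
  then show ?thesis using assms by blast
qed

private lemma image_res_dom:
  assumes "x \<epsilon> A v"
  shows "\<exists>y. pr x y \<epsilon> A (res k v)"
proof -
  have "\<forall>x. x \<epsilon> v \<longrightarrow> (\<exists>x' y. pr x' y \<epsilon> res k v \<and> x' = x)"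
    by (auto simp: pr_mem_res[OF k])
  then have "\<forall>x. x \<epsilon> A v \<longrightarrow> (\<exists>x' y. pr x' y \<epsilon> A (res k v) \<and> x' = x)"
    by (rule pres2[OF presA, THEN iffD1, rotated]) (intro D0_intros)
  then show ?thesis using assms by blast
qed

private lemma image_res_mono: "subset_of v v' \<Longrightarrow> subset_of (A (res k v)) (A (res k v'))"
  by (subst pres_subset[OF presA]) (auto simp: subset_of_def mem_res[OF k])

text \<open>Values obtained from \<open>v\<close> and \<open>v'\<close> agree because both occur in
  the graph for the union of the two sets, and being single-valued is a bounded property that
  \<open>A\<close> transfers.\<close>

lemma act_eq: "pr x y \<epsilon> A (res k v) \<Longrightarrow> act A k x = y"
  unfolding act_def
proof (rule the_equality)
  assume y: "pr x y \<epsilon> A (res k v)"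
  then show "\<exists>v. pr x y \<epsilon> A (res k v)" by blast
  fix y' assume "\<exists>v. pr x y' \<epsilon> A (res k v)"
  then obtain v' where "pr x y' \<epsilon> A (res k v')" by blast
  moreover have "subset_of v (bin_un v v')" "subset_of v' (bin_un v v')" by (simp_all add: subset_of_def)
  ultimately have "pr x y' \<epsilon> A (res k (bin_un v v'))" "pr x y \<epsilon> A (res k (bin_un v v'))"
    using y image_res_mono subsetD by blast+
  then show "y' = y" by (rule image_res_fun)
qed

lemma act_mem: "x \<epsilon> A v \<Longrightarrow> pr x (act A k x) \<epsilon> A (res k v)"
  using image_res_dom act_eq by blast

lemma act_image: "act A k (A x) = A (k x)"
  by (rule act_eq[of _ _ "single x"]) (simp add: pres_pr_mem[OF presA] pr_mem_res[OF k])

lemma act_graph: "y = act A k x \<longleftrightarrow> (\<exists>v. pr x y \<epsilon> A (res k v))"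
proof -
  obtain v where "subset_of (single x) (A v)" using cofinA unfolding cofin_def by blast
  then have "x \<epsilon> A v" by (simp add: subset_of_def)
  then show ?thesis using act_mem act_eq by blast
qed

private lemma pDefF_act: "pDefF (act A k)"
proof -
  have "g = res k v \<longleftrightarrow> (\<forall>z. z \<epsilon> g \<longleftrightarrow> (\<exists>x. x \<epsilon> v \<and> z = pr x (k x)))" for g v
    using mem_res[OF k] by (metis set_eqI)
  then have *: "y = act A k x \<longleftrightarrow>
      (\<exists>v g. (\<forall>z. z \<epsilon> g \<longleftrightarrow> (\<exists>x. x \<epsilon> v \<and> z = pr x (k x))) \<and> pr x y \<epsilon> A g)" for x y
    unfolding act_graph by metis
  show ?thesis
    unfolding pDefF_def *
    by (intro pDef_intros DF_pr DF_pDefF[OF emb_pDefF[OF A]] DF_pDefF[OF emb_pDefF[OF k]])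
qed

private lemma cofin_act: "cofin (act A k)"
  unfolding cofin_def
proof
  fix y
  obtain v where v: "subset_of y (A v)" using cofinA unfolding cofin_def by blast
  obtain v' where "subset_of v (k v')" using cofink unfolding cofin_def by blast
  then have "subset_of (A v) (act A k (A v'))" by (simp add: act_image pres_subset[OF presA])
  then show "\<exists>v. subset_of y (act A k v)" using v subset_trans by blast
qed

text \<open>That a set function preserves \<open>B\<close> is a bounded property \<open>S\<close> of
  the function. It holds of \<open>res k v\<close>, hence of \<open>A (res k v)\<close>, and these
  graphs together make up \<open>act A k\<close>.\<close>

private lemma pres_act: "pres (act A k)"
  unfolding pres_def
proof (intro allI impI)
  fix B w x y z
  assume "D0 (\<lambda>s. B (s 0) (s 1) (s 2) (s 3))"
  then have B: "D0 (\<lambda>s. B (s m) (s n) (s p) (s q))" for m n p q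
    by (drule_tac \<rho> = "\<lambda>i. if i = 0 then m else if i = 1 then n else if i = 2 then p else q" in D0_rename)
      simp
  define S where "S g \<longleftrightarrow> (\<forall>w w'. pr w w' \<epsilon> g \<longrightarrow> (\<forall>x x'. pr x x' \<epsilon> g \<longrightarrow>
    (\<forall>y y'. pr y y' \<epsilon> g \<longrightarrow> (\<forall>z z'. pr z z' \<epsilon> g \<longrightarrow> (B w x y z \<longleftrightarrow> B w' x' y' z')))))" for g
  have S: "D0 (\<lambda>s. S (s 0))" unfolding S_def by (intro D0_intros B)
  obtain v where "subset_of (bin_un (upr w x) (upr y z)) (A v)" using cofinA unfolding cofin_def by blast
  then have v: "w \<epsilon> A v" "x \<epsilon> A v" "y \<epsilon> A v" "z \<epsilon> A v" by (auto simp: subset_of_def)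
  have "B w x y z \<longleftrightarrow> B (k w) (k x) (k y) (k z)" for w x y z
    by (rule pres4[OF presk, where B = B]) (rule B)
  then have "S (res k v)" unfolding S_def pr_mem_res[OF k] by auto
  then have "S (A (res k v))" using pres1[OF presA S] by blast
  then show "B w x y z \<longleftrightarrow> B (act A k w) (act A k x) (act A k y) (act A k z)"
    unfolding S_def using v[THEN act_mem] by blast
qed

lemma emb_act: "emb (act A k)"
  unfolding emb_def using pDefF_act cofin_act pres_act by blast

end

subsection \<open>Level-preserving embeddings\<close>

context
  fixes j
  assumes S: "Sigma1_elementary mem j" and jdef: "pDefF j"
begin

lemma Sigma1_D0:
  assumes "D0 P"
  shows "P s \<longleftrightarrow> P (\<lambda>i. j (s i))"
proof -
  obtain \<phi> where "Delta0 \<phi>" and \<phi>: "\<And>s. sat mem s \<phi> = P s" using assms unfolding D0_def by blast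
  then have "Sigma1 \<phi>" by (intro Sigma1.intros)
  then have "sat mem s \<phi> = sat mem (j \<circ> s) \<phi>" using S unfolding Sigma1_elementary_def by blast
  then show ?thesis by (simp add: \<phi> comp_def)
qed

lemma Sigma1_all_D0:
  assumes "D0 (\<lambda>s. P (s 0) (s (Suc 0)) (s (Suc (Suc 0))))"
  shows "(\<forall>z. P z x y) \<longleftrightarrow> (\<forall>z. P z (j x) (j y))"
proof -
  obtain \<phi> where "Delta0 \<phi>" and \<phi>: "\<And>s. sat mem s \<phi> = (\<not> P (s 0) (s (Suc 0)) (s (Suc (Suc 0))))"
    using D0_not[OF assms] unfolding D0_def by blast
  then obtain \<psi> where "Sigma1 \<psi>" and \<psi>: "\<And>s. sat mem s \<psi> = (\<exists>x. sat mem (case_nat x s) \<phi>)"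
    using de_Bruijn_Ex_Sigma1[of \<phi> mem] by blast
  then have "sat mem (case_nat x (\<lambda>_. y)) \<psi> = sat mem (j \<circ> case_nat x (\<lambda>_. y)) \<psi>"
    using S unfolding Sigma1_elementary_def by blast
  then have "(\<exists>z. \<not> P z x y) = (\<exists>z. \<not> P z (j x) (j y))" by (simp add: \<psi> \<phi>)
  then show ?thesis by blast
qed

lemma pres_j: "pres j"
  unfolding pres_def
proof (intro allI impI)
  fix B w x y z assume "D0 (\<lambda>s. B (s 0) (s 1) (s 2) (s 3))"
  from Sigma1_D0[OF this, of "\<lambda>i. if i = 0 then w else if i = 1 then x else if i = 2 then y else z"]
  show "B w x y z \<longleftrightarrow> B (j w) (j x) (j y) (j z)" by simp
qed

text \<open>One half of the equivalence in \<open>hist\<close> is bounded; the other quantifies over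
  arbitrary \<open>y\<close> and is \<open>\<Pi>\<^sub>1\<close>. They are transferred
  separately.\<close>

lemma hist_j:
  assumes "hist h"
  shows "hist (j h)"
proof -
  let ?P = "\<lambda>h. \<forall>x. x \<epsilon> h \<longrightarrow> (\<forall>y. y \<epsilon> x \<longrightarrow> (\<exists>c. c \<epsilon> x \<and> c \<epsilon> h \<and> subset_of y c))"
  let ?Q = "\<lambda>y h. \<forall>x. x \<epsilon> h \<longrightarrow> (\<forall>c. c \<epsilon> x \<longrightarrow> c \<epsilon> h \<longrightarrow> subset_of y c \<longrightarrow> y \<epsilon> x)"
  have "?P h" "\<forall>y. ?Q y h" using assms unfolding hist_def by blast+
  have "D0 (\<lambda>s. ?P (s 0))" by (intro D0_intros)
  then have P: "?P (j h)" using \<open>?P h\<close> by (rule pres1[OF pres_j, THEN iffD1])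
  have "D0 (\<lambda>s. ?Q (s 0) (s (Suc 0)))" by (intro D0_intros)
  then have Q: "\<forall>y. ?Q y (j h)"
    using \<open>\<forall>y. ?Q y h\<close> by (rule Sigma1_all_D0[where P = "\<lambda>z x y. ?Q z x" and y = h, THEN iffD1])
  show ?thesis unfolding hist_def using P Q by blast
qed

lemma acc_j:
  assumes "acc v h"
  shows "acc (j v) (j h)"
proof -
  let ?Q = "\<lambda>y v h. (y \<epsilon> v \<longleftrightarrow> (\<exists>c. c \<epsilon> h \<and> subset_of y c))"
  have "D0 (\<lambda>s. ?Q (s 0) (s (Suc 0)) (s (Suc (Suc 0))))" by (intro D0_intros)
  then show ?thesis using assms unfolding acc_def by (rule Sigma1_all_D0[THEN iffD1])
qed

lemma Lev_j: "Lev v \<Longrightarrow> Lev (j v)"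
  unfolding Lev_def using hist_j acc_j by blast

text \<open>If \<open>u\<close> were the least level with \<open>j u \<epsilon> u\<close>, then
  applying \<open>j\<close> would make the smaller level \<open>j u\<close> another one.\<close>

lemma Lev_subset_j:
  assumes "Lev v"
  shows "v = j v \<or> v \<epsilon> j v"
proof (rule ccontr)
  assume "\<not> ?thesis"
  then have "j v \<epsilon> v" using Lev_linear[OF assms Lev_j[OF assms]] by blast
  moreover have "pDef (\<lambda>v. j v \<epsilon> v)"
    unfolding pDef_def by (intro pDef_intros DF_pDefF[OF jdef])
  ultimately obtain u where "Lev u" "j u \<epsilon> u" "\<And>w. w \<epsilon> u \<Longrightarrow> Lev w \<Longrightarrow> \<not> j w \<epsilon> w"
    using Lev_least[OF _ assms] by blast
  then show False using Lev_j pres_mem[OF pres_j] by blast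
qed

lemma emb_j: "emb j"
proof -
  have "cofin j"
    unfolding cofin_def
  proof
    fix y
    obtain v where v: "Lev v" "subset_of y v" using Lev_cofinal_subset by blast
    then have "subset_of v (j v)" using Lev_subset_j Lev_transitive Lev_j by (metis subset_refl)
    then show "\<exists>v. subset_of y (j v)" using v(2) subset_trans by blast
  qed
  then show ?thesis unfolding emb_def using pres_j jdef by blast
qed

text \<open>The witness is \<open>V\<^sub>\<kappa>\<close>, where \<open>\<kappa>\<close> is the critical point of \<open>j\<close>.\<close>

lemma critical_level:
  assumes "j \<noteq> id"
  shows "\<exists>u. (\<forall>y. y \<epsilon> u \<longrightarrow> j y = y) \<and> u \<epsilon> j u \<and> Lev (j u)"
proof -
  obtain x where x: "j x \<noteq> x" using assms by (metis eq_id_iff)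
  obtain v where v: "Lev v" "subset_of x v" using Lev_cofinal_subset by blast
  have "pDef (\<lambda>v. \<exists>x. subset_of x v \<and> j x \<noteq> x)"
    unfolding pDef_def by (intro pDef_intros DF_pDefF[OF jdef] Def_subset)
  then obtain u where u: "Lev u" "\<exists>x. subset_of x u \<and> j x \<noteq> x"
    and min: "\<And>w x. w \<epsilon> u \<Longrightarrow> Lev w \<Longrightarrow> subset_of x w \<Longrightarrow> j x = x"
    using Lev_least[OF _ v(1)] v(2) x by blast
  have fixed: "j y = y" if "y \<epsilon> u" for y
    using Lev_below[OF u(1) that] min by blast
  \<comment> \<open>Were \<open>u\<close> fixed, \<open>j x\<close> would again be a subset of
    \<open>u\<close>; since \<open>j\<close> fixes the elements of \<open>u\<close>, it would have
    the same elements as \<open>x\<close>.\<close>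
  have "u \<noteq> j u"
  proof
    assume eq: "u = j u"
    obtain x where x: "subset_of x u" "j x \<noteq> x" using u(2) by blast
    have "subset_of (j x) u" using x(1) pres_subset[OF pres_j] eq by metis
    then have "w \<epsilon> j x \<longleftrightarrow> w \<epsilon> x" for w
      using fixed[of w] pres_mem[OF pres_j, of w x] x(1) unfolding subset_of_def by metis
    then show False using x(2) set_eqI by blast
  qed
  then show ?thesis using fixed Lev_subset_j[OF u(1)] Lev_j[OF u(1)] by blast
qed

end

subsection \<open>Internal iteration\<close>

text \<open>\<open>Iter k n a b\<close> means \<open>b = k\<^sup>n(a)\<close>, where \<open>n\<close> is a Zermelo numeral of the structure, which may be
  nonstandard.\<close>

definition chain :: "('a \<Rightarrow> 'a) \<Rightarrow> 'a \<Rightarrow> 'a \<Rightarrow> bool" where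
  "chain k t a \<longleftrightarrow>
    (\<forall>z. z \<epsilon> t \<longrightarrow> z = pr emp a \<or> (\<exists>m b. pr m b \<epsilon> t \<and> z = pr (single m) (k b)))"

definition Iter :: "('a \<Rightarrow> 'a) \<Rightarrow> 'a \<Rightarrow> 'a \<Rightarrow> 'a \<Rightarrow> bool" where
  "Iter k n a b \<longleftrightarrow> (\<exists>t. chain k t a \<and> pr n b \<epsilon> t)"

lemma Iter_emp: "Iter k emp a b \<longleftrightarrow> b = a"
proof
  assume "Iter k emp a b"
  then show "b = a" unfolding Iter_def chain_def by force
next
  assume "b = a"
  then show "Iter k emp a b" unfolding Iter_def chain_def by (intro exI[of _ "single (pr emp a)"]) simp
qed

text \<open>A chain justifies each entry by an earlier one and need not be a function, so it can
  always be prolonged by one entry. Uniqueness of the value is left to induction on the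
  numeral.\<close>

lemma Iter_single: "Iter k (single n) a b \<longleftrightarrow> (\<exists>b'. Iter k n a b' \<and> b = k b')"
proof
  assume "Iter k (single n) a b"
  then obtain t where t: "chain k t a" "pr (single n) b \<epsilon> t" unfolding Iter_def by blast
  then obtain b' where "pr n b' \<epsilon> t" "b = k b'" unfolding chain_def by fastforce
  then show "\<exists>b'. Iter k n a b' \<and> b = k b'" using t(1) unfolding Iter_def by blast
next
  assume "\<exists>b'. Iter k n a b' \<and> b = k b'"
  then obtain t b' where t: "chain k t a" "pr n b' \<epsilon> t" "b = k b'" unfolding Iter_def by blast
  have "chain k (bin_un t (single (pr (single n) b))) a"
    using t unfolding chain_def by (simp only: mem_bin_un mem_single) blast
  then show "Iter k (single n) a b" unfolding Iter_def by (intro exI[of _ "bin_un t (single (pr (single n) b))"]) simp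
qed

definition iter :: "('a \<Rightarrow> 'a) \<Rightarrow> 'a \<Rightarrow> 'a \<Rightarrow> 'a" where
  "iter k n a = (THE b. Iter k n a b)"

definition shift :: "('a \<Rightarrow> 'a) \<Rightarrow> 'a \<Rightarrow> 'a \<Rightarrow> 'a" where
  "shift k n = act (iter k n) k"

text \<open>\<open>shift k n\<close> is the iterate \<open>(k\<^sup>n)\<^sup>+(k)\<close>, and \<open>shift_rel k n\<close> is its graph in first-order form.\<close>

definition shift_rel :: "('a \<Rightarrow> 'a) \<Rightarrow> 'a \<Rightarrow> 'a \<Rightarrow> 'a \<Rightarrow> bool" where
  "shift_rel k n x y \<longleftrightarrow> (\<exists>v g e. (\<forall>z. z \<epsilon> g \<longleftrightarrow> (\<exists>a. a \<epsilon> v \<and> z = pr a (k a))) \<and> Iter k n g e \<and> pr x y \<epsilon> e)"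

section \<open>Prewellorders and continuity\<close>

abbreviation lt :: "'a \<Rightarrow> 'a \<Rightarrow> 'a \<Rightarrow> bool" where
  "lt R x y \<equiv> pr x y \<epsilon> R \<and> \<not> pr y x \<epsilon> R"

definition lin :: "'a \<Rightarrow> 'a \<Rightarrow> bool" where
  "lin R F \<longleftrightarrow> (\<forall>x y. pr x y \<epsilon> R \<longrightarrow> x \<epsilon> F \<and> y \<epsilon> F) \<and>
    (\<forall>x. x \<epsilon> F \<longrightarrow> (\<forall>y. y \<epsilon> F \<longrightarrow> pr x y \<epsilon> R \<or> pr y x \<epsilon> R)) \<and>
    (\<forall>x y. pr x y \<epsilon> R \<longrightarrow> (\<forall>z. z \<epsilon> F \<longrightarrow> pr y z \<epsilon> R \<longrightarrow> pr x z \<epsilon> R))"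

definition pwo :: "'a \<Rightarrow> 'a \<Rightarrow> bool" where
  "pwo R F \<longleftrightarrow> lin R F \<and>
    (\<forall>Y. subset_of Y F \<longrightarrow> Y \<noteq> emp \<longrightarrow> (\<exists>m. m \<epsilon> Y \<and> (\<forall>y. y \<epsilon> Y \<longrightarrow> pr m y \<epsilon> R)))"

text \<open>\<open>k\<close> maps the initial segment of \<open>R\<close> below \<open>x\<close> cofinally into its image.\<close>

definition continuous_at :: "('a \<Rightarrow> 'a) \<Rightarrow> 'a \<Rightarrow> 'a \<Rightarrow> bool" where
  "continuous_at k R x \<longleftrightarrow> (\<forall>z. lt (k R) z (k x) \<longrightarrow> (\<exists>y. lt R y x \<and> pr z (k y) \<epsilon> k R))"

lemma lin_pres: "pres k \<Longrightarrow> lin R F \<Longrightarrow> lin (k R) (k F)"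
  by (rule pres2[where B = lin, THEN iffD1]) (assumption, unfold lin_def, intro D0_intros)

lemma not_empD: "x \<noteq> emp \<Longrightarrow> \<exists>y. y \<epsilon> x"
  by (metis mem_emp set_eqI)

section \<open>The numbers of the structure and the iterates of \<open>j\<close>\<close>

context
  fixes j u
  assumes S: "Sigma1_elementary mem j" and jdef: "pDefF j"
    and fixed: "\<And>y. y \<epsilon> u \<Longrightarrow> j y = y" and u: "u \<epsilon> j u" "Lev (j u)"
begin

lemma j_emb: "emb j" and j_pres: "pres j"
  using emb_j[OF S jdef] pres_j[OF S jdef] by blast+

text \<open>Being a subset of \<open>u\<close>, which lies in the level \<open>j u\<close>,
  \<open>x\<close> belongs to \<open>j u\<close>; as \<open>x\<close> equals \<open>j x\<close>, it
  belongs to \<open>u\<close>. This closure replaces an axiom of Infinity.\<close>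

lemma subset_crit: "subset_of x u \<Longrightarrow> j x = x \<Longrightarrow> x \<epsilon> u"
  using Lev_potent[OF u(2,1)] pres_mem[OF j_pres, of x u] by metis

lemma emp_crit: "emp \<epsilon> u"
  by (rule subset_crit) (simp_all add: subset_of_def pres_emp[OF j_pres])

lemma single_crit: "n \<epsilon> u \<Longrightarrow> single n \<epsilon> u"
  by (rule subset_crit) (simp_all add: subset_of_def pres_single[OF j_pres] fixed)

definition omega :: 'a where
  "omega = Sep u (\<lambda>n. \<forall>I. subset_of I u \<longrightarrow> emp \<epsilon> I \<longrightarrow> (\<forall>m. m \<epsilon> I \<longrightarrow> single m \<epsilon> I) \<longrightarrow> n \<epsilon> I)"

lemma mem_omega: "n \<epsilon> omega \<longleftrightarrow> n \<epsilon> u \<and>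
    (\<forall>I. subset_of I u \<longrightarrow> emp \<epsilon> I \<longrightarrow> (\<forall>m. m \<epsilon> I \<longrightarrow> single m \<epsilon> I) \<longrightarrow> n \<epsilon> I)"
  unfolding omega_def by (rule mem_Sep) (unfold pDef_def, intro pDef_intros Def_subset DF_emp DF_single)

lemma emp_omega: "emp \<epsilon> omega" and single_omega: "n \<epsilon> omega \<Longrightarrow> single n \<epsilon> omega"
  unfolding mem_omega using emp_crit single_crit by blast+

lemma omega_fixed: "n \<epsilon> omega \<Longrightarrow> j n = n"
  unfolding mem_omega using fixed by blast

lemma omega_induct:
  assumes Q: "pDef Q" and "Q emp" "\<And>n. n \<epsilon> omega \<Longrightarrow> Q n \<Longrightarrow> Q (single n)" and n: "n \<epsilon> omega"
  shows "Q n"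
proof -
  have "subset_of (Sep omega Q) u" unfolding subset_of_def mem_Sep[OF Q] by (simp add: mem_omega)
  moreover have "emp \<epsilon> Sep omega Q" unfolding mem_Sep[OF Q] using assms(2) emp_omega by blast
  moreover have "\<forall>m. m \<epsilon> Sep omega Q \<longrightarrow> single m \<epsilon> Sep omega Q"
    unfolding mem_Sep[OF Q] using assms(3) single_omega by blast
  ultimately have "n \<epsilon> Sep omega Q" using n unfolding mem_omega by blast
  then show ?thesis unfolding mem_Sep[OF Q] by blast
qed

lemma omega_cases: "n \<epsilon> omega \<Longrightarrow> n = emp \<or> (\<exists>m. m \<epsilon> omega \<and> n = single m)"
  by (rule omega_induct[where Q = "\<lambda>n. n = emp \<or> (\<exists>m. m \<epsilon> omega \<and> n = single m)"])
    (unfold pDef_def, intro pDef_intros DF_emp DF_single, auto)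

text \<open>That every element is \<open>emp\<close> or the singleton of an element is bounded and
  passes to \<open>j omega\<close>; a minimal new element would be the singleton of an old one. Thus
  an index found in \<open>j omega\<close> is a usable index, and \<open>j\<close> fixes it.\<close>

lemma j_omega: "n \<epsilon> j omega \<Longrightarrow> n \<epsilon> omega"
proof (rule ccontr)
  assume n: "n \<epsilon> j omega" "\<not> n \<epsilon> omega"
  have "\<forall>n. n \<epsilon> omega \<longrightarrow> n = emp \<or> (\<exists>m. m \<epsilon> omega \<and> is_upair n m m)"
    using omega_cases by (auto simp: is_upair_iff single_def)
  then have "\<forall>n. n \<epsilon> j omega \<longrightarrow> n = emp \<or> (\<exists>m. m \<epsilon> j omega \<and> is_upair n m m)"
    by (rule pres1[OF j_pres, THEN iffD1, rotated]) (intro D0_intros D0_upair D0_eq_emp)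
  then have cases: "n = emp \<or> (\<exists>m. m \<epsilon> j omega \<and> n = single m)" if "n \<epsilon> j omega" for n
    using that by (auto simp: is_upair_iff single_def)
  have Q: "pDef (\<lambda>n. \<not> n \<epsilon> omega)" unfolding pDef_def by (intro pDef_intros)
  have "n \<epsilon> Sep (j omega) (\<lambda>n. \<not> n \<epsilon> omega)" using n unfolding mem_Sep[OF Q] by blast
  then obtain m where "m \<epsilon> Sep (j omega) (\<lambda>n. \<not> n \<epsilon> omega)"
    "\<And>w. w \<epsilon> m \<Longrightarrow> \<not> w \<epsilon> Sep (j omega) (\<lambda>n. \<not> n \<epsilon> omega)"
    using foundation[of "Sep (j omega) (\<lambda>n. \<not> n \<epsilon> omega)"] unfolding is_empty_def by blast
  then have m: "m \<epsilon> j omega" "\<not> m \<epsilon> omega" "\<And>w. w \<epsilon> m \<Longrightarrow> w \<epsilon> j omega \<Longrightarrow> w \<epsilon> omega"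
    unfolding mem_Sep[OF Q] by blast+
  then obtain m' where "m' \<epsilon> j omega" "m = single m'" using cases[OF m(1)] emp_omega by blast
  then show False using m single_omega by simp
qed

lemma Def_Iter_j: "DF UNIV f \<Longrightarrow> DF UNIV g \<Longrightarrow> DF UNIV h \<Longrightarrow> Def UNIV (\<lambda>s. Iter j (f s) (g s) (h s))"
  by (rule Def_comp3) (unfold Iter_def chain_def,
      intro pDef_intros DF_pr DF_single DF_emp DF_pDefF[OF jdef])

lemma Iter_total: "n \<epsilon> omega \<Longrightarrow> \<forall>a. \<exists>b. Iter j n a b \<and> (\<forall>b'. Iter j n a b' \<longrightarrow> b' = b)"
  by (rule omega_induct[where Q = "\<lambda>n. \<forall>a. \<exists>b. Iter j n a b \<and> (\<forall>b'. Iter j n a b' \<longrightarrow> b' = b)"])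
    (unfold pDef_def, intro pDef_intros Def_Iter_j, auto simp: Iter_emp Iter_single, metis)

lemma iter_graph: "n \<epsilon> omega \<Longrightarrow> Iter j n a b \<longleftrightarrow> b = iter j n a"
  unfolding iter_def using Iter_total[of n] by (metis (mono_tags, lifting) the_equality)

lemma iter_emp: "iter j emp a = a"
  using iter_graph[OF emp_omega, of a a] Iter_emp by simp

lemma iter_single: "n \<epsilon> omega \<Longrightarrow> iter j (single n) a = j (iter j n a)"
  using iter_graph[OF single_omega, of n a] Iter_single[of j n a] iter_graph[of n a] by metis

lemma emb_iter:
  assumes n: "n \<epsilon> omega"
  shows "emb (iter j n)"
proof -
  have "pDefF (iter j n)"
    unfolding pDefF_def iter_graph[OF n, symmetric] by (intro pDef_intros Def_Iter_j)
  moreover have "pres (iter j n)"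
    unfolding pres_def
  proof (intro allI impI)
    fix B w x y z assume B: "D0 (\<lambda>s. B (s 0) (s 1) (s 2) (s 3))"
    \<comment> \<open>Induction needs a definable predicate and \<open>pres\<close> is none, so it
      is carried out for one fixed \<open>B\<close>, with the iterates described through
      \<open>Iter\<close>.\<close>
    let ?Q = "\<lambda>n. \<forall>w w' x x' y y' z z'. Iter j n w w' \<longrightarrow> Iter j n x x' \<longrightarrow> Iter j n y y' \<longrightarrow> Iter j n z z' \<longrightarrow>
      (B w x y z \<longleftrightarrow> B w' x' y' z')"
    have BD: "Def UNIV (\<lambda>s. B (e s) (f s) (g s) (h s))"
      if "DF UNIV e" "DF UNIV f" "DF UNIV g" "DF UNIV h" for e f g h
      by (rule Def_comp4[OF Fm_imp_Def[OF D0_imp_Fm[OF B]] that])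
    have "pDef ?Q" unfolding pDef_def by (intro pDef_intros Def_Iter_j BD)
    then have "?Q n"
    proof (rule omega_induct[OF _ _ _ n])
      fix m assume Qm: "?Q m"
      show "?Q (single m)"
        unfolding Iter_single
      proof (intro allI impI, elim exE conjE)
        fix w w' x x' y y' z z' w1 x1 y1 z1
        assume "Iter j m w w1" "Iter j m x x1" "Iter j m y y1" "Iter j m z z1"
        then have "B w x y z \<longleftrightarrow> B w1 x1 y1 z1" using Qm by blast
        also have "\<dots> \<longleftrightarrow> B (j w1) (j x1) (j y1) (j z1)"
          using j_pres B unfolding pres_def by blast
        finally show "B w x y z \<longleftrightarrow> B w' x' y' z'"
          if "w' = j w1" "x' = j x1" "y' = j y1" "z' = j z1" using that by simp
      qed
    qed (simp add: Iter_emp)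
    then show "B w x y z \<longleftrightarrow> B (iter j n w) (iter j n x) (iter j n y) (iter j n z)"
      by (simp add: iter_graph[OF n])
  qed
  moreover have "\<forall>y. \<exists>v v'. Iter j n v v' \<and> subset_of y v'"
  proof (rule omega_induct[OF _ _ _ n])
    show "pDef (\<lambda>n. \<forall>y. \<exists>v v'. Iter j n v v' \<and> subset_of y v')"
      unfolding pDef_def by (intro pDef_intros Def_Iter_j Def_subset)
    show "\<forall>y. \<exists>v v'. Iter j emp v v' \<and> subset_of y v'" unfolding Iter_emp using subset_refl by blast
    fix m assume m: "\<forall>y. \<exists>v v'. Iter j m v v' \<and> subset_of y v'"
    show "\<forall>y. \<exists>v v'. Iter j (single m) v v' \<and> subset_of y v'"
    proof
      fix y
      obtain y' where y: "subset_of y (j y')" using emb_cofin[OF j_emb] unfolding cofin_def by blast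
      obtain v v' where "Iter j m v v'" "subset_of y' v'" using m by blast
      then have "Iter j (single m) v (j v')" "subset_of y (j v')"
        using y pres_subset[OF j_pres, of y' v'] subset_trans unfolding Iter_single by blast+
      then show "\<exists>v v'. Iter j (single m) v v' \<and> subset_of y v'" by blast
    qed
  qed
  then have "cofin (iter j n)" unfolding cofin_def by (simp add: iter_graph[OF n])
  ultimately show ?thesis unfolding emb_def by blast
qed

lemma emb_shift: "n \<epsilon> omega \<Longrightarrow> emb (shift j n)"
  unfolding shift_def by (rule emb_act[OF emb_iter j_emb])

lemma shift_emp: "shift j emp x = j x"
  unfolding shift_def using act_image[OF emb_iter[OF emp_omega] j_emb, of x] by (simp add: iter_emp)

text \<open>This shows that no iterate is trivial: if \<open>j\<close> moves \<open>x\<close>, then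
  \<open>shift j n\<close> moves \<open>iter j n x\<close>, as \<open>iter j n\<close> is
  injective.\<close>

lemma shift_iter: "n \<epsilon> omega \<Longrightarrow> shift j n (iter j n x) = iter j n (j x)"
  unfolding shift_def by (rule act_image[OF emb_iter j_emb])

text \<open>\<open>iter j n (res j v)\<close> is a piece of the graph of \<open>j\<^sub>n\<close>.
  Applying \<open>j\<close> turns it into \<open>iter j (single n) (res j v)\<close>, a piece of the
  graph of the next iterate.\<close>

lemma shift_image_eq:
  assumes n: "n \<epsilon> omega" and "pr x y \<epsilon> j (iter j n (res j v))"
  shows "y = shift j (single n) x"
  using act_eq[OF emb_iter[OF single_omega[OF n]] j_emb, of x y v] assms(2)
  by (simp add: iter_single[OF n] shift_def)

lemma shift_mem_image:
  assumes n: "n \<epsilon> omega"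
  shows "\<exists>v. \<forall>x. x \<epsilon> a \<longrightarrow> pr x (shift j n x) \<epsilon> iter j n (res j v)"
proof -
  obtain v where "subset_of a (iter j n v)" using emb_cofin[OF emb_iter[OF n]] unfolding cofin_def by blast
  then show ?thesis
    unfolding shift_def using act_mem[OF emb_iter[OF n] j_emb] unfolding subset_of_def by blast
qed

lemma j_shift:
  assumes n: "n \<epsilon> omega"
  shows "j (shift j n a) = shift j (single n) (j a)"
proof -
  obtain v where "pr a (shift j n a) \<epsilon> iter j n (res j v)" using shift_mem_image[OF n, of "single a"] by auto
  then have "pr (j a) (j (shift j n a)) \<epsilon> j (iter j n (res j v))" by (simp add: pres_pr_mem[OF j_pres])
  then show ?thesis by (rule shift_image_eq[OF n])
qed

lemma shift_rel_shift:
  assumes n: "n \<epsilon> omega"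
  shows "shift_rel j n x y \<longleftrightarrow> y = shift j n x"
proof -
  have "(\<forall>z. z \<epsilon> g \<longleftrightarrow> (\<exists>a. a \<epsilon> v \<and> z = pr a (j a))) \<longleftrightarrow> g = res j v" for g v
    using mem_res[OF j_emb] by (metis set_eqI)
  then show ?thesis
    unfolding shift_rel_def shift_def act_graph[OF emb_iter[OF n] j_emb] iter_graph[OF n] by simp
qed

lemma Def_shift_rel_j: "DF UNIV f \<Longrightarrow> DF UNIV g \<Longrightarrow> DF UNIV h \<Longrightarrow> Def UNIV (\<lambda>s. shift_rel j (f s) (g s) (h s))"
  by (rule Def_comp3) (unfold shift_rel_def, intro pDef_intros DF_pr Def_Iter_j DF_pDefF[OF jdef])

text \<open>Linearity is bounded, but minimality speaks of all subsets \<open>Y\<close> and is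
  \<open>\<Pi>\<^sub>1\<close>, so here the \<open>\<Sigma>\<^sub>1\<close>-elementarity of
  \<open>j\<close> itself is used.\<close>

lemma pwo_j:
  assumes "pwo R F"
  shows "pwo (j R) (j F)"
proof -
  let ?P = "\<lambda>Y R F. subset_of Y F \<longrightarrow> Y \<noteq> emp \<longrightarrow> (\<exists>m. m \<epsilon> Y \<and> (\<forall>y. y \<epsilon> Y \<longrightarrow> pr m y \<epsilon> R))"
  have "D0 (\<lambda>s. ?P (s 0) (s (Suc 0)) (s (Suc (Suc 0))))" by (intro D0_intros D0_eq_emp)
  then show ?thesis
    using assms lin_pres[OF j_pres] unfolding pwo_def using Sigma1_all_D0[OF S jdef, where P = ?P and x = R and y = F] by blast
qed

text \<open>Continuity of \<open>shift j n\<close> with \<open>n\<close> as a variable of the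
  formula, as needed to separate the set of all pairs \<open>(n, y)\<close> such that
  \<open>j\<^sub>n\<close> is continuous at \<open>y\<close>.\<close>

definition cont_rel :: "'a \<Rightarrow> 'a \<Rightarrow> 'a \<Rightarrow> bool" where
  "cont_rel n R x \<longleftrightarrow> (\<exists>R' x'. shift_rel j n R R' \<and> shift_rel j n x x' \<and>
    (\<forall>z. lt R' z x' \<longrightarrow> (\<exists>y y'. lt R y x \<and> shift_rel j n y y' \<and> pr z y' \<epsilon> R')))"

lemma cont_rel_iff: "n \<epsilon> omega \<Longrightarrow> cont_rel n R x \<longleftrightarrow> continuous_at (shift j n) R x"
  unfolding cont_rel_def continuous_at_def by (simp add: shift_rel_shift)

lemma Def_cont_rel:
  "DF UNIV f \<Longrightarrow> DF UNIV g \<Longrightarrow> DF UNIV h \<Longrightarrow> Def UNIV (\<lambda>s. cont_rel (f s) (g s) (h s))"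
  by (rule Def_comp3) (unfold cont_rel_def, intro pDef_intros DF_pr Def_shift_rel_j)

text \<open>If \<open>j\<close> is discontinuous at \<open>x\<close>, let \<open>w\<close> be the
  supremum in \<open>j R\<close> of the image of the segment below \<open>x\<close>. Applying
  \<open>j\<close> to the hypothesis \<open>below\<close> yields an iterate \<open>k\<close>
  continuous at \<open>w\<close> with respect to \<open>j R\<close>. Since \<open>j\<close> embeds
  the segment below \<open>x\<close> cofinally into the one below \<open>w\<close>, continuity can
  be pulled back from \<open>w\<close> to \<open>x\<close>.\<close>

lemma continuous_iterate_step:
  assumes R: "pwo R F" and x: "x \<epsilon> F"
    and below: "\<And>y. lt R y x \<Longrightarrow> \<exists>n. n \<epsilon> omega \<and> continuous_at (shift j n) R y"
  shows "\<exists>n. n \<epsilon> omega \<and> continuous_at (shift j n) R x"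
proof (cases "continuous_at j R x")
  case True
  moreover have "shift j emp = j" using shift_emp by blast
  ultimately show ?thesis using emp_omega by metis
next
  case False
  have linR: "lin R F" using R unfolding pwo_def by blast
  have RF: "y \<epsilon> F" "z \<epsilon> F" if "pr y z \<epsilon> R" for y z using linR that unfolding lin_def by blast+
  have linS: "lin (j R) (j F)" by (rule lin_pres[OF j_pres linR])
  have SF: "y \<epsilon> j F" "z \<epsilon> j F" if "pr y z \<epsilon> j R" for y z using linS that unfolding lin_def by blast+
  have Stot: "pr y z \<epsilon> j R \<or> pr z y \<epsilon> j R" if "y \<epsilon> j F" "z \<epsilon> j F" for y z
    using linS that unfolding lin_def by blast
  have Strans: "pr a c \<epsilon> j R" if "pr a b \<epsilon> j R" "pr b c \<epsilon> j R" for a b c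
    using linS that SF unfolding lin_def by blast

  let ?T = "\<lambda>y. lt R y x"
  have QT: "pDef ?T" unfolding pDef_def by (intro pDef_intros DF_pr)
  define T where "T = Sep F ?T"
  have T: "y \<epsilon> T \<longleftrightarrow> lt R y x" for y unfolding T_def mem_Sep[OF QT] using RF by blast

  \<comment> \<open>The points below \<open>j x\<close> but strictly above the image of
    \<open>T\<close>: discontinuity provides one, and \<open>w\<close> is the least of them.\<close>
  let ?bd = "\<lambda>z. lt (j R) z (j x) \<and> (\<forall>y. y \<epsilon> T \<longrightarrow> \<not> pr z (j y) \<epsilon> j R)"
  have Qbd: "pDef ?bd" unfolding pDef_def by (intro pDef_intros DF_pr DF_pDefF[OF jdef])
  obtain z0 where "?bd z0" using False unfolding continuous_at_def T by blast
  then have "z0 \<epsilon> Sep (j F) ?bd" unfolding mem_Sep[OF Qbd] using SF by blast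
  then have "Sep (j F) ?bd \<noteq> emp" using mem_emp by metis
  moreover have "subset_of (Sep (j F) ?bd) (j F)" unfolding subset_of_def mem_Sep[OF Qbd] by blast
  ultimately obtain w where "w \<epsilon> Sep (j F) ?bd" "\<And>z. z \<epsilon> Sep (j F) ?bd \<Longrightarrow> pr w z \<epsilon> j R"
    using pwo_j[OF R] unfolding pwo_def by blast
  then have w: "w \<epsilon> j F" "?bd w" and least: "\<And>z. z \<epsilon> j F \<Longrightarrow> ?bd z \<Longrightarrow> pr w z \<epsilon> j R"
    unfolding mem_Sep[OF Qbd] by blast+

  let ?N = "\<lambda>p. \<exists>n y. p = pr n y \<and> cont_rel n R y"
  have QN: "pDef ?N" unfolding pDef_def by (intro pDef_intros DF_pr Def_cont_rel)
  define N where "N = Sep (prod omega T) ?N"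
  have N: "pr n y \<epsilon> N \<longleftrightarrow> n \<epsilon> omega \<and> y \<epsilon> T \<and> continuous_at (shift j n) R y" for n y
    unfolding N_def mem_Sep[OF QN] using cont_rel_iff by auto
  let ?P = "\<lambda>F x R T. \<forall>y. y \<epsilon> F \<longrightarrow> pr y x \<epsilon> R \<longrightarrow> \<not> pr x y \<epsilon> R \<longrightarrow> y \<epsilon> T"
  have "?P F x R T" using T by blast
  then have "?P (j F) (j x) (j R) (j T)"
    by (rule pres4D[OF j_pres, where B = ?P]) (intro D0_intros)
  then have wT: "w \<epsilon> j T" using w by blast
  let ?P = "\<lambda>T W N. \<forall>y. y \<epsilon> T \<longrightarrow> (\<exists>n. n \<epsilon> W \<and> pr n y \<epsilon> N)"
  have "?P T omega N" using below T N by blast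
  then have "?P (j T) (j omega) (j N)"
    by (rule pres3D[OF j_pres, where B = ?P]) (intro D0_intros)
  \<comment> \<open>The index comes from \<open>j omega\<close>; \<open>j_omega\<close> brings it
    back to \<open>omega\<close>, where \<open>j\<close> fixes it. So \<open>j\<close> maps the
    slice of \<open>N\<close> at \<open>n\<close> to the slice of \<open>j N\<close> at the same
    \<open>n\<close>.\<close>
  then obtain n where n: "n \<epsilon> omega" "pr n w \<epsilon> j N" using wT j_omega by blast

  have Qn: "pDef (\<lambda>y. pr n y \<epsilon> N)" unfolding pDef_def by (intro pDef_intros DF_pr)
  define Nn where "Nn = Sep T (\<lambda>y. pr n y \<epsilon> N)"
  let ?P = "\<lambda>T n N Nn. \<forall>y. y \<epsilon> T \<longrightarrow> pr n y \<epsilon> N \<longrightarrow> y \<epsilon> Nn"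
  have Nn: "y \<epsilon> Nn \<longleftrightarrow> y \<epsilon> T \<and> pr n y \<epsilon> N" for y unfolding Nn_def by (rule mem_Sep[OF Qn])
  have "?P T n N Nn" using Nn by blast
  then have "?P (j T) (j n) (j N) (j Nn)"
    by (rule pres4D[OF j_pres, where B = ?P]) (intro D0_intros)
  then have wN: "w \<epsilon> j Nn" using wT n omega_fixed[OF n(1)] by simp

  \<comment> \<open>\<open>j\<close> sends the graph \<open>e\<close> of \<open>j\<^sub>n\<close> to
    a graph of the next iterate \<open>k\<close>. Continuity of \<open>j\<^sub>n\<close> at the
    points of \<open>Nn\<close> therefore becomes continuity of \<open>k\<close> at the points of
    \<open>j Nn\<close>, among them \<open>w\<close>.\<close>
  define e where "e = res (shift j n) F"
  define k where "k = shift j (single n)"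
  have k: "emb k" unfolding k_def by (rule emb_shift[OF single_omega[OF n(1)]])
  note kp = emb_pres[OF k]
  have e: "pr a b \<epsilon> e \<longleftrightarrow> a \<epsilon> F \<and> b = shift j n a" for a b
    unfolding e_def by (rule pr_mem_res[OF emb_shift[OF n(1)]])
  obtain v0 where v0: "\<And>a. a \<epsilon> F \<Longrightarrow> pr a (shift j n a) \<epsilon> iter j n (res j v0)"
    using shift_mem_image[OF n(1)] by blast
  have "subset_of e (iter j n (res j v0))"
    unfolding subset_of_def e_def mem_res[OF emb_shift[OF n(1)]] using v0 by blast
  then have "subset_of (j e) (j (iter j n (res j v0)))" by (simp add: pres_subset[OF j_pres])
  then have je: "b = k a" if "pr a b \<epsilon> j e" for a b
    unfolding k_def using shift_image_eq[OF n(1)] that subsetD by blast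
  let ?P = "\<lambda>F e. \<forall>a. a \<epsilon> F \<longrightarrow> (\<exists>a' b. pr a' b \<epsilon> e \<and> a' = a)"
  have "?P F e" using e by blast
  then have "?P (j F) (j e)"
    by (rule pres2D[OF j_pres, where B = ?P]) (intro D0_intros)
  then have wk: "pr w (k w) \<epsilon> j e" using w(1) je by blast

  \<comment> \<open>Continuity on all of \<open>Nn\<close>, with the map replaced by its graph to
    make it bounded. Quantified pairs need two variables, hence equations such as
    \<open>y1 = y\<close>.\<close>
  let ?P = "\<lambda>Nn e R R'. \<forall>y. y \<epsilon> Nn \<longrightarrow> (\<forall>y1 y'. pr y1 y' \<epsilon> e \<longrightarrow> y1 = y \<longrightarrow>
      (\<forall>z z1. pr z z1 \<epsilon> R' \<longrightarrow> z1 = y' \<longrightarrow> \<not> pr y' z \<epsilon> R' \<longrightarrow>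
        (\<exists>v v'. pr v v' \<epsilon> e \<and> lt R v y \<and> pr z v' \<epsilon> R')))"
  have "?P Nn e R (shift j n R)"
  proof (intro allI impI)
    fix y y1 y' z z1
    assume "y \<epsilon> Nn" and h: "pr y1 y' \<epsilon> e" "y1 = y" "pr z z1 \<epsilon> shift j n R" "z1 = y'" "\<not> pr y' z \<epsilon> shift j n R"
    then have "continuous_at (shift j n) R y" using Nn N by blast
    moreover have "lt (shift j n R) z (shift j n y)" using h e by simp
    ultimately obtain v where "lt R v y" "pr z (shift j n v) \<epsilon> shift j n R"
      unfolding continuous_at_def by blast
    then show "\<exists>v v'. pr v v' \<epsilon> e \<and> lt R v y \<and> pr z v' \<epsilon> shift j n R" using e RF by blast
  qed
  then have "?P (j Nn) (j e) (j R) (j (shift j n R))"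
    by (rule pres4D[OF j_pres, where B = ?P]) (intro D0_intros)
  moreover have "j (shift j n R) = k (j R)" unfolding k_def by (rule j_shift[OF n(1)])
  ultimately have "?P (j Nn) (j e) (j R) (k (j R))" by (simp only:)
  then have contw: "\<exists>v. lt (j R) v w \<and> pr z (k v) \<epsilon> k (j R)" if "lt (k (j R)) z (k w)" for z
    using wN wk je that by blast

  \<comment> \<open>The image \<open>k g\<close> of the restriction of \<open>j\<close> to
    \<open>T\<close> is an order embedding of the segment of \<open>k R\<close> below
    \<open>k x\<close> into the segment of \<open>k (j R)\<close> below \<open>k w\<close>.\<close>
  define g where "g = res j T"
  have g: "pr a b \<epsilon> g \<longleftrightarrow> a \<epsilon> T \<and> b = j a" for a b
    unfolding g_def by (rule pr_mem_res[OF j_emb])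
  let ?P = "\<lambda>R x g. \<forall>y y1. pr y y1 \<epsilon> R \<longrightarrow> y1 = x \<longrightarrow> \<not> pr x y \<epsilon> R \<longrightarrow> (\<exists>y2 y'. pr y2 y' \<epsilon> g \<and> y2 = y)"
  have "?P R x g"
    using g T by blast
  then have g_dom: "?P (k R) (k x) (k g)"
    by (rule pres3D[OF kp, where B = ?P]) (intro D0_intros)
  have above: "lt (j R) (j y) w" if "y \<epsilon> T" for y
  proof -
    have "\<not> pr w (j y) \<epsilon> j R" using w(2) that by blast
    moreover have "j y \<epsilon> j F" using that T RF pres_mem[OF j_pres] by blast
    ultimately show ?thesis using Stot[OF w(1)] by blast
  qed
  let ?P = "\<lambda>g S w. \<forall>y y'. pr y y' \<epsilon> g \<longrightarrow> lt S y' w"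
  have "?P g (j R) w" using above by (simp add: g)
  then have g_below: "?P (k g) (k (j R)) (k w)"
    by (rule pres3D[OF kp, where B = ?P]) (intro D0_intros)
  let ?P = "\<lambda>g R S. \<forall>y y'. pr y y' \<epsilon> g \<longrightarrow> (\<forall>v v'. pr v v' \<epsilon> g \<longrightarrow> (pr y v \<epsilon> R \<longleftrightarrow> pr y' v' \<epsilon> S))"
  have "?P g R (j R)"
    by (simp add: g pres_pr_mem[OF j_pres])
  then have g_emb: "?P (k g) (k R) (k (j R))"
    by (rule pres3D[OF kp, where B = ?P]) (intro D0_intros)
  have linkS: "lin (k (j R)) (k (j F))" by (rule lin_pres[OF kp linS])

  have "continuous_at k R x"
    unfolding continuous_at_def
  proof (intro allI impI)
    fix z assume z: "lt (k R) z (k x)"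
    \<comment> \<open>Move \<open>z\<close> along \<open>k g\<close> to \<open>z'\<close>, bound
      \<open>z'\<close> by some \<open>k v\<close> with \<open>v\<close> below \<open>w\<close>, and
      \<open>v\<close> by some \<open>j y\<close> since \<open>w\<close> is least. As
      \<open>k (j y)\<close> is the value of \<open>k g\<close> at \<open>k y\<close>, the bound can
      be pulled back.\<close>
    obtain z' where z': "pr z z' \<epsilon> k g" using g_dom z by blast
    obtain v where v: "lt (j R) v w" "pr z' (k v) \<epsilon> k (j R)" using contw g_below z' by blast
    have "lt (j R) v (j x)" using v(1) w(2) Strans by blast
    moreover have "\<not> ?bd v" using least[of v] v(1) SF by blast
    ultimately obtain y where y: "y \<epsilon> T" "pr v (j y) \<epsilon> j R" by blast
    have "pr (k v) (k (j y)) \<epsilon> k (j R)" using y(2) pres_pr_mem[OF kp] by blast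
    then have "pr z' (k (j y)) \<epsilon> k (j R)" using linkS v(2) unfolding lin_def by blast
    moreover have "pr (k y) (k (j y)) \<epsilon> k g" using pres_pr_mem[OF kp] g y(1) by blast
    ultimately have "pr z (k y) \<epsilon> k R" using g_emb z' by blast
    then show "\<exists>y. lt R y x \<and> pr z (k y) \<epsilon> k R" using y(1) T by blast
  qed
  then show ?thesis unfolding k_def using single_omega[OF n(1)] by blast
qed

lemma continuous_iterate:
  assumes R: "pwo R F" and x: "x \<epsilon> F"
  shows "\<exists>n. n \<epsilon> omega \<and> continuous_at (shift j n) R x"
proof (rule ccontr)
  let ?bad = "\<lambda>x. \<not> (\<exists>n. n \<epsilon> omega \<and> cont_rel n R x)"
  have Q: "pDef ?bad" unfolding pDef_def by (intro pDef_intros Def_cont_rel)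
  define Y where "Y = Sep F ?bad"
  have Y: "y \<epsilon> Y \<longleftrightarrow> y \<epsilon> F \<and> \<not> (\<exists>n. n \<epsilon> omega \<and> continuous_at (shift j n) R y)" for y
    unfolding Y_def mem_Sep[OF Q] using cont_rel_iff by blast
  assume "\<not> ?thesis"
  then have "x \<epsilon> Y" unfolding Y using x by blast
  then have "Y \<noteq> emp" using mem_emp by metis
  moreover have "subset_of (Y) F" unfolding subset_of_def Y by blast
  ultimately obtain m where m: "m \<epsilon> Y" "\<And>y. y \<epsilon> Y \<Longrightarrow> pr m y \<epsilon> R"
    using R unfolding pwo_def by blast
  have "\<exists>n. n \<epsilon> omega \<and> continuous_at (shift j n) R y" if "lt R y m" for y
  proof (rule ccontr)
    assume "\<not> ?thesis"
    moreover have "y \<epsilon> F" using that R unfolding pwo_def lin_def by blast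
    ultimately have "pr m y \<epsilon> R" using m(2)[of y] unfolding Y by blast
    then show False using that by blast
  qed
  then have "\<exists>n. n \<epsilon> omega \<and> continuous_at (shift j n) R m"
    using continuous_iterate_step[OF R] m(1) unfolding Y by blast
  then show False using m(1) unfolding Y by blast
qed

end

subsection \<open>Coding assignments by sets\<close>

text \<open>The default \<open>t\<close> on non-pairs keeps the value inside every level that
  contains \<open>t\<close>.\<close>

definition pfst :: "'a \<Rightarrow> 'a" where
  "pfst t = (if \<exists>x y. t = pr x y then THE x. \<exists>y. t = pr x y else t)"

definition psnd :: "'a \<Rightarrow> 'a" where
  "psnd t = (if \<exists>x y. t = pr x y then THE y. \<exists>x. t = pr x y else t)"

lemma pfst_pr [simp]: "pfst (pr x y) = x" and psnd_pr [simp]: "psnd (pr x y) = y"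
  by (simp_all add: pfst_def psnd_def)

lemma pfst_graph: "x = pfst t \<longleftrightarrow> (\<exists>a b. t = pr a b \<and> x = a) \<or> \<not> (\<exists>a b. t = pr a b \<and> a = a) \<and> x = t"
  by (cases "\<exists>a b. t = pr a b") (auto simp: pfst_def)

lemma psnd_graph: "x = psnd t \<longleftrightarrow> (\<exists>a b. t = pr a b \<and> x = b) \<or> \<not> (\<exists>a b. t = pr a b \<and> a = a) \<and> x = t"
  by (cases "\<exists>a b. t = pr a b") (auto simp: psnd_def)

lemma D0_eq_pfst: "D0 (\<lambda>s. s m = pfst (s n))"
  unfolding pfst_graph by (intro D0_intros)

lemma D0_eq_psnd: "D0 (\<lambda>s. s m = psnd (s n))"
  unfolding psnd_graph by (intro D0_intros)

lemma DF_pfst: "DF C f \<Longrightarrow> DF C (\<lambda>s. pfst (f s))"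
  unfolding DF_def[of _ "\<lambda>s. pfst (f s)"]
  by (rule Def_comp2[where P = "\<lambda>x y. x = pfst y", OF Fm_imp_Def[OF D0_imp_Fm[OF D0_eq_pfst]]])
    (auto intro: DF_index DF_lift)

lemma DF_psnd: "DF C f \<Longrightarrow> DF C (\<lambda>s. psnd (f s))"
  unfolding DF_def[of _ "\<lambda>s. psnd (f s)"]
  by (rule Def_comp2[where P = "\<lambda>x y. x = psnd y", OF Fm_imp_Def[OF D0_imp_Fm[OF D0_eq_psnd]]])
    (auto intro: DF_index DF_lift)

text \<open>An assignment is coded by nested pairs, and \<open>pr x t\<close> extends it by
  \<open>x\<close> at index 0. As \<open>dec\<close> is total, every set codes some
  assignment.\<close>

primrec dec :: "nat \<Rightarrow> 'a \<Rightarrow> 'a" where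
  "dec 0 t = pfst t"
| "dec (Suc i) t = dec i (psnd t)"

lemma DF_dec: "DF C f \<Longrightarrow> DF C (\<lambda>s. dec i (f s))"
  by (induction i arbitrary: f) (simp_all add: DF_pfst DF_psnd)

lemma pDef_sat: "pDef (\<lambda>t. sat mem (\<lambda>i. dec (\<rho> i) t) \<phi>)"
proof -
  define L where "L = map (\<lambda>i (s :: nat \<Rightarrow> 'a). dec (\<rho> i) (s 0)) [0..<vbound \<phi>]"
  have "Def UNIV (\<lambda>s. sat mem s \<phi>)" by (rule Fm_imp_Def) (auto simp: Fm_def)
  moreover have "\<forall>f \<in> set L. DF UNIV f" by (auto simp: L_def intro: DF_dec DF_index)
  ultimately have "Def UNIV (\<lambda>s. sat mem (\<lambda>i. if i < length L then (L ! i) s else s (i - length L)) \<phi>)"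
    by (rule Def_comp_list)
  moreover have "sat mem (\<lambda>i. if i < length L then (L ! i) s else s (i - length L)) \<phi> =
      sat mem (\<lambda>i. dec (\<rho> i) (s 0)) \<phi>" for s
    by (rule sat_cong) (simp add: L_def)
  ultimately show ?thesis unfolding pDef_def by simp
qed

subsection \<open>A finite basis for elementarity\<close>

text \<open>Elementarity is not expressible by a single formula. Preservation of the following finitely many
  bounded relations is, and it implies elementarity for all bounded formulas.\<close>

definition basis :: "('a \<Rightarrow> 'a \<Rightarrow> 'a \<Rightarrow> 'a \<Rightarrow> bool) list" where
  "basis = [
    \<lambda>x y _ _. x \<epsilon> y,
    \<lambda>x y _ _. \<not> x \<epsilon> y,
    \<lambda>x y _ _. subset_of x y,
    \<lambda>z x y _. z = pr x y,
    \<lambda>c a b _. \<forall>w. w \<epsilon> c \<longrightarrow> w \<epsilon> a \<and> w \<epsilon> b,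
    \<lambda>c a b _. \<forall>w. w \<epsilon> a \<longrightarrow> w \<epsilon> b \<longrightarrow> w \<epsilon> c,
    \<lambda>c a b _. \<forall>w. w \<epsilon> c \<longrightarrow> w \<epsilon> a \<and> \<not> w \<epsilon> b,
    \<lambda>c a b _. \<forall>w. w \<epsilon> a \<longrightarrow> \<not> w \<epsilon> b \<longrightarrow> w \<epsilon> c,
    \<lambda>g a _ _. \<forall>z. z \<epsilon> g \<longrightarrow> (\<exists>t x. z = pr t x \<and> t \<epsilon> a \<and> x = pfst t),
    \<lambda>g a _ _. \<forall>t. t \<epsilon> a \<longrightarrow> (\<exists>t' x. pr t' x \<epsilon> g \<and> t' = t),
    \<lambda>h a g _. \<forall>z. z \<epsilon> h \<longrightarrow> (\<exists>t y. z = pr t y \<and> t \<epsilon> a \<and> (\<exists>t' y'. pr t' y' \<epsilon> g \<and> t' = psnd t \<and> y' = y)),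
    \<lambda>c a g h. \<forall>t. t \<epsilon> c \<longrightarrow> t \<epsilon> a \<and>
      (\<exists>t1 x. pr t1 x \<epsilon> g \<and> t1 = t \<and> (\<exists>t2 y. pr t2 y \<epsilon> h \<and> t2 = t \<and> x \<epsilon> y)),
    \<lambda>c a g h. \<forall>t. t \<epsilon> a \<longrightarrow>
      (\<exists>t1 x. pr t1 x \<epsilon> g \<and> t1 = t \<and> (\<exists>t2 y. pr t2 y \<epsilon> h \<and> t2 = t \<and> x \<epsilon> y)) \<longrightarrow> t \<epsilon> c,
    \<lambda>c a g h. \<forall>t. t \<epsilon> c \<longrightarrow> t \<epsilon> a \<and>
      (\<exists>t1 x. pr t1 x \<epsilon> g \<and> t1 = t \<and> (\<exists>t2 y. pr t2 y \<epsilon> h \<and> t2 = t \<and> x = y)),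
    \<lambda>c a g h. \<forall>t. t \<epsilon> a \<longrightarrow>
      (\<exists>t1 x. pr t1 x \<epsilon> g \<and> t1 = t \<and> (\<exists>t2 y. pr t2 y \<epsilon> h \<and> t2 = t \<and> x = y)) \<longrightarrow> t \<epsilon> c,
    \<lambda>d b a _. \<forall>x. x \<epsilon> b \<longrightarrow> (\<forall>t. t \<epsilon> a \<longrightarrow> pr x t \<epsilon> d),
    \<lambda>c a b d. \<forall>t. t \<epsilon> c \<longrightarrow> t \<epsilon> a \<and> (\<exists>x. x \<epsilon> b \<and> pr x t \<epsilon> d),
    \<lambda>c a b d. \<forall>t. t \<epsilon> a \<longrightarrow> (\<exists>x. x \<epsilon> b \<and> pr x t \<epsilon> d) \<longrightarrow> t \<epsilon> c,
    \<lambda>X Y H _. \<forall>t. t \<epsilon> X \<longrightarrow> (\<exists>x. x \<epsilon> Y \<and> pr x t \<epsilon> H),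
    \<lambda>Y H X _. \<forall>x t. pr x t \<epsilon> H \<longrightarrow> x \<epsilon> Y \<longrightarrow> t \<epsilon> X]"

text \<open>The clauses of \<open>basis\<close> serve, in order: membership, inclusion and pairs;
  intersection and difference; the graphs of \<open>dec\<close>; the two kinds of atomic formulas; a
  bounded quantifier; and the comparison of growths in \<open>preserved_ex\<close>. Equalities of
  sets are split into two inclusions, so one direction of preservation is enough.\<close>

definition good :: "('a \<Rightarrow> 'a) \<Rightarrow> bool" where
  "good k \<longleftrightarrow> (\<forall>B \<in> set basis. \<forall>w x y z. B w x y z \<longrightarrow> B (k w) (k x) (k y) (k z))"

lemma D0_basis: "B \<in> set basis \<Longrightarrow> D0 (\<lambda>s. B (s 0) (s 1) (s 2) (s 3))"
proof -
  have "\<forall>B \<in> set basis. D0 (\<lambda>s. B (s 0) (s 1) (s 2) (s 3))"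
    unfolding basis_def list.set ball_simps simp_thms
    by (intro conjI; intro D0_intros D0_eq_pfst D0_eq_psnd)
  then show "B \<in> set basis \<Longrightarrow> ?thesis" by blast
qed

lemma pres_good: "pres k \<Longrightarrow> good k"
  unfolding good_def pres_def using D0_basis by blast

text \<open>Elementarity in terms of sets: \<open>k\<close> commutes with intersecting a set with
  the class \<open>A\<close>. Connectives become set operations covered by \<open>basis\<close>;
  singletons give back the usual notion.\<close>

definition preserved :: "('a \<Rightarrow> 'a) \<Rightarrow> ('a \<Rightarrow> bool) \<Rightarrow> bool" where
  "preserved k A \<longleftrightarrow>
    (\<forall>a b. (\<forall>w. w \<epsilon> b \<longleftrightarrow> w \<epsilon> a \<and> A w) \<longrightarrow> (\<forall>w. w \<epsilon> k b \<longleftrightarrow> w \<epsilon> k a \<and> A w))"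

text \<open>The instance of Collection for \<open>A\<close> on \<open>a\<close>, with a level as the
  collecting set.\<close>

definition bounded_on :: "'a \<Rightarrow> ('a \<Rightarrow> bool) \<Rightarrow> bool" where
  "bounded_on a A \<longleftrightarrow>
    (\<exists>v. Lev v \<and> (\<forall>t. t \<epsilon> a \<longrightarrow> (\<exists>x. A (pr x t)) \<longrightarrow> (\<exists>x. x \<epsilon> v \<and> A (pr x t))))"

text \<open>\<open>X\<close> is the increasing union of the sets \<open>Y\<close> obtained from the
  levels \<open>v\<close>; \<open>k\<close> is required to commute with this union.\<close>

definition cont_growth :: "('a \<Rightarrow> 'a) \<Rightarrow> 'a \<Rightarrow> ('a \<Rightarrow> bool) \<Rightarrow> bool" where
  "cont_growth k a A \<longleftrightarrow> (\<forall>X. (\<forall>t. t \<epsilon> X \<longleftrightarrow> t \<epsilon> a \<and> (\<exists>x. A (pr x t))) \<longrightarrow>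
    (\<forall>z. z \<epsilon> k X \<longrightarrow>
      (\<exists>v Y. Lev v \<and> (\<forall>t. t \<epsilon> Y \<longleftrightarrow> t \<epsilon> a \<and> (\<exists>x. x \<epsilon> v \<and> A (pr x t))) \<and> z \<epsilon> k Y)))"

text \<open>Either Collection holds throughout, or \<open>k\<close> is continuous along one failure
  of it. The quantifiers over definable classes make this no single formula.\<close>

definition anchored :: "('a \<Rightarrow> 'a) \<Rightarrow> bool" where
  "anchored k \<longleftrightarrow> (\<forall>A a. pDef A \<longrightarrow> bounded_on a A) \<or>
    (\<exists>A a. pDef A \<and> \<not> bounded_on a A \<and> cont_growth k a A)"

section \<open>From the finite basis to full elementarity\<close>

context
  fixes k
  assumes good: "good k"
begin

lemma goodD: "B w x y z \<Longrightarrow> B \<in> set basis \<Longrightarrow> B (k w) (k x) (k y) (k z)"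
  using good unfolding good_def by blast

lemma good_mem: "k x \<epsilon> k y \<longleftrightarrow> x \<epsilon> y"
proof
  assume "x \<epsilon> y"
  then show "k x \<epsilon> k y" by (rule goodD[where B = "\<lambda>x y _ _. x \<epsilon> y"]) (simp add: basis_def)
next
  have "\<not> k x \<epsilon> k y" if "\<not> x \<epsilon> y"
    using that by (rule goodD[where B = "\<lambda>x y _ _. \<not> x \<epsilon> y"]) (simp add: basis_def)
  then show "k x \<epsilon> k y \<Longrightarrow> x \<epsilon> y" by blast
qed

lemma good_subset: "subset_of x y \<Longrightarrow> subset_of (k x) (k y)"
  by (rule goodD[where B = "\<lambda>x y _ _. subset_of x y"]) (assumption, simp add: basis_def)

lemma good_pr: "k (pr x y) = pr (k x) (k y)"
  by (rule goodD[where B = "\<lambda>z x y _. z = pr x y"]) (rule refl, simp add: basis_def)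

lemma good_int:
  assumes "\<And>w. w \<epsilon> c \<longleftrightarrow> w \<epsilon> a \<and> w \<epsilon> b"
  shows "w \<epsilon> k c \<longleftrightarrow> w \<epsilon> k a \<and> w \<epsilon> k b"
proof -
  have "\<forall>w. w \<epsilon> k c \<longrightarrow> w \<epsilon> k a \<and> w \<epsilon> k b"
    by (rule goodD[where B = "\<lambda>c a b _. \<forall>w. w \<epsilon> c \<longrightarrow> w \<epsilon> a \<and> w \<epsilon> b"])
      (use assms in blast, simp add: basis_def)
  moreover have "\<forall>w. w \<epsilon> k a \<longrightarrow> w \<epsilon> k b \<longrightarrow> w \<epsilon> k c"
    by (rule goodD[where B = "\<lambda>c a b _. \<forall>w. w \<epsilon> a \<longrightarrow> w \<epsilon> b \<longrightarrow> w \<epsilon> c"])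
      (use assms in blast, simp add: basis_def)
  ultimately show ?thesis by blast
qed

lemma good_diff:
  assumes "\<And>w. w \<epsilon> c \<longleftrightarrow> w \<epsilon> a \<and> \<not> w \<epsilon> b"
  shows "w \<epsilon> k c \<longleftrightarrow> w \<epsilon> k a \<and> \<not> w \<epsilon> k b"
proof -
  have "\<forall>w. w \<epsilon> k c \<longrightarrow> w \<epsilon> k a \<and> \<not> w \<epsilon> k b"
    by (rule goodD[where B = "\<lambda>c a b _. \<forall>w. w \<epsilon> c \<longrightarrow> w \<epsilon> a \<and> \<not> w \<epsilon> b"])
      (use assms in blast, simp add: basis_def)
  moreover have "\<forall>w. w \<epsilon> k a \<longrightarrow> \<not> w \<epsilon> k b \<longrightarrow> w \<epsilon> k c"
    by (rule goodD[where B = "\<lambda>c a b _. \<forall>w. w \<epsilon> a \<longrightarrow> \<not> w \<epsilon> b \<longrightarrow> w \<epsilon> c"])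
      (use assms in blast, simp add: basis_def)
  ultimately show ?thesis by blast
qed

definition commutes :: "('a \<Rightarrow> 'a) \<Rightarrow> bool" where
  "commutes f \<longleftrightarrow> (\<forall>a. \<exists>g. (\<forall>t x. pr t x \<epsilon> g \<longleftrightarrow> t \<epsilon> a \<and> x = f t) \<and>
    (\<forall>t x. pr t x \<epsilon> k g \<longleftrightarrow> t \<epsilon> k a \<and> x = f t))"

lemma graph_domain_image:
  assumes "\<And>t. t \<epsilon> a \<Longrightarrow> \<exists>x. pr t x \<epsilon> g" "t \<epsilon> k a"
  shows "\<exists>x. pr t x \<epsilon> k g"
proof -
  have "\<forall>t. t \<epsilon> k a \<longrightarrow> (\<exists>t' x. pr t' x \<epsilon> k g \<and> t' = t)"
    by (rule goodD[where B = "\<lambda>g a _ _. \<forall>t. t \<epsilon> a \<longrightarrow> (\<exists>t' x. pr t' x \<epsilon> g \<and> t' = t)"])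
      (use assms(1) in blast, simp add: basis_def)
  then show ?thesis using assms(2) by blast
qed

lemma graph_exists:
  assumes f: "pDefF f" and b: "\<And>t. t \<epsilon> a \<Longrightarrow> f t \<epsilon> b"
  shows "\<exists>g. \<forall>z. z \<epsilon> g \<longleftrightarrow> (\<exists>t. t \<epsilon> a \<and> z = pr t (f t))"
proof -
  have Q: "pDef (\<lambda>z. \<exists>t. z = pr t (f t))"
    unfolding pDef_def by (intro pDef_intros DF_pr DF_pDefF[OF f])
  show ?thesis
    by (rule exI[of _ "Sep (prod a b) (\<lambda>z. \<exists>t. z = pr t (f t))"])
      (auto simp: mem_Sep[OF Q] mem_prod b)
qed

lemma pair_parts_bound: "\<exists>b. \<forall>t. t \<epsilon> a \<longrightarrow> pfst t \<epsilon> b \<and> psnd t \<epsilon> b"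
proof -
  obtain v where v: "Lev v" "a \<epsilon> v" using Lev_cofinal by blast
  have "pfst t \<epsilon> v \<and> psnd t \<epsilon> v" if "t \<epsilon> a" for t
  proof -
    have t: "t \<epsilon> v" using Lev_transitive[OF v] subsetD that by blast
    show ?thesis
    proof (cases "\<exists>x y. t = pr x y")
      case True
      then obtain x y where xy: "t = pr x y" by blast
      then have "upr x y \<epsilon> t" by (simp add: pr_def)
      then have "upr x y \<epsilon> v" using Lev_transitive[OF v(1) t] subsetD by blast
      then have "subset_of (upr x y) v" by (rule Lev_transitive[OF v(1)])
      then show ?thesis by (simp add: xy subset_of_def)
    qed (simp add: t pfst_def psnd_def)
  qed
  then show ?thesis by blast
qed

lemma pDefF_dec: "pDefF (dec i)"
  unfolding pDefF_def by (intro Def_eq DF_index DF_dec)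

lemma dec_bound: "\<exists>b. \<forall>t. t \<epsilon> a \<longrightarrow> dec i t \<epsilon> b"
proof (induction i arbitrary: a)
  case 0
  then show ?case using pair_parts_bound[of a] by auto
next
  case (Suc i)
  obtain b where b: "\<forall>t. t \<epsilon> a \<longrightarrow> psnd t \<epsilon> b" using pair_parts_bound[of a] by blast
  obtain c where "\<forall>t. t \<epsilon> b \<longrightarrow> dec i t \<epsilon> c" using Suc[of b] by blast
  then show ?case using b by auto
qed

lemma dec_graph: "\<exists>g. \<forall>z. z \<epsilon> g \<longleftrightarrow> (\<exists>t. t \<epsilon> a \<and> z = pr t (dec i t))"
  using dec_bound[of a i] graph_exists[OF pDefF_dec] by blast

text \<open>Since \<open>dec\<close> is single-valued, one inclusion between graphs together with
  the full domain determines the image graph.\<close>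

lemma commutes_dec: "commutes (dec i)"
proof (induction i)
  case 0
  show ?case
    unfolding commutes_def
  proof
    fix a
    obtain g where g: "\<And>z. z \<epsilon> g \<longleftrightarrow> (\<exists>t. t \<epsilon> a \<and> z = pr t (dec 0 t))" using dec_graph by blast
    have "\<forall>z. z \<epsilon> k g \<longrightarrow> (\<exists>t x. z = pr t x \<and> t \<epsilon> k a \<and> x = pfst t)"
      by (rule goodD[where B = "\<lambda>g a _ _. \<forall>z. z \<epsilon> g \<longrightarrow> (\<exists>t x. z = pr t x \<and> t \<epsilon> a \<and> x = pfst t)"])
        (use g in auto, simp add: basis_def)
    moreover have "\<exists>x. pr t x \<epsilon> k g" if "t \<epsilon> k a" for t
      by (rule graph_domain_image[OF _ that]) (auto simp: g)
    ultimately have "pr t x \<epsilon> k g \<longleftrightarrow> t \<epsilon> k a \<and> x = dec 0 t" for t x by fastforce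
    then show "\<exists>g. (\<forall>t x. pr t x \<epsilon> g \<longleftrightarrow> t \<epsilon> a \<and> x = dec 0 t) \<and>
        (\<forall>t x. pr t x \<epsilon> k g \<longleftrightarrow> t \<epsilon> k a \<and> x = dec 0 t)"
      using g by (intro exI[of _ g]) auto
  qed
next
  case (Suc i)
  show ?case
    unfolding commutes_def
  proof
    fix a
    obtain b where b: "\<And>t. t \<epsilon> a \<Longrightarrow> psnd t \<epsilon> b" using pair_parts_bound[of a] by blast
    obtain g where g: "\<And>t x. pr t x \<epsilon> g \<longleftrightarrow> t \<epsilon> b \<and> x = dec i t"
      and kg: "\<And>t x. pr t x \<epsilon> k g \<longleftrightarrow> t \<epsilon> k b \<and> x = dec i t"
      using Suc[unfolded commutes_def, THEN spec, of b] by blast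
    obtain h where h: "\<And>z. z \<epsilon> h \<longleftrightarrow> (\<exists>t. t \<epsilon> a \<and> z = pr t (dec (Suc i) t))" using dec_graph by blast
    have "\<forall>z. z \<epsilon> k h \<longrightarrow> (\<exists>t y. z = pr t y \<and> t \<epsilon> k a \<and>
        (\<exists>t' y'. pr t' y' \<epsilon> k g \<and> t' = psnd t \<and> y' = y))"
      by (rule goodD[where B = "\<lambda>h a g _. \<forall>z. z \<epsilon> h \<longrightarrow> (\<exists>t y. z = pr t y \<and> t \<epsilon> a \<and>
          (\<exists>t' y'. pr t' y' \<epsilon> g \<and> t' = psnd t \<and> y' = y))"])
        (use g h b in auto, simp add: basis_def)
    then have kh: "t \<epsilon> k a \<and> x = dec (Suc i) t" if "pr t x \<epsilon> k h" for t x
      using that kg by fastforce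
    moreover have "\<exists>x. pr t x \<epsilon> k h" if "t \<epsilon> k a" for t
      by (rule graph_domain_image[OF _ that]) (auto simp: h)
    ultimately have "pr t x \<epsilon> k h \<longleftrightarrow> t \<epsilon> k a \<and> x = dec (Suc i) t" for t x by blast
    then show "\<exists>g. (\<forall>t x. pr t x \<epsilon> g \<longleftrightarrow> t \<epsilon> a \<and> x = dec (Suc i) t) \<and>
        (\<forall>t x. pr t x \<epsilon> k g \<longleftrightarrow> t \<epsilon> k a \<and> x = dec (Suc i) t)"
      using h by (intro exI[of _ h]) auto
  qed
qed

lemma preserved_mem: "preserved k (\<lambda>t. dec m t \<epsilon> dec n t)"
  unfolding preserved_def
proof (intro allI impI)
  fix a b w assume b: "\<forall>w. w \<epsilon> b \<longleftrightarrow> w \<epsilon> a \<and> dec m w \<epsilon> dec n w"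
  obtain g where g: "\<And>t x. pr t x \<epsilon> g \<longleftrightarrow> t \<epsilon> a \<and> x = dec m t"
    "\<And>t x. pr t x \<epsilon> k g \<longleftrightarrow> t \<epsilon> k a \<and> x = dec m t"
    using commutes_dec[of m, unfolded commutes_def, THEN spec, of a] by blast
  obtain h where h: "\<And>t x. pr t x \<epsilon> h \<longleftrightarrow> t \<epsilon> a \<and> x = dec n t"
    "\<And>t x. pr t x \<epsilon> k h \<longleftrightarrow> t \<epsilon> k a \<and> x = dec n t"
    using commutes_dec[of n, unfolded commutes_def, THEN spec, of a] by blast
  let ?P = "\<lambda>c a g h. \<forall>t. t \<epsilon> c \<longrightarrow> t \<epsilon> a \<and>
      (\<exists>t1 x. pr t1 x \<epsilon> g \<and> t1 = t \<and> (\<exists>t2 y. pr t2 y \<epsilon> h \<and> t2 = t \<and> x \<epsilon> y))"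
  let ?Q = "\<lambda>c a g h. \<forall>t. t \<epsilon> a \<longrightarrow>
      (\<exists>t1 x. pr t1 x \<epsilon> g \<and> t1 = t \<and> (\<exists>t2 y. pr t2 y \<epsilon> h \<and> t2 = t \<and> x \<epsilon> y)) \<longrightarrow> t \<epsilon> c"
  have "?P (k b) (k a) (k g) (k h)"
    by (rule goodD[where B = ?P]) (simp add: b g h, simp add: basis_def)
  moreover have "?Q (k b) (k a) (k g) (k h)"
    by (rule goodD[where B = ?Q]) (simp add: b g h, simp add: basis_def)
  ultimately show "w \<epsilon> k b \<longleftrightarrow> w \<epsilon> k a \<and> dec m w \<epsilon> dec n w"
    by (simp add: g h) blast
qed

lemma preserved_eq: "preserved k (\<lambda>t. dec m t = dec n t)"
  unfolding preserved_def
proof (intro allI impI)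
  fix a b w assume b: "\<forall>w. w \<epsilon> b \<longleftrightarrow> w \<epsilon> a \<and> dec m w = dec n w"
  obtain g where g: "\<And>t x. pr t x \<epsilon> g \<longleftrightarrow> t \<epsilon> a \<and> x = dec m t"
    "\<And>t x. pr t x \<epsilon> k g \<longleftrightarrow> t \<epsilon> k a \<and> x = dec m t"
    using commutes_dec[of m, unfolded commutes_def, THEN spec, of a] by blast
  obtain h where h: "\<And>t x. pr t x \<epsilon> h \<longleftrightarrow> t \<epsilon> a \<and> x = dec n t"
    "\<And>t x. pr t x \<epsilon> k h \<longleftrightarrow> t \<epsilon> k a \<and> x = dec n t"
    using commutes_dec[of n, unfolded commutes_def, THEN spec, of a] by blast
  let ?P = "\<lambda>c a g h. \<forall>t. t \<epsilon> c \<longrightarrow> t \<epsilon> a \<and>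
      (\<exists>t1 x. pr t1 x \<epsilon> g \<and> t1 = t \<and> (\<exists>t2 y. pr t2 y \<epsilon> h \<and> t2 = t \<and> x = y))"
  let ?Q = "\<lambda>c a g h. \<forall>t. t \<epsilon> a \<longrightarrow>
      (\<exists>t1 x. pr t1 x \<epsilon> g \<and> t1 = t \<and> (\<exists>t2 y. pr t2 y \<epsilon> h \<and> t2 = t \<and> x = y)) \<longrightarrow> t \<epsilon> c"
  have "?P (k b) (k a) (k g) (k h)"
    by (rule goodD[where B = ?P]) (simp add: b g h, simp add: basis_def)
  moreover have "?Q (k b) (k a) (k g) (k h)"
    by (rule goodD[where B = ?Q]) (simp add: b g h, simp add: basis_def)
  ultimately show "w \<epsilon> k b \<longleftrightarrow> w \<epsilon> k a \<and> dec m w = dec n w"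
    by (simp add: g h) blast
qed

lemma preserved_not: "preserved k A \<Longrightarrow> pDef A \<Longrightarrow> preserved k (\<lambda>t. \<not> A t)"
  unfolding preserved_def[of _ "\<lambda>t. \<not> A t"]
proof (intro allI impI)
  fix a b w assume A: "preserved k A" "pDef A" and b: "\<forall>w. w \<epsilon> b \<longleftrightarrow> w \<epsilon> a \<and> \<not> A w"
  have "w \<epsilon> k (Sep a A) \<longleftrightarrow> w \<epsilon> k a \<and> A w" for w
    using A mem_Sep[OF A(2), of _ a] unfolding preserved_def by blast
  moreover have "w \<epsilon> k b \<longleftrightarrow> w \<epsilon> k a \<and> \<not> w \<epsilon> k (Sep a A)"
    by (rule good_diff) (auto simp: b mem_Sep[OF A(2)])
  ultimately show "w \<epsilon> k b \<longleftrightarrow> w \<epsilon> k a \<and> \<not> A w" by blast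
qed

lemma preserved_conj:
  "preserved k A \<Longrightarrow> pDef A \<Longrightarrow> preserved k B \<Longrightarrow> pDef B \<Longrightarrow> preserved k (\<lambda>t. A t \<and> B t)"
  unfolding preserved_def[of _ "\<lambda>t. A t \<and> B t"]
proof (intro allI impI)
  fix a b w assume A: "preserved k A" "pDef A" and B: "preserved k B" "pDef B"
    and b: "\<forall>w. w \<epsilon> b \<longleftrightarrow> w \<epsilon> a \<and> A w \<and> B w"
  have "w \<epsilon> k (Sep a A) \<longleftrightarrow> w \<epsilon> k a \<and> A w" for w
    using A mem_Sep[OF A(2), of _ a] unfolding preserved_def by blast
  moreover have "w \<epsilon> k (Sep a B) \<longleftrightarrow> w \<epsilon> k a \<and> B w" for w
    using B mem_Sep[OF B(2), of _ a] unfolding preserved_def by blast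
  moreover have "w \<epsilon> k b \<longleftrightarrow> w \<epsilon> k (Sep a A) \<and> w \<epsilon> k (Sep a B)"
    by (rule good_int) (auto simp: b mem_Sep[OF A(2)] mem_Sep[OF B(2)])
  ultimately show "w \<epsilon> k b \<longleftrightarrow> w \<epsilon> k a \<and> A w \<and> B w" by blast
qed

lemma preserved_bounded_ex:
  assumes A: "preserved k A" "pDef A"
    and y: "\<And>t. t \<epsilon> y \<longleftrightarrow> t \<epsilon> a \<and> (\<exists>x. x \<epsilon> v \<and> A (pr x t))"
  shows "t \<epsilon> k y \<longleftrightarrow> t \<epsilon> k a \<and> (\<exists>x. x \<epsilon> k v \<and> A (pr x t))"
proof -
  define d where "d = prod v a"
  define c where "c = Sep d A"
  have c: "w \<epsilon> c \<longleftrightarrow> w \<epsilon> d \<and> A w" for w unfolding c_def by (rule mem_Sep[OF A(2)])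
  then have kc: "w \<epsilon> k c \<longleftrightarrow> w \<epsilon> k d \<and> A w" for w using A(1) unfolding preserved_def by blast
  have "\<forall>x. x \<epsilon> k v \<longrightarrow> (\<forall>t. t \<epsilon> k a \<longrightarrow> pr x t \<epsilon> k d)"
    by (rule goodD[where B = "\<lambda>d b a _. \<forall>x. x \<epsilon> b \<longrightarrow> (\<forall>t. t \<epsilon> a \<longrightarrow> pr x t \<epsilon> d)"])
      (simp add: d_def, simp add: basis_def)
  moreover have "\<forall>t. t \<epsilon> k y \<longrightarrow> t \<epsilon> k a \<and> (\<exists>x. x \<epsilon> k v \<and> pr x t \<epsilon> k c)"
    by (rule goodD[where B = "\<lambda>c a b d. \<forall>t. t \<epsilon> c \<longrightarrow> t \<epsilon> a \<and> (\<exists>x. x \<epsilon> b \<and> pr x t \<epsilon> d)"])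
      (simp add: y c d_def, simp add: basis_def)
  moreover have "\<forall>t. t \<epsilon> k a \<longrightarrow> (\<exists>x. x \<epsilon> k v \<and> pr x t \<epsilon> k c) \<longrightarrow> t \<epsilon> k y"
    by (rule goodD[where B = "\<lambda>c a b d. \<forall>t. t \<epsilon> a \<longrightarrow> (\<exists>x. x \<epsilon> b \<and> pr x t \<epsilon> d) \<longrightarrow> t \<epsilon> c"])
      (simp add: y c d_def, simp add: basis_def)
  ultimately show ?thesis using kc by blast
qed

text \<open>If no level bounds the witnesses for \<open>A\<close>, their growth is compared with that of the witnesses for
  the class \<open>A0\<close> at which \<open>k\<close> is continuous, by means of the set relation \<open>H\<close>.\<close>

lemma preserved_ex:
  assumes cofin: "cofin k" and anch: "anchored k" and A: "preserved k A" "pDef A"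
  shows "preserved k (\<lambda>t. \<exists>x. A (pr x t))"
  unfolding preserved_def
proof (intro allI impI)
  fix a b z assume b: "\<forall>w. w \<epsilon> b \<longleftrightarrow> w \<epsilon> a \<and> (\<exists>x. A (pr x w))"
  have AD: "Def UNIV (\<lambda>s. A (f s))" if "DF UNIV f" for f
    by (rule Def_comp1[OF A(2)[unfolded pDef_def] that])
  have Qv: "pDef (\<lambda>t. \<exists>x. x \<epsilon> v \<and> A (pr x t))" for v
    unfolding pDef_def by (intro pDef_intros AD DF_pr)
  define Y where "Y v = Sep a (\<lambda>t. \<exists>x. x \<epsilon> v \<and> A (pr x t))" for v
  have Y: "t \<epsilon> Y v \<longleftrightarrow> t \<epsilon> a \<and> (\<exists>x. x \<epsilon> v \<and> A (pr x t))" for t v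
    unfolding Y_def by (rule mem_Sep[OF Qv])
  have kY: "t \<epsilon> k (Y v) \<longleftrightarrow> t \<epsilon> k a \<and> (\<exists>x. x \<epsilon> k v \<and> A (pr x t))" for t v
    by (rule preserved_bounded_ex[OF A Y])
  have "\<exists>v. z \<epsilon> k (Y v)" if z: "z \<epsilon> k b"
  proof (cases "bounded_on a A")
    case True
    then obtain v where "\<forall>t. t \<epsilon> a \<longrightarrow> (\<exists>x. A (pr x t)) \<longrightarrow> (\<exists>x. x \<epsilon> v \<and> A (pr x t))"
      unfolding bounded_on_def by blast
    then have "b = Y v" using Y b by (intro set_eqI) blast
    then show ?thesis using z by blast
  next
    case False
    then obtain A0 a0 where A0: "pDef A0" "\<not> bounded_on a0 A0" "cont_growth k a0 A0"
      using anch A(2) unfolding anchored_def by blast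
    have A0D: "Def UNIV (\<lambda>s. A0 (f s))" if "DF UNIV f" for f
      by (rule Def_comp1[OF A0(1)[unfolded pDef_def] that])
    have QX: "pDef (\<lambda>t. \<exists>x. A0 (pr x t))" unfolding pDef_def by (intro pDef_intros A0D DF_pr)
    define X where "X = Sep a0 (\<lambda>t. \<exists>x. A0 (pr x t))"
    have X: "t \<epsilon> X \<longleftrightarrow> t \<epsilon> a0 \<and> (\<exists>x. A0 (pr x t))" for t
      unfolding X_def by (rule mem_Sep[OF QX])
    \<comment> \<open>\<open>H\<close> pairs \<open>x\<close> with \<open>t\<close> when a witness
      for \<open>t\<close> in \<open>A\<close> appears no later than the first witness for
      \<open>x\<close> in \<open>A0\<close>.\<close>
    let ?H = "\<lambda>p. \<exists>x t. p = pr x t \<and>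
      (\<forall>v. Lev v \<longrightarrow> (\<exists>y. y \<epsilon> v \<and> A0 (pr y x)) \<longrightarrow> (\<exists>y. y \<epsilon> v \<and> A (pr y t)))"
    have QH: "pDef ?H" unfolding pDef_def by (intro pDef_intros AD A0D DF_pr Def_Lev)
    define H where "H = Sep (prod X b) ?H"
    have H: "pr x t \<epsilon> H \<longleftrightarrow> x \<epsilon> X \<and> t \<epsilon> b \<and>
      (\<forall>v. Lev v \<longrightarrow> (\<exists>y. y \<epsilon> v \<and> A0 (pr y x)) \<longrightarrow> (\<exists>y. y \<epsilon> v \<and> A (pr y t)))" for x t
      unfolding H_def mem_Sep[OF QH] by simp
    \<comment> \<open>Unboundedness of \<open>A0\<close> gives an \<open>x\<close> whose witnesses
      all lie outside a level that already holds one for \<open>t\<close>.\<close>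
    have H_dom: "\<exists>x. x \<epsilon> X \<and> pr x t \<epsilon> H" if t: "t \<epsilon> b" for t
    proof -
      obtain y v where v: "A (pr y t)" "Lev v" "y \<epsilon> v" using t b Lev_cofinal by blast
      obtain x where x: "x \<epsilon> a0" "\<exists>x'. A0 (pr x' x)" "\<not> (\<exists>y. y \<epsilon> v \<and> A0 (pr y x))"
        using A0(2) v(2) unfolding bounded_on_def by blast
      have "\<exists>y. y \<epsilon> v' \<and> A (pr y t)" if v': "Lev v'" "\<exists>y. y \<epsilon> v' \<and> A0 (pr y x)" for v'
      proof -
        have "\<not> v' \<epsilon> v" using v' x(3) Lev_transitive[OF v(2)] subsetD by blast
        then have "subset_of v v'" using Lev_subset_or[OF v(2) v'(1)] by blast
        then show ?thesis using v(1,3) subsetD by blast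
      qed
      then show ?thesis unfolding H X using x t by blast
    qed
    let ?P = "\<lambda>X Y H _. \<forall>t. t \<epsilon> X \<longrightarrow> (\<exists>x. x \<epsilon> Y \<and> pr x t \<epsilon> H)"
    have "\<forall>t. t \<epsilon> k b \<longrightarrow> (\<exists>x. x \<epsilon> k X \<and> pr x t \<epsilon> k H)"
      by (rule goodD[where B = ?P]) (use H_dom in blast, simp add: basis_def)
    then obtain x where x: "x \<epsilon> k X" "pr x z \<epsilon> k H" using z by blast
    \<comment> \<open>Continuity puts \<open>x\<close> into the image of a stage \<open>y0\<close>
      of \<open>X\<close>. By the choice of \<open>H\<close>, everything related to a member of
      \<open>y0\<close> lies in \<open>Y v\<close>, and this passes to the images.\<close>
    obtain v y0 where v: "Lev v" "\<And>t. t \<epsilon> y0 \<longleftrightarrow> t \<epsilon> a0 \<and> (\<exists>x. x \<epsilon> v \<and> A0 (pr x t))" "x \<epsilon> k y0"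
      using A0(3)[unfolded cont_growth_def, THEN spec, of X] X x(1) by blast
    let ?Q = "\<lambda>Y H X _. \<forall>x t. pr x t \<epsilon> H \<longrightarrow> x \<epsilon> Y \<longrightarrow> t \<epsilon> X"
    have "t \<epsilon> Y v" if "pr x t \<epsilon> H" "x \<epsilon> y0" for x t
      unfolding Y using that v(1,2) b unfolding H by blast
    then have "?Q y0 H (Y v) z" by blast
    then have "?Q (k y0) (k H) (k (Y v)) (k z)"
      by (rule goodD[where B = ?Q]) (simp add: basis_def)
    then show ?thesis using x(2) v(3) by blast
  qed
  \<comment> \<open>For the converse direction cofinality suffices: the given witness lies in some
    \<open>k v\<close>.\<close>
  moreover have "z \<epsilon> k b" if z: "z \<epsilon> k a" "A (pr x z)" for x
  proof -
    obtain v where "subset_of (single x) (k v)" using cofin unfolding cofin_def by blast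
    then have "z \<epsilon> k (Y v)" unfolding kY using z by (auto simp: subset_of_def)
    moreover have "subset_of (Y v) b" using b by (auto simp: subset_of_def Y)
    ultimately show ?thesis using good_subset subsetD by blast
  qed
  ultimately show "z \<epsilon> k b \<longleftrightarrow> z \<epsilon> k a \<and> (\<exists>x. A (pr x z))" using kY by blast
qed

lemma preserved_sat:
  assumes cofin: "cofin k" and anch: "anchored k"
  shows "preserved k (\<lambda>t. sat mem (\<lambda>i. dec (\<rho> i) t) \<phi>)"
proof (induction \<phi> arbitrary: \<rho>)
  case (Mem m n)
  show ?case by (simp add: preserved_mem)
next
  case (Eq m n)
  show ?case by (simp add: preserved_eq)
next
  case (Neg \<phi>)
  show ?case using preserved_not[OF Neg pDef_sat] by simp
next
  case (And \<phi> \<psi>)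
  show ?case using preserved_conj[OF And(1) pDef_sat And(2) pDef_sat] by simp
next
  case (Ex n \<phi>)
  define \<sigma> where "\<sigma> = (\<lambda>i. Suc (\<rho> i))(n := 0)"
  have "(\<lambda>i. dec (\<sigma> i) (pr x t)) = (\<lambda>i. dec (\<rho> i) t)(n := x)" for x t
    by (auto simp: \<sigma>_def fun_eq_iff)
  then show ?case using preserved_ex[OF cofin anch Ex[of \<sigma>] pDef_sat] by simp
qed

lemma elementary:
  assumes cofin: "cofin k" and anch: "anchored k" and P: "Def {} (\<lambda>s. P (s 0))"
  shows "P x \<longleftrightarrow> P (k x)"
proof -
  obtain \<phi> where \<phi>: "\<And>s. sat mem s \<phi> = P (s 0)" using P unfolding Def_empty Fm_def by blast
  have "preserved k (\<lambda>t. P (pfst t))"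
    using preserved_sat[OF cofin anch, of "\<lambda>_. 0" \<phi>] by (simp add: \<phi>)
  moreover have Q: "pDef (\<lambda>t. P (pfst t))"
    using pDef_sat[of "\<lambda>_. 0" \<phi>] by (simp add: \<phi>)
  \<comment> \<open>\<open>dec 0\<close> would decompose \<open>x\<close> if \<open>x\<close> were
    itself a pair; \<open>pr x x\<close> is a safe code for it.\<close>
  let ?a = "single (pr x x)"
  have b: "w \<epsilon> Sep ?a (\<lambda>t. P (pfst t)) \<longleftrightarrow> w \<epsilon> ?a \<and> P (pfst w)" for w by (rule mem_Sep[OF Q])
  ultimately have "k (pr x x) \<epsilon> k (Sep ?a (\<lambda>t. P (pfst t))) \<longleftrightarrow> k (pr x x) \<epsilon> k ?a \<and> P (pfst (k (pr x x)))"
    unfolding preserved_def by blast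
  then show ?thesis by (simp add: good_mem b) (simp add: good_pr)
qed

end

subsection \<open>Parametrised classes\<close>

text \<open>A total function, so that parametrised classes can be applied even at parameters for which
  they are not functional.\<close>

definition totalize :: "('a \<Rightarrow> 'a \<Rightarrow> bool) \<Rightarrow> 'a \<Rightarrow> 'a" where
  "totalize R x = (if \<exists>!y. R x y then THE y. R x y else x)"

lemma totalize_graph: "y = totalize R x \<longleftrightarrow> (R x y \<and> (\<forall>y'. R x y' \<longrightarrow> y' = y)) \<or>
    (\<not> (\<exists>z. R x z \<and> (\<forall>y'. R x y' \<longrightarrow> y' = z)) \<and> y = x)"
proof (cases "\<exists>!y. R x y")
  case True
  then obtain z where z: "R x z" "\<And>y'. R x y' \<Longrightarrow> y' = z" by blast
  have "(THE y. R x y) = z" by (rule the_equality) (fact z)+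
  then have "totalize R x = z" using True unfolding totalize_def by simp
  then show ?thesis using z by blast
next
  case False
  then have "totalize R x = x" "\<not> (\<exists>z. R x z \<and> (\<forall>y'. R x y' \<longrightarrow> y' = z))" unfolding totalize_def by (simp, blast)
  then show ?thesis by metis
qed

lemma totalize_eq: "(\<And>y. R x y \<longleftrightarrow> y = f x) \<Longrightarrow> totalize R x = f x"
  using totalize_graph[of "f x" R x] by simp

lemma DF_totalize:
  assumes R: "Def C (\<lambda>s. R (s 0) (s 1) (s 2))" and f: "DF C f" "DF C g"
  shows "DF C (\<lambda>s. totalize (R (f s)) (g s))"
proof -
  have RD: "Def C (\<lambda>s. R (e s) (f s) (g s))" if "DF C e" "DF C f" "DF C g" for e f g
    by (rule Def_comp3[OF R that])
  have "Def C (\<lambda>s. s 0 = totalize (R (s 1)) (s 2))"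
    unfolding totalize_graph by (intro Def_intros RD)
  then show ?thesis
    unfolding DF_def
    by (rule Def_comp3[where P = "\<lambda>y q x. y = totalize (R q) x", OF _ DF_index DF_lift[OF f(1)] DF_lift[OF f(2)]])
qed

definition class_rel :: "fm \<Rightarrow> 'a \<Rightarrow> 'a \<Rightarrow> 'a \<Rightarrow> bool" where
  "class_rel \<phi> q x y \<longleftrightarrow> sat mem ((\<lambda>_. q)(1 := x, 2 := y)) \<phi>"

definition class_fun :: "fm \<Rightarrow> 'a \<Rightarrow> 'a \<Rightarrow> 'a" where
  "class_fun \<phi> q = totalize (class_rel \<phi> q)"

lemma DF_class_fun: "DF C f \<Longrightarrow> DF C g \<Longrightarrow> DF C (\<lambda>s. class_fun \<phi> (f s) (g s))"
proof -
  have "Fm (\<lambda>s. sat mem (\<lambda>i. s (if i = 1 then 1 else if i = 2 then 2 else 0)) \<phi>)"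
    by (rule Fm_rename[of "\<lambda>s. sat mem s \<phi>"]) (auto simp: Fm_def)
  moreover have "(\<lambda>i::nat. s (if i = 1 then 1 else if i = 2 then 2 else 0)) = (\<lambda>_. s 0)(1 := s 1, 2 := s 2)"
    for s :: "nat \<Rightarrow> 'a" by (auto simp: fun_eq_iff)
  ultimately have "Def C (\<lambda>s. class_rel \<phi> (s 0) (s 1) (s 2))"
    unfolding class_rel_def by (intro Fm_imp_Def) (simp only:)
  then show "DF C f \<Longrightarrow> DF C g \<Longrightarrow> ?thesis" unfolding class_fun_def by (rule DF_totalize)
qed

text \<open>The iterate with index \<open>n\<close> of the map defined by \<open>\<phi>\<close> from the parameter \<open>p\<close> is
  \<open>shift_fun \<phi> (pr p n)\<close>.\<close>

definition shift_fun :: "fm \<Rightarrow> 'a \<Rightarrow> 'a \<Rightarrow> 'a" where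
  "shift_fun \<phi> q = totalize (shift_rel (class_fun \<phi> (pfst q)) (psnd q))"

lemma DF_shift_fun: "DF C f \<Longrightarrow> DF C g \<Longrightarrow> DF C (\<lambda>s. shift_fun \<phi> (f s) (g s))"
  unfolding shift_fun_def
  by (rule DF_totalize[where R = "\<lambda>q. shift_rel (class_fun \<phi> (pfst q)) (psnd q)"])
    (unfold shift_rel_def Iter_def chain_def, intro Def_intros DF_pr DF_single DF_emp DF_pfst DF_psnd DF_class_fun)

text \<open>A finite conjunction of formulas is a formula; this is where the finiteness of
  \<open>basis\<close> is used.\<close>

lemma Def_ball_list:
  "(\<And>B. B \<in> set L \<Longrightarrow> Def C (P B)) \<Longrightarrow> Def C (\<lambda>s. \<forall>B \<in> set L. P B s)"
proof (induction L)
  case Nil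
  have "Def C (\<lambda>s. s 0 = s 0)" by (intro Def_intros)
  then show ?case by simp
next
  case (Cons B L)
  then have "Def C (\<lambda>s. P B s \<and> (\<forall>B \<in> set L. P B s))" by (intro Def_conj) auto
  then show ?case by simp
qed

lemma Def_good_shift_fun: "Def C (\<lambda>s. good (shift_fun \<phi> (s 0)))"
  unfolding good_def
proof (rule Def_ball_list)
  fix B assume "B \<in> set basis"
  note B = Fm_imp_Def[OF D0_imp_Fm[OF D0_basis[OF this]]]
  show "Def C (\<lambda>s. \<forall>w x y z. B w x y z \<longrightarrow> B (shift_fun \<phi> (s 0) w) (shift_fun \<phi> (s 0) x) (shift_fun \<phi> (s 0) y) (shift_fun \<phi> (s 0) z))"
    by (intro Def_intros Def_comp4[OF B] DF_shift_fun)
qed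

lemma Def_cofin_shift_fun: "Def C (\<lambda>s. cofin (shift_fun \<phi> (s 0)))"
  unfolding cofin_def by (intro Def_intros Def_subset DF_shift_fun)

lemma dec_foldr_pr: "i < length l \<Longrightarrow> dec i (foldr pr l x) = l ! i"
proof (induction l arbitrary: i)
  case (Cons y l)
  then show ?case by (cases i) simp_all
qed simp

text \<open>All parameters of \<open>A\<close> are packed into one set \<open>r\<close>, which can
  then be quantified inside the structure.\<close>

lemma pDef_uniform:
  assumes "pDef A"
  shows "\<exists>\<Theta> r. Def {} (\<lambda>s. \<Theta> (s 0) (s 1)) \<and> A = \<Theta> r"
proof -
  obtain R l where R: "Fm R" and A: "(\<lambda>s. A (s 0)) = (\<lambda>s. R (foldr case_nat l s))"
    using assms unfolding pDef_def Def_def by blast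
  define \<Theta> where "\<Theta> r t = R (\<lambda>i. if i < length l then dec i r else t)" for r t
  define L where "L = map (\<lambda>i (s :: nat \<Rightarrow> 'a). dec i (s 0)) [0..<length l] @ [\<lambda>s. s 1]"
  have "Def {} (\<lambda>s. R (\<lambda>i. s (min i (length l))))"
    unfolding Def_empty by (rule Fm_rename[OF R])
  moreover have "\<forall>f \<in> set L. DF {} f" by (auto simp: L_def intro: DF_dec DF_index)
  ultimately have "Def {} (\<lambda>s. R (\<lambda>i. (\<lambda>i. if i < length L then (L ! i) s else s (i - length L)) (min i (length l))))"
    by (rule Def_comp_list)
  moreover have "(\<lambda>i. (\<lambda>i. if i < length L then (L ! i) s else s (i - length L)) (min i (length l))) =
      (\<lambda>i. if i < length l then dec i (s 0) else s 1)" for s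
    by (auto simp: fun_eq_iff L_def nth_append min_def)
  ultimately have "Def {} (\<lambda>s. \<Theta> (s 0) (s 1))" unfolding \<Theta>_def by (simp only:)
  moreover have "A = \<Theta> (foldr pr l emp)"
  proof
    fix t
    have "A t = R (foldr case_nat l (\<lambda>_. t))" using fun_cong[OF A, of "\<lambda>_. t"] by simp
    also have "foldr case_nat l (\<lambda>_. t) = (\<lambda>i. if i < length l then dec i (foldr pr l emp) else t)"
      by (auto simp: fun_eq_iff foldr_case_nat dec_foldr_pr)
    finally show "A t = \<Theta> (foldr pr l emp) t" unfolding \<Theta>_def .
  qed
  ultimately show ?thesis by blast
qed

subsection \<open>Continuity at an unbounded class\<close>

text \<open>Points are compared by the first level that holds a witness. The extra point
  \<open>a\<close> is no element of itself, so the conjunct \<open>t \<epsilon> a\<close> makes it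
  count as never having a witness: it lies on top, and strictly below it are exactly the points with
  witnesses. Continuity along the class becomes continuity at one point.\<close>

lemma growth_prewellorder:
  assumes A: "pDef A"
  shows "\<exists>R. pwo R (bin_un a (single a)) \<and> (\<forall>t t'. pr t t' \<epsilon> R \<longleftrightarrow> t \<epsilon> bin_un a (single a) \<and> t' \<epsilon> bin_un a (single a) \<and>
    (\<forall>v. Lev v \<longrightarrow> t' \<epsilon> a \<and> (\<exists>x. x \<epsilon> v \<and> A (pr x t')) \<longrightarrow> t \<epsilon> a \<and> (\<exists>x. x \<epsilon> v \<and> A (pr x t))))"
proof -
  let ?F = "bin_un a (single a)"
  define D where "D v t \<longleftrightarrow> t \<epsilon> a \<and> (\<exists>x. x \<epsilon> v \<and> A (pr x t))" for v t
  have AD: "Def UNIV (\<lambda>s. A (f s))" if "DF UNIV f" for f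
    by (rule Def_comp1[OF A[unfolded pDef_def] that])
  have DD: "Def UNIV (\<lambda>s. D (f s) (g s))" if "DF UNIV f" "DF UNIV g" for f g
    by (rule Def_comp2[OF _ that]) (unfold D_def, intro pDef_intros AD DF_pr)
  have D_mono: "D v t \<Longrightarrow> subset_of v v' \<Longrightarrow> D v' t" for v v' t
    unfolding D_def using subsetD by blast
  let ?R = "\<lambda>p. \<exists>t t'. p = pr t t' \<and> (\<forall>v. Lev v \<longrightarrow> D v t' \<longrightarrow> D v t)"
  have QR: "pDef ?R" unfolding pDef_def by (intro pDef_intros DD DF_pr Def_Lev)
  define R where "R = Sep (prod ?F ?F) ?R"
  have R: "pr t t' \<epsilon> R \<longleftrightarrow> t \<epsilon> ?F \<and> t' \<epsilon> ?F \<and> (\<forall>v. Lev v \<longrightarrow> D v t' \<longrightarrow> D v t)" for t t'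
    unfolding R_def mem_Sep[OF QR] by (simp del: mem_bin_un)
  have total: "pr t t' \<epsilon> R \<or> pr t' t \<epsilon> R" if F: "t \<epsilon> ?F" "t' \<epsilon> ?F" for t t'
  proof (rule ccontr)
    assume "\<not> ?thesis"
    then obtain v v' where v: "Lev v" "D v t'" "\<not> D v t" and v': "Lev v'" "D v' t" "\<not> D v' t'"
      unfolding R using F by blast
    show False
      using Lev_subset_or[OF v(1) v'(1)] D_mono v v' Lev_transitive[OF v(1)] by blast
  qed
  have least: "\<exists>m. m \<epsilon> Y \<and> (\<forall>y. y \<epsilon> Y \<longrightarrow> pr m y \<epsilon> R)" if Y: "subset_of Y ?F" "Y \<noteq> emp" for Y
  proof (cases "\<exists>v. Lev v \<and> (\<exists>t. t \<epsilon> Y \<and> D v t)")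
    case True
    have Q: "pDef (\<lambda>v. \<exists>t. t \<epsilon> Y \<and> D v t)" unfolding pDef_def by (intro pDef_intros DD)
    obtain v0 where v0: "Lev v0" "\<exists>t. t \<epsilon> Y \<and> D v0 t" using True by blast
    obtain v where v: "Lev v" "\<exists>t. t \<epsilon> Y \<and> D v t"
      and min: "\<And>w t. w \<epsilon> v \<Longrightarrow> Lev w \<Longrightarrow> t \<epsilon> Y \<Longrightarrow> \<not> D w t"
      using Lev_least[OF Q v0] by blast
    then obtain m where m: "m \<epsilon> Y" "D v m" by blast
    have "D v' m" if "y \<epsilon> Y" "Lev v'" "D v' y" for y v'
      using Lev_subset_or[OF v(1) that(2)] min[of v' y] that D_mono m(2) by blast
    then show ?thesis using m(1) Y(1) subsetD unfolding R by blast
  next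
    case False
    obtain m where "m \<epsilon> Y" using not_empD[OF Y(2)] by blast
    then show ?thesis using False Y(1) subsetD unfolding R by blast
  qed
  have "x \<epsilon> ?F \<and> y \<epsilon> ?F" if "pr x y \<epsilon> R" for x y using that unfolding R by blast
  moreover have "pr x z \<epsilon> R" if "pr x y \<epsilon> R" "pr y z \<epsilon> R" for x y z using that unfolding R by blast
  ultimately have "lin R ?F" using total unfolding lin_def by blast
  then have "pwo R ?F" unfolding pwo_def using least by blast
  then show ?thesis using R unfolding D_def by blast
qed

text \<open>Continuity bounds \<open>z\<close> by some \<open>k y\<close> with \<open>y\<close> in
  \<open>X\<close>. For a level holding a witness for \<open>y\<close>, the stage \<open>Y\<close>
  contains \<open>y\<close> and is closed downwards in \<open>R\<close>; both facts are bounded, so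
  \<open>z\<close> falls into \<open>k Y\<close>.\<close>

lemma continuous_at_imp_cont_growth:
  assumes A: "pDef A" and k: "pres k"
    and R: "\<forall>t t'. pr t t' \<epsilon> R \<longleftrightarrow> t \<epsilon> bin_un a (single a) \<and> t' \<epsilon> bin_un a (single a) \<and>
    (\<forall>v. Lev v \<longrightarrow> t' \<epsilon> a \<and> (\<exists>x. x \<epsilon> v \<and> A (pr x t')) \<longrightarrow> t \<epsilon> a \<and> (\<exists>x. x \<epsilon> v \<and> A (pr x t)))"
    and c: "continuous_at k R a"
  shows "cont_growth k a A"
  unfolding cont_growth_def
proof (intro allI impI)
  fix X z assume X: "\<forall>t. t \<epsilon> X \<longleftrightarrow> t \<epsilon> a \<and> (\<exists>x. A (pr x t))" and z: "z \<epsilon> k X"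
  have AD: "Def UNIV (\<lambda>s. A (f s))" if "DF UNIV f" for f
    by (rule Def_comp1[OF A[unfolded pDef_def] that])
  have lt_iff: "lt R t a \<longleftrightarrow> t \<epsilon> X" for t
  proof
    assume t: "t \<epsilon> X"
    then obtain x v where "A (pr x t)" "Lev v" "x \<epsilon> v" using X Lev_cofinal by blast
    moreover have "t \<epsilon> a" using t X by blast
    ultimately show "lt R t a" unfolding R[rule_format] by auto
  next
    assume "lt R t a"
    then have "t \<epsilon> a" "\<not> (\<forall>v. Lev v \<longrightarrow> t \<epsilon> a \<and> (\<exists>x. x \<epsilon> v \<and> A (pr x t)) \<longrightarrow> False)"
      unfolding R[rule_format] by auto
    then show "t \<epsilon> X" using X by blast
  qed
  let ?P = "\<lambda>X R a. \<forall>t. t \<epsilon> X \<longrightarrow> lt R t a"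
  have "?P X R a" using lt_iff by blast
  then have "?P (k X) (k R) (k a)" by (rule pres3D[OF k, where B = ?P]) (intro D0_intros)
  then obtain y where y: "lt R y a" "pr z (k y) \<epsilon> k R" using z c unfolding continuous_at_def by blast
  then have "y \<epsilon> X" using lt_iff by blast
  then obtain x v where v: "y \<epsilon> a" "A (pr x y)" "Lev v" "x \<epsilon> v" using X Lev_cofinal by blast
  let ?D = "\<lambda>t. \<exists>x. x \<epsilon> v \<and> A (pr x t)"
  have QD: "pDef ?D" unfolding pDef_def by (intro pDef_intros AD DF_pr)
  define Y where "Y = Sep a ?D"
  have Y: "t \<epsilon> Y \<longleftrightarrow> t \<epsilon> a \<and> ?D t" for t unfolding Y_def by (rule mem_Sep[OF QD])
  let ?P = "\<lambda>R Y. \<forall>t t'. pr t t' \<epsilon> R \<longrightarrow> t' \<epsilon> Y \<longrightarrow> t \<epsilon> Y"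
  have "?P R Y" unfolding R[rule_format] Y using v(3) by blast
  then have "?P (k R) (k Y)" by (rule pres2D[OF k, where B = ?P]) (intro D0_intros)
  moreover have "k y \<epsilon> k Y" using v Y pres_mem[OF k] by blast
  ultimately have "z \<epsilon> k Y" using y(2) by blast
  then show "\<exists>v Y. Lev v \<and> (\<forall>t. t \<epsilon> Y \<longleftrightarrow> t \<epsilon> a \<and> (\<exists>x. x \<epsilon> v \<and> A (pr x t))) \<and> z \<epsilon> k Y"
    using v(3) Y by blast
qed

subsection \<open>Non-definability\<close>

text \<open>The minimum is taken over all parameters \<open>q\<close> at once, which removes the
  parameter from its definition. \<open>anc\<close> is a first-order condition sufficient for
  \<open>anchored\<close>.\<close>

lemma no_definable_family:
  assumes anc: "Def {} (\<lambda>s. anc (s 0))" "\<And>q. anc q \<Longrightarrow> anchored (shift_fun \<phi> q)"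
    and q0: "good (shift_fun \<phi> q0)" "cofin (shift_fun \<phi> q0)" "anc q0" "shift_fun \<phi> q0 x0 \<noteq> x0"
  shows False
proof -
  define Q where "Q u \<longleftrightarrow> (\<exists>q x. good (shift_fun \<phi> q) \<and> cofin (shift_fun \<phi> q) \<and> anc q \<and> subset_of x u \<and> shift_fun \<phi> q x \<noteq> x)" for u
  have QD: "Def C (\<lambda>s. Q (f s))" if "DF C f" for C f
    by (rule Def_comp1[OF _ that], unfold Q_def,
        intro Def_intros Def_comp1[OF Def_good_shift_fun] Def_comp1[OF Def_cofin_shift_fun] Def_subset DF_shift_fun
          Def_comp1[OF Fm_imp_Def[OF anc(1)[unfolded Def_empty]]])
  define least where "least u \<longleftrightarrow> Lev u \<and> Q u \<and> (\<forall>w. w \<epsilon> u \<longrightarrow> Lev w \<longrightarrow> \<not> Q w)" for u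
  have leastD: "Def {} (\<lambda>s. least (s 0))" unfolding least_def by (intro Def_intros Def_Lev QD)
  obtain v0 where v0: "Lev v0" "subset_of x0 v0" using Lev_cofinal_subset by blast
  then have "Q v0" unfolding Q_def using q0 by blast
  have "pDef Q" unfolding pDef_def by (intro QD DF_index)
  from Lev_least[OF this v0(1) \<open>Q v0\<close>] obtain u where u: "least u" unfolding least_def by blast
  then obtain q x where good: "good (shift_fun \<phi> q)" and cofin: "cofin (shift_fun \<phi> q)" and q: "anc q"
    and x: "subset_of x u" "shift_fun \<phi> q x \<noteq> x"
    unfolding least_def Q_def by blast
  let ?k = "shift_fun \<phi> q"
  \<comment> \<open>Only one level satisfies \<open>least\<close>, by linearity, so an elementary
    map must fix it. Then all elements of \<open>u\<close> are fixed, hence all its subsets, against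
    the choice of \<open>x\<close>.\<close>
  have "least (?k u)" using elementary[OF good cofin anc(2)[OF q] leastD] u by blast
  then have ku: "?k u = u" using u Lev_linear unfolding least_def by blast
  have fixed: "?k y = y" if "y \<epsilon> u" for y
  proof -
    obtain c where c: "c \<epsilon> u" "Lev c" "subset_of y c"
      using Lev_below[OF _ \<open>y \<epsilon> u\<close>] u unfolding least_def by blast
    then have "\<not> Q c" using u unfolding least_def by blast
    then show ?thesis unfolding Q_def using good cofin q c(3) by blast
  qed
  have "subset_of (?k x) u" using good_subset[OF good x(1)] ku by simp
  then have "w \<epsilon> ?k x \<longleftrightarrow> w \<epsilon> x" for w
    using fixed[of w] good_mem[OF good, of w x] x(1) unfolding subset_of_def by metis
  then show False using x(2) set_eqI by blast
qed

lemma no_definable_embedding: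
  assumes S: "Sigma1_elementary mem j" and "j \<noteq> id" and j: "\<And>x y. class_rel \<phi> p x y \<longleftrightarrow> y = j x"
  shows False
proof -
  have jf: "class_fun \<phi> p = j"
    unfolding class_fun_def by (rule ext, rule totalize_eq) (rule j)
  have "pDefF (class_fun \<phi> p)" unfolding pDefF_def by (intro pDef_intros DF_class_fun)
  then have jdef: "pDefF j" by (simp add: jf)
  obtain u where u: "\<And>y. y \<epsilon> u \<Longrightarrow> j y = y" "u \<epsilon> j u" "Lev (j u)"
    using critical_level[OF S jdef \<open>j \<noteq> id\<close>] by blast
  note ctx = S jdef u
  obtain x where x: "j x \<noteq> x" using \<open>j \<noteq> id\<close> by (metis eq_id_iff)
  have shift_fun: "shift_fun \<phi> (pr p n) = shift j n" if "n \<epsilon> omega u" for n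
    unfolding shift_fun_def by (rule ext, rule totalize_eq) (simp add: jf shift_rel_shift[OF ctx that])
  have moved: "shift j n (iter j n x) \<noteq> iter j n x" if "n \<epsilon> omega u" for n
    using x shift_iter[OF ctx that, of x] pres_eq[OF emb_pres[OF emb_iter[OF ctx that]], of "j x" x] by simp
  have contra: False if "Def {} (\<lambda>s. anc (s 0))" "\<And>q. anc q \<Longrightarrow> anchored (shift_fun \<phi> q)"
    "n \<epsilon> omega u" "anc (pr p n)" for anc n
    by (rule no_definable_family[OF that(1,2) _ _ that(4), of "iter j n x"])
      (auto simp: shift_fun[OF that(3)] moved[OF that(3)]
        intro: pres_good emb_pres emb_cofin emb_shift[OF ctx that(3)])
  \<comment> \<open>This distinction is made outside the structure. If Collection holds, the trivial
    \<open>anc\<close> and the index \<open>emp\<close> do. Otherwise the scheme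
    \<open>\<Theta>\<close> of one failing class is fixed, and only its parameter and the set
    \<open>a\<close> are quantified inside, so \<open>anc\<close> has no parameters.\<close>
  show False
  proof (cases "\<forall>A a. pDef A \<longrightarrow> bounded_on a A")
    case True
    have "Def {} (\<lambda>s. s 0 = s 0)" by (intro Def_intros)
    then show False
      by (rule contra[where anc = "\<lambda>q. q = q"]) (use True emp_omega[OF ctx] in \<open>auto simp: anchored_def\<close>)
  next
    case False
    then obtain A a where A: "pDef A" "\<not> bounded_on a A" by blast
    then obtain \<Theta> r where \<Theta>: "Def {} (\<lambda>s. \<Theta> (s 0) (s 1))" and Ar: "A = \<Theta> r"
      using pDef_uniform by blast
    have \<Theta>D: "Def C (\<lambda>s. \<Theta> (f s) (g s))" if "DF C f" "DF C g" for C f g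
      by (rule Def_comp2[OF Fm_imp_Def[OF \<Theta>[unfolded Def_empty]] that])
    have pD: "pDef (\<Theta> r)" for r unfolding pDef_def by (intro \<Theta>D pDef_intros)
    define anc where "anc q \<longleftrightarrow> (\<exists>r a. \<not> bounded_on a (\<Theta> r) \<and> cont_growth (shift_fun \<phi> q) a (\<Theta> r))" for q
    have "Def {} (\<lambda>s. anc (s 0))"
      unfolding anc_def bounded_on_def cont_growth_def by (intro Def_intros \<Theta>D Def_Lev DF_shift_fun DF_pr)
    moreover have "anchored (shift_fun \<phi> q)" if "anc q" for q
      using that pD unfolding anc_def anchored_def by blast
    moreover obtain R where pwo: "pwo R (bin_un a (single a))"
      and R: "\<forall>t t'. pr t t' \<epsilon> R \<longleftrightarrow> t \<epsilon> bin_un a (single a) \<and> t' \<epsilon> bin_un a (single a) \<and>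
        (\<forall>v. Lev v \<longrightarrow> t' \<epsilon> a \<and> (\<exists>x. x \<epsilon> v \<and> A (pr x t')) \<longrightarrow> t \<epsilon> a \<and> (\<exists>x. x \<epsilon> v \<and> A (pr x t)))"
      using growth_prewellorder[OF A(1), of a] by blast
    obtain n where n: "n \<epsilon> omega u" "continuous_at (shift j n) R a"
      using continuous_iterate[OF ctx pwo, of a] by auto
    have "cont_growth (shift j n) a A"
      by (rule continuous_at_imp_cont_growth[OF A(1) emb_pres[OF emb_shift[OF ctx n(1)]] R n(2)])
    then have "anc (pr p n)" unfolding anc_def shift_fun[OF n(1)] using A(2) Ar by blast
    ultimately show False using contra n(1) by blast
  qed
qed

end

theorem theorem2p3:
  fixes mem :: "'a \<Rightarrow> 'a \<Rightarrow> bool" and \<phi> :: fm and p :: 'a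
  assumes "RL mem"
  shows "\<not> (\<exists>j :: 'a \<Rightarrow> 'a. Sigma1_elementary mem j \<and> j \<noteq> id \<and>
    defined_class mem \<phi> p = {(x, y). y = j x})"
proof
  assume "\<exists>j :: 'a \<Rightarrow> 'a. Sigma1_elementary mem j \<and> j \<noteq> id \<and> defined_class mem \<phi> p = {(x, y). y = j x}"
  then obtain j :: "'a \<Rightarrow> 'a" where j: "Sigma1_elementary mem j" "j \<noteq> id"
    "defined_class mem \<phi> p = {(x, y). y = j x}" by blast
  interpret RL mem by fact
  have "class_rel \<phi> p x y \<longleftrightarrow> y = j x" for x y
    using j(3) unfolding class_rel_def defined_class_def by (auto simp: set_eq_iff)
  then show False by (rule no_definable_embedding[OF j(1,2)])
qed

end
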